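(* Let $\beta,L>0$, $\theta_0\in\mathbb{R}^d$, and let $\delta_n>0$ be such that $\delta_n\to0$ and $n\delta_n\to\infty$. For each $f\in\mathcal{P}_C(\beta,L)$ let $\mathbb{P}=\mathbb{P}_f$ denote the law under which $\{X(t),t\in\mathbb{R}^d\}$ is a zero-mean real stationary Gaussian process in $\mathbb{H}$ with spectral density $f$. Let $\mathcal{M}_n$ be the class of all possible estimators $f_n$ of $f$ based on the observations $X(k\delta_n)$, $k\in\{1,\dots,n\}^d$. Then $$\liminf_{n\to\infty}\ \inf_{f_n\in\mathcal{M}_n}\ \sup_{f\in\mathcal{P}_C(\beta,L)}\mathbb{P}\Big(\|f_n(\theta_0)-f(\theta_0)\|_{\rm HS}\ge(n\delta_n)^{-\frac{d\beta}{2\beta+d}}\Big)>0.$$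
   Context: $\mathbb{H}\neq\{0\}$ is a separable complex Hilbert space with a fixed complete orthonormal system $\{e_j\}$ (the "real" CONS); $x\in\mathbb{H}$ is real if all $\langle x,e_j\rangle$ are real; a process is real if all its values are real. $x\otimes y$ is the operator $z\mapsto x\langle z,y\rangle$; $\|\cdot\|_{\rm tr}$, $\|\cdot\|_{\rm HS}$ are the trace and Hilbert–Schmidt norms. For a real zero-mean stationary process indexed by $\mathbb{R}^d$, $C(h)=\mathbb{E}[X(t+h)\otimes X(t)]$, and its spectral density (when $\int\|C(h)\|_{\rm tr}dh<\infty$) is $f(\theta)=(2\pi)^{-d}\int_{\mathbb{R}^d}e^{\mathrm{i}h^\top\theta}C(h)\,dh$. $\mathcal{P}_C(\beta,L)$ is the class of spectral densities of such processes with $\int_{\mathbb{R}^d}(1+\|x\|_2^\beta)\|C(x)\|_{\rm tr}\,dx\le L$. An estimator $f_n(\theta_0)$ is any measurable function of the observations with values in the Hilbert–Schmidt operators on $\mathbb{H}$. *)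

theory Defs
  imports "HOL-Probability.Probability"
begin

section \<open>Complex Hilbert spaces\<close>

class complex_hilbert_space = banach +
  fixes scaleC :: "complex \<Rightarrow> 'a \<Rightarrow> 'a" (infixr "*\<^sub>C" 75)
    and cinner :: "'a \<Rightarrow> 'a \<Rightarrow> complex"
  assumes scaleR_scaleC: "scaleR r x = complex_of_real r *\<^sub>C x"
    and scaleC_add_right: "c *\<^sub>C (x + y) = c *\<^sub>C x + c *\<^sub>C y"
    and scaleC_add_left: "(b + c) *\<^sub>C x = b *\<^sub>C x + c *\<^sub>C x"
    and scaleC_scaleC: "b *\<^sub>C (c *\<^sub>C x) = (b * c) *\<^sub>C x"
    and cinner_add_left: "cinner (x + y) z = cinner x z + cinner y z"
    and cinner_scaleC_left: "cinner (c *\<^sub>C x) y = c * cinner x y"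
    and cinner_commute: "cinner x y = cnj (cinner y x)"
    and cinner_self: "cinner x x = complex_of_real ((norm x)\<^sup>2)"

definition complete_orthonormal_system :: "'h::complex_hilbert_space set \<Rightarrow> bool" where
  "complete_orthonormal_system E \<longleftrightarrow>
     (\<forall>e\<in>E. \<forall>e'\<in>E. cinner e e' = (if e = e' then 1 else 0)) \<and>
     (\<forall>x. (\<forall>e\<in>E. cinner x e = 0) \<longrightarrow> x = 0)"

definition real_element :: "'h::complex_hilbert_space set \<Rightarrow> 'h \<Rightarrow> bool" where
  "real_element E x \<longleftrightarrow> (\<forall>e\<in>E. cinner x e \<in> \<real>)"


section \<open>Operators, trace norm and Hilbert--Schmidt norm\<close>

definition bounded_clinear ::
  "('h::complex_hilbert_space \<Rightarrow> 'h) \<Rightarrow> bool" where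
  "bounded_clinear A \<longleftrightarrow> bounded_linear A \<and> (\<forall>c x. A (c *\<^sub>C x) = c *\<^sub>C A x)"

definition tensor :: "'h::complex_hilbert_space \<Rightarrow> 'h \<Rightarrow> 'h \<Rightarrow> 'h" where
  "tensor x y = (\<lambda>z. cinner z y *\<^sub>C x)"

definition cadjoint :: "('h::complex_hilbert_space \<Rightarrow> 'h) \<Rightarrow> 'h \<Rightarrow> 'h" where
  "cadjoint A = (THE B. \<forall>x y. cinner (A x) y = cinner x (B y))"

definition positive_operator :: "('h::complex_hilbert_space \<Rightarrow> 'h) \<Rightarrow> bool" where
  "positive_operator S \<longleftrightarrow>
     bounded_clinear S \<and> (\<forall>x. cinner (S x) x \<in> \<real> \<and> 0 \<le> Re (cinner (S x) x))"

definition abs_operator :: "('h::complex_hilbert_space \<Rightarrow> 'h) \<Rightarrow> 'h \<Rightarrow> 'h" where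
  "abs_operator A = (THE S. positive_operator S \<and> S \<circ> S = cadjoint A \<circ> A)"

text \<open>The trace norm is the trace of \<open>|A|\<close>, with value \<open>\<infinity>\<close> if \<open>A\<close> is bounded but not of trace
  class. Neither it nor the Hilbert--Schmidt norm depends on the complete orthonormal system \<open>E\<close>.\<close>

definition trace_norm ::
  "'h::complex_hilbert_space set \<Rightarrow> ('h \<Rightarrow> 'h) \<Rightarrow> ennreal" where
  "trace_norm E A = (\<Sum>\<^sub>\<infinity>e\<in>E. ennreal (Re (cinner (abs_operator A e) e)))"

definition hs_operators ::
  "'h::complex_hilbert_space set \<Rightarrow> ('h \<Rightarrow> 'h) set" where
  "hs_operators E = {A. bounded_clinear A \<and> (\<lambda>e. (norm (A e))\<^sup>2) summable_on E}"

definition hs_norm ::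
  "'h::complex_hilbert_space set \<Rightarrow> ('h \<Rightarrow> 'h) \<Rightarrow> real" where
  "hs_norm E A = sqrt (\<Sum>\<^sub>\<infinity>e\<in>E. (norm (A e))\<^sup>2)"

definition hs_borel ::
  "'h::complex_hilbert_space set \<Rightarrow> ('h \<Rightarrow> 'h) measure" where
  "hs_borel E = sigma (hs_operators E)
     {U. openin (Metric_space.mtopology (hs_operators E) (\<lambda>A B. hs_norm E (\<lambda>z. A z - B z))) U}"


section \<open>Real stationary processes and their spectral densities\<close>

text \<open>Processes are represented by their laws on the space of all real paths with the product
  sigma-algebra; the process is then the coordinate process \<open>\<lambda>t \<omega>. \<omega> t\<close>.\<close>

definition real_path_space ::
  "'h::{complex_hilbert_space, second_countable_topology} set \<Rightarrow> ((real^'d) \<Rightarrow> 'h) measure" where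
  "real_path_space E = Pi\<^sub>M UNIV (\<lambda>_. restrict_space borel {x. real_element E x})"

text \<open>Expectations and integrals of operator-valued functions are taken pointwise in the argument
  \<open>z\<close>. Where the Bochner integral in trace norm exists, this gives the same operator, because
  evaluation at \<open>z\<close> is continuous.\<close>

definition cross_covariance ::
  "((real^'d) \<Rightarrow> 'h::{complex_hilbert_space, second_countable_topology}) measure
     \<Rightarrow> real^'d \<Rightarrow> real^'d \<Rightarrow> 'h \<Rightarrow> 'h" where
  "cross_covariance P s t = (\<lambda>z. LINT \<omega>|P. tensor (\<omega> s) (\<omega> t) z)"

text \<open>Mean-square continuity is part of the notion of stationary process used here. Without it the
  spectral density would not determine the covariance function: adding an independent process with
  covariance \<open>A\<close> at lag \<open>0\<close> and \<open>0\<close> at all other lags changes no integral of \<open>C\<close>.\<close>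

definition real_stationary_law ::
  "'h::{complex_hilbert_space, second_countable_topology} set
     \<Rightarrow> ((real^'d) \<Rightarrow> 'h) measure \<Rightarrow> bool" where
  "real_stationary_law E P \<longleftrightarrow>
     prob_space P \<and> sets P = sets (real_path_space E) \<and>
     (\<forall>t. integrable P (\<lambda>\<omega>. (norm (\<omega> t))\<^sup>2)) \<and>
     (\<forall>t. (LINT \<omega>|P. \<omega> t) = 0) \<and>
     (\<forall>t h. cross_covariance P (t + h) t = cross_covariance P h 0) \<and>
     (\<forall>t. ((\<lambda>s. LINT \<omega>|P. (norm (\<omega> s - \<omega> t))\<^sup>2) \<longlongrightarrow> 0) (at t))"

definition autocovariance ::
  "((real^'d) \<Rightarrow> 'h::{complex_hilbert_space, second_countable_topology}) measure
     \<Rightarrow> real^'d \<Rightarrow> 'h \<Rightarrow> 'h" where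
  "autocovariance P h = cross_covariance P h 0"

definition spectral_density ::
  "((real^'d) \<Rightarrow> 'h::{complex_hilbert_space, second_countable_topology}) measure
     \<Rightarrow> real^'d \<Rightarrow> 'h \<Rightarrow> 'h" where
  "spectral_density P \<theta> = (\<lambda>z. complex_of_real (1 / (2 * pi) ^ CARD('d)) *\<^sub>C
     (LINT h|lborel. exp (\<i> * complex_of_real (h \<bullet> \<theta>)) *\<^sub>C autocovariance P h z))"

definition has_spectral_density ::
  "'h::{complex_hilbert_space, second_countable_topology} set
     \<Rightarrow> ((real^'d) \<Rightarrow> 'h) measure \<Rightarrow> (real^'d \<Rightarrow> 'h \<Rightarrow> 'h) \<Rightarrow> bool" where
  "has_spectral_density E P f \<longleftrightarrow>
     (\<integral>\<^sup>+h. trace_norm E (autocovariance P h) \<partial>lborel) < \<infinity> \<and> f = spectral_density P"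

definition spectral_class ::
  "'h::{complex_hilbert_space, second_countable_topology} set
     \<Rightarrow> real \<Rightarrow> real \<Rightarrow> (real^'d \<Rightarrow> 'h \<Rightarrow> 'h) set" where
  "spectral_class E \<beta> L = {f. \<exists>P. real_stationary_law E P \<and> has_spectral_density E P f \<and>
     (\<integral>\<^sup>+x. ennreal (1 + norm x powr \<beta>) * trace_norm E (autocovariance P x) \<partial>lborel)
       \<le> ennreal L}"


section \<open>Gaussian processes\<close>

text \<open>Point masses count as (degenerate) normal distributions. On real paths the functionals
  \<open>x \<mapsto> Re (cinner x a)\<close> are exactly the bounded real-linear functionals, so \<open>gaussian_law\<close> says that
  all finite-dimensional distributions are Gaussian.\<close>

definition gaussian_variable :: "'w measure \<Rightarrow> ('w \<Rightarrow> real) \<Rightarrow> bool" where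
  "gaussian_variable M Y \<longleftrightarrow> Y \<in> borel_measurable M \<and>
     ((\<exists>\<mu> \<sigma>. 0 < \<sigma> \<and> distributed M lborel Y (\<lambda>x. ennreal (normal_density \<mu> \<sigma> x))) \<or>
      (\<exists>c. AE \<omega> in M. Y \<omega> = c))"

definition gaussian_law ::
  "((real^'d) \<Rightarrow> 'h::{complex_hilbert_space, second_countable_topology}) measure \<Rightarrow> bool" where
  "gaussian_law P \<longleftrightarrow>
     (\<forall>T a. finite T \<longrightarrow> gaussian_variable P (\<lambda>\<omega>. \<Sum>t\<in>T. Re (cinner (\<omega> t) (a t))))"

text \<open>For every \<open>f\<close> there is at most one such law: the covariance function is continuous and integrable, hence
  determined by its Fourier transform \<open>f\<close>, and it determines the finite-dimensional distributions
  of a centered real Gaussian process.\<close>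

definition gaussian_spectral_laws ::
  "'h::{complex_hilbert_space, second_countable_topology} set
     \<Rightarrow> (real^'d \<Rightarrow> 'h \<Rightarrow> 'h) \<Rightarrow> ((real^'d) \<Rightarrow> 'h) measure set" where
  "gaussian_spectral_laws E f =
     {P. real_stationary_law E P \<and> gaussian_law P \<and> has_spectral_density E P f}"


section \<open>Observations and estimators\<close>

definition grid :: "nat \<Rightarrow> (nat^'d) set" where
  "grid n = {k. \<forall>i. k $ i \<in> {1..n}}"

definition observations ::
  "real \<Rightarrow> nat \<Rightarrow> (real^'d \<Rightarrow> 'h) \<Rightarrow> nat^'d \<Rightarrow> 'h" where
  "observations \<delta> n \<omega> = (\<lambda>k\<in>grid n. \<omega> (\<chi> i. \<delta> * real (k $ i)))"

definition estimators ::
  "'h::{complex_hilbert_space, second_countable_topology} set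
     \<Rightarrow> nat \<Rightarrow> ((nat^'d \<Rightarrow> 'h) \<Rightarrow> real^'d \<Rightarrow> 'h \<Rightarrow> 'h) set" where
  "estimators E n =
     {g. \<forall>\<theta>. (\<lambda>x. g x \<theta>) \<in> measurable (Pi\<^sub>M (grid n) (\<lambda>_. borel)) (hs_borel E)}"

end

theory Submission
  imports Defs
begin

text \<open>The bound is Le Cam's two-point method, applied to processes \<open>X(t) = \<xi>(t) e\<close> with a fixed
  \<open>e \<in> E\<close> and a scalar stationary Gaussian field \<open>\<xi>\<close>. Write \<open>N = n \<delta>\<^sub>n\<close>, \<open>h = N powr (- d / (2 \<beta> + d))\<close>
  and \<open>r = h powr \<beta>\<close>, the claimed rate. The first covariance function is an integrable function which
  on the observation grid is \<open>a \<delta>\<^sub>n\<^sup>-\<^sup>d\<close> times white noise; the second adds \<open>\<alpha> exp(-w\<^sup>2|t|\<^sup>2/2) cos(\<theta>\<^sub>0\<cdot>t)\<close>,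
  whose Fourier transform has bumps of width \<open>w\<close>, proportional to \<open>h\<close>, and of height proportional
  to \<open>r\<close> at \<open>\<plusminus>\<theta>\<^sub>0\<close>. Up to scaling, the observations have covariance matrices \<open>I\<close> and \<open>I + M\<close> with
  \<open>M\<close> positive semidefinite, and \<open>\<Sum>M\<^sub>i\<^sub>j\<^sup>2\<close> is of the order \<open>r\<^sup>2 h\<^sup>d N\<^sup>d = 1\<close>. With a Cholesky factor of \<open>I + M\<close>
  the relative entropy is bounded by this sum, and the Gibbs variational inequality turns the bound
  into a lower bound for the error probability of any test between the two hypotheses. Both fields
  exist because their covariance functions are absolutely convergent sums \<open>\<Sum>\<psi>\<^sub>k(s) \<psi>\<^sub>k(t)\<close>, so that
  \<open>\<xi>(t) = \<Sum>\<psi>\<^sub>k(t) \<xi>\<^sub>k\<close> with independent standard normal \<open>\<xi>\<^sub>k\<close>.\<close>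

section \<open>Complete orthonormal systems and Hilbert--Schmidt operators\<close>

text \<open>Two balances force the exponent. By scaling, a bump covariance of amplitude \<alpha> and
  inverse range w has spectral height r of order \<alpha> w^-d and weighted integral of order r (1 +
  w^-\<beta>), so membership in the class permits r of order w^\<beta>. On the grid its squared
  entries sum to order \<alpha>^2 (n / (w \<delta>))^d; measured against the squared noise level
  \<delta>^(-2d) this is r^2 w^d (n \<delta>)^d, which has to stay bounded. The obstacle is the
  conditioning of sampled covariance matrices: for a fixed continuous covariance the smallest
  eigenvalue tends to 0 with the grid spacing, and an entropy bound would need control of inverses.
  The null law therefore changes with n, in such a way that its sampled covariance is exactly a
  multiple of the identity while its weighted integral stays bounded. Fields along a single basis
  vector suffice, because on multiples of one rank-one projection the trace norm and the
  Hilbert-Schmidt norm both are the modulus of the factor. Positivity of the perturbed spectral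
  density is never checked: it is built into the sums of products that define the
  covariances.\<close>

lemma scaleC_of_real: "complex_of_real r *\<^sub>C x = r *\<^sub>R (x::'h::complex_hilbert_space)"
  by (simp add: scaleR_scaleC)

lemma scaleC_zero_left [simp]: "0 *\<^sub>C (x::'h::complex_hilbert_space) = 0"
  using scaleC_of_real[of 0 x] by simp

lemma scaleC_zero_right [simp]: "c *\<^sub>C (0::'h::complex_hilbert_space) = 0"
  using scaleC_scaleC[of c 0 "0::'h"] by simp

lemma cinner_zero_left [simp]: "cinner 0 (y::'h::complex_hilbert_space) = 0"
  using cinner_scaleC_left[of 0 0 y] by simp

lemma cinner_zero_right [simp]: "cinner (y::'h::complex_hilbert_space) 0 = 0"
  using cinner_commute[of y 0] by simp

lemma cinner_scaleR_left: "cinner (r *\<^sub>R x) (y::'h::complex_hilbert_space) = of_real r * cinner x y"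
  by (simp add: scaleR_scaleC cinner_scaleC_left)

lemma cinner_minus_left: "cinner (- x) (y::'h::complex_hilbert_space) = - cinner x y"
  using cinner_scaleR_left[of "-1" x y] by simp

lemma cinner_diff_left: "cinner (x - z) (y::'h::complex_hilbert_space) = cinner x y - cinner z y"
  using cinner_add_left[of x "- z" y] by (simp add: cinner_minus_left)

lemma cinner_add_right: "cinner x (y + z) = cinner x y + cinner x (z::'h::complex_hilbert_space)"
  by (metis cinner_add_left cinner_commute complex_cnj_add)

lemma cinner_scaleC_right: "cinner x (c *\<^sub>C y) = cnj c * cinner x (y::'h::complex_hilbert_space)"
  by (metis cinner_scaleC_left cinner_commute complex_cnj_mult)

lemma cinner_diff_right: "cinner x (y - z) = cinner x y - cinner x (z::'h::complex_hilbert_space)"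
  by (metis cinner_diff_left cinner_commute complex_cnj_diff)

lemma cinner_sum_left: "cinner (\<Sum>i\<in>F. f i) (y::'h::complex_hilbert_space) = (\<Sum>i\<in>F. cinner (f i) y)"
  by (induction F rule: infinite_finite_induct) (auto simp: cinner_add_left)

lemma cinner_sum_right: "cinner (y::'h::complex_hilbert_space) (\<Sum>i\<in>F. f i) = (\<Sum>i\<in>F. cinner y (f i))"
  by (induction F rule: infinite_finite_induct) (auto simp: cinner_add_right)

lemma norm_scaleC: "norm (c *\<^sub>C x) = cmod c * norm (x::'h::complex_hilbert_space)"
proof -
  have "complex_of_real ((norm (c *\<^sub>C x))\<^sup>2) = c * (cnj c * complex_of_real ((norm x)\<^sup>2))"
    by (simp only: cinner_self[symmetric] cinner_scaleC_left cinner_scaleC_right mult_ac)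
  also have "\<dots> = complex_of_real ((cmod c * norm x)\<^sup>2)"
    by (simp add: power_mult_distrib complex_norm_square mult.assoc del: of_real_power)
  finally have "(norm (c *\<^sub>C x))\<^sup>2 = (cmod c * norm x)\<^sup>2"
    using of_real_eq_iff by blast
  then show ?thesis by (simp add: power2_eq_iff_nonneg)
qed

lemma cinner_left_eq_imp_eq:
  assumes "\<And>x. cinner x y = cinner x (z::'h::complex_hilbert_space)" shows "y = z"
proof -
  have "cinner (y - z) (y - z) = 0" using assms by (simp add: cinner_diff_right)
  then show ?thesis by (simp add: cinner_self)
qed

text \<open>The content is the Cauchy-Schwarz inequality: for a unit vector \<open>e\<close> it
  follows from Pythagoras, applied to the component of \<open>x\<close> along \<open>e\<close> and
  the rest; a nonzero \<open>z\<close> is a multiple of a unit vector.\<close>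

lemma bounded_linear_cinner: "bounded_linear (\<lambda>x. cinner x (z::'h::complex_hilbert_space))"
proof -
  have unit: "bounded_linear (\<lambda>x. cinner x e)" if "norm e = 1" for e :: 'h
  proof (rule bounded_linear_intro[where K = 1])
    fix x
    define r where "r = x - cinner x e *\<^sub>C e"
    have ee: "cinner e e = 1" using that by (simp add: cinner_self)
    have re: "cinner r e = 0" "cinner e r = 0"
      using ee cinner_commute[of e r] by (auto simp: r_def cinner_diff_left cinner_scaleC_left)
    have x: "x = r + cinner x e *\<^sub>C e" by (simp add: r_def)
    have "cinner x x = cinner r r + cinner x e * cnj (cinner x e)"
      by (subst (1 2) x) (simp add: cinner_add_left cinner_add_right cinner_scaleC_left
          cinner_scaleC_right re ee)
    then have "complex_of_real ((norm x)\<^sup>2) = of_real ((norm r)\<^sup>2 + (cmod (cinner x e))\<^sup>2)"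
      by (simp only: cinner_self of_real_add complex_norm_square)
    then have "(norm x)\<^sup>2 = (norm r)\<^sup>2 + (cmod (cinner x e))\<^sup>2" using of_real_eq_iff by blast
    then have "(cmod (cinner x e))\<^sup>2 \<le> (norm x)\<^sup>2" by simp
    then show "cmod (cinner x e) \<le> norm x * 1" using power2_le_imp_le by fastforce
  qed (simp_all add: cinner_add_left cinner_scaleR_left scaleR_conv_of_real)
  show ?thesis
  proof (cases "z = 0")
    case False
    define u where "u = inverse (norm z) *\<^sub>R z"
    have "norm u = 1" using False by (simp add: u_def)
    from unit[OF this]
    have "bounded_linear (\<lambda>x. complex_of_real (norm z) * cinner x u)"
      by (rule bounded_linear_const_mult)
    moreover have z: "z = complex_of_real (norm z) *\<^sub>C u" using False by (simp add: u_def scaleC_of_real)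
    have "cinner x z = complex_of_real (norm z) * cinner x u" for x
      by (subst z) (simp add: cinner_scaleC_right)
    ultimately show ?thesis by simp
  qed (simp add: bounded_linear_zero)
qed

lemma bounded_linear_scaleC_right: "bounded_linear (\<lambda>x. c *\<^sub>C (x::'h::complex_hilbert_space))"
  by (rule bounded_linear_intro[where K = "cmod c"])
     (simp_all add: scaleC_add_right scaleR_scaleC scaleC_scaleC norm_scaleC mult.commute)

lemma bounded_linear_scaleC_left: "bounded_linear (\<lambda>c. c *\<^sub>C (x::'h::complex_hilbert_space))"
  by (rule bounded_linear_intro[where K = "norm x"])
     (simp_all add: scaleC_add_left scaleR_scaleC scaleC_scaleC norm_scaleC scaleR_conv_of_real)

lemma scaleC_Re_Im: "c *\<^sub>C (x::'h::complex_hilbert_space) = Re c *\<^sub>R x + Im c *\<^sub>R (\<i> *\<^sub>C x)"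
proof -
  have "c = complex_of_real (Re c) + complex_of_real (Im c) * \<i>" by (simp add: complex_eq_iff)
  then show ?thesis by (metis scaleC_add_left scaleC_of_real scaleC_scaleC)
qed

lemma complete_orthonormal_systemD:
  assumes "complete_orthonormal_system E"
  shows "e \<in> E \<Longrightarrow> e' \<in> E \<Longrightarrow> cinner e e' = (if e = e' then 1 else 0)"
    and "(\<And>e. e \<in> E \<Longrightarrow> cinner x e = 0) \<Longrightarrow> x = 0"
    and "e \<in> E \<Longrightarrow> norm e = 1"
proof -
  show ip: "cinner e e' = (if e = e' then 1 else 0)" if "e \<in> E" "e' \<in> E" for e e'
    using assms that by (auto simp: complete_orthonormal_system_def)
  show "(\<And>e. e \<in> E \<Longrightarrow> cinner x e = 0) \<Longrightarrow> x = 0"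
    using assms by (auto simp: complete_orthonormal_system_def)
  show "norm e = 1" if "e \<in> E"
  proof -
    have "complex_of_real ((norm e)\<^sup>2) = 1" using ip[OF that that] by (simp add: cinner_self)
    then have "(norm e)\<^sup>2 = 1" by (metis of_real_eq_1_iff)
    then show ?thesis by (smt (verit) norm_ge_zero power2_eq_1_iff)
  qed
qed

lemma norm_sq_fourier_sum:
  fixes E :: "'h::complex_hilbert_space set"
  assumes E: "complete_orthonormal_system E" and F: "finite F" "F \<subseteq> E"
  shows "(norm (\<Sum>e\<in>F. c e *\<^sub>C e))\<^sup>2 = (\<Sum>e\<in>F. (cmod (c e))\<^sup>2)"
proof -
  have "complex_of_real ((norm (\<Sum>e\<in>F. c e *\<^sub>C e))\<^sup>2)
      = (\<Sum>e'\<in>F. cnj (c e') * (\<Sum>e\<in>F. c e * (if e = e' then 1 else 0)))"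
    unfolding cinner_self[symmetric] cinner_sum_left cinner_sum_right cinner_scaleC_left
      cinner_scaleC_right
    using F complete_orthonormal_systemD(1)[OF E]
    by (intro sum.cong refl arg_cong2[where f = times]) (auto simp: subset_eq)
  also have "\<dots> = (\<Sum>e\<in>F. c e * cnj (c e))"
    using F by (simp add: if_distrib mult.commute cong: if_cong)
  also have "\<dots> = complex_of_real (\<Sum>e\<in>F. (cmod (c e))\<^sup>2)"
    by (simp add: complex_norm_square del: of_real_power)
  finally show ?thesis using of_real_eq_iff by blast
qed

lemma bessel_decomposition:
  fixes E :: "'h::complex_hilbert_space set"
  assumes E: "complete_orthonormal_system E" and F: "finite F" "F \<subseteq> E"
  shows "(norm x)\<^sup>2 = (norm (x - (\<Sum>e\<in>F. cinner x e *\<^sub>C e)))\<^sup>2 + (\<Sum>e\<in>F. (cmod (cinner x e))\<^sup>2)"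
    and "e \<in> E \<Longrightarrow> cinner (\<Sum>e\<in>F. cinner x e *\<^sub>C e) e = (if e \<in> F then cinner x e else 0)"
proof -
  define p where "p = (\<Sum>e\<in>F. cinner x e *\<^sub>C e)"
  show pe: "cinner p e = (if e \<in> F then cinner x e else 0)" if "e \<in> E" for e
  proof -
    have "cinner p e = (\<Sum>e'\<in>F. cinner x e' * (if e' = e then 1 else 0))"
      unfolding p_def cinner_sum_left cinner_scaleC_left
      using F that complete_orthonormal_systemD(1)[OF E] by (intro sum.cong refl) (auto simp: subset_eq)
    then show ?thesis using F by (simp add: sum.delta if_distrib cong: if_cong)
  qed
  have "cinner (x - p) p = 0"
    unfolding p_def cinner_sum_right cinner_scaleC_right
    using F pe unfolding p_def by (intro sum.neutral) (auto simp: cinner_diff_left subset_eq)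
  moreover from this have "cinner p (x - p) = 0" using cinner_commute[of p "x - p"] by simp
  ultimately have "cinner (x - p + p) (x - p + p) = cinner (x - p) (x - p) + cinner p p"
    unfolding cinner_add_left cinner_add_right by simp
  then have "complex_of_real ((norm x)\<^sup>2) = of_real ((norm (x - p))\<^sup>2 + (norm p)\<^sup>2)"
    by (simp add: cinner_self)
  then have "(norm x)\<^sup>2 = (norm (x - p))\<^sup>2 + (norm p)\<^sup>2" using of_real_eq_iff by blast
  then show "(norm x)\<^sup>2 = (norm (x - p))\<^sup>2 + (\<Sum>e\<in>F. (cmod (cinner x e))\<^sup>2)"
    unfolding p_def norm_sq_fourier_sum[OF E F] .
qed

text \<open>Completeness is given only as a trivial orthogonal complement, so convergence of Fourier
  sums has to be derived: finite sums whose coefficient mass nearly attains its supremum form a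
  Cauchy sequence, and their limit differs from \<open>x\<close> by a vector orthogonal to
  \<open>E\<close>. This is what makes the Hilbert-Schmidt distance definite.\<close>

lemma bounded_clinear_eq_0_if_0_on_ons:
  fixes E :: "'h::complex_hilbert_space set"
  assumes E: "complete_orthonormal_system E" and D: "bounded_clinear D"
    and D0: "\<And>e. e \<in> E \<Longrightarrow> D e = 0"
  shows "D x = 0"
proof -
  define q where "q F = (\<Sum>e\<in>F. (cmod (cinner x e))\<^sup>2)" for F
  define p where "p F = (\<Sum>e\<in>F. cinner x e *\<^sub>C e)" for F
  define \<F> where "\<F> = {F. finite F \<and> F \<subseteq> E}"
  define s where "s = (SUP F\<in>\<F>. q F)"
  have "q F \<le> (norm x)\<^sup>2" if "F \<in> \<F>" for F
    using bessel_decomposition(1)[OF E, of F x] that unfolding q_def \<F>_def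
    by (metis (mono_tags, lifting) le_add_same_cancel2 mem_Collect_eq zero_le_power2)
  then have bdd: "bdd_above (q ` \<F>)" by (rule bdd_aboveI2)
  have q_le: "q F \<le> s" if "F \<in> \<F>" for F
    unfolding s_def by (rule cSUP_upper[OF that bdd])
  have "\<exists>F\<in>\<F>. s - (1/2) ^ n < q F" for n
  proof -
    have "\<F> \<noteq> {}" by (auto simp: \<F>_def)
    moreover have "s - (1/2) ^ n < s" by simp
    ultimately show ?thesis unfolding s_def using less_cSUP_iff[OF _ bdd] by blast
  qed
  then obtain F where F: "\<And>n. F n \<in> \<F>" "\<And>n. s - (1/2) ^ n < q (F n)" by metis
  \<comment> \<open>Cumulative unions make the index sets increase, so a difference of two Fourier
    sums is again a Fourier sum over a finite set.\<close>
  define A where "A n = (\<Union>k\<le>n. F k)" for n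
  have A: "A n \<in> \<F>" for n using F(1) by (auto simp: A_def \<F>_def)
  have A_mono: "A m \<subseteq> A n" if "m \<le> n" for m n using that by (force simp: A_def)
  have q_mono: "q G \<le> q H" if "G \<subseteq> H" "H \<in> \<F>" for G H
    unfolding q_def using that by (intro sum_mono2) (auto simp: \<F>_def)
  have qA: "s - (1/2) ^ n < q (A n)" for n
    using F(2)[of n] q_mono[of "F n" "A n"] A by (force simp: A_def)
  have p_diff: "(norm (p (A m) - p (A n)))\<^sup>2 \<le> (1/2) ^ n" if "n \<le> m" for m n
  proof -
    have fin: "finite (A m)" and sub: "A n \<subseteq> A m" using A[of m] A_mono[OF that] by (auto simp: \<F>_def)
    have "p (A m) - p (A n) = p (A m - A n)" unfolding p_def using sum_diff[OF fin sub] by metis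
    then have "(norm (p (A m) - p (A n)))\<^sup>2 = q (A m - A n)"
      unfolding p_def q_def using A[of m] norm_sq_fourier_sum[OF E, of "A m - A n" "cinner x"]
      by (auto simp: \<F>_def)
    also have "\<dots> = q (A m) - q (A n)" unfolding q_def by (rule sum_diff[OF fin sub])
    also have "\<dots> \<le> (1/2) ^ n" using q_le[OF A[of m]] qA[of n] by simp
    finally show ?thesis .
  qed
  have "Cauchy (\<lambda>n. p (A n))"
  proof (rule metric_CauchyI)
    fix \<epsilon> :: real assume "\<epsilon> > 0"
    then have "(\<epsilon>/2)\<^sup>2 > 0" by simp
    then obtain N where N: "(1/2::real) ^ N < (\<epsilon>/2)\<^sup>2" using real_arch_pow_inv[of "(\<epsilon>/2)\<^sup>2" "1/2"] by auto
    have "norm (p (A m) - p (A N)) < \<epsilon>/2" if "m \<ge> N" for m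
    proof -
      have "(norm (p (A m) - p (A N)))\<^sup>2 < (\<epsilon>/2)\<^sup>2"
        by (rule le_less_trans[OF p_diff[OF that] N])
      then show ?thesis by (rule power_less_imp_less_base) (use \<open>\<epsilon> > 0\<close> in simp)
    qed
    then have "dist (p (A m)) (p (A n)) < \<epsilon>" if "m \<ge> N" "n \<ge> N" for m n
      using that by - (rule dist_triangle_half_l[where y = "p (A N)"], auto simp: dist_norm)
    then show "\<exists>M. \<forall>m\<ge>M. \<forall>n\<ge>M. dist (p (A m)) (p (A n)) < \<epsilon>" by blast
  qed
  then obtain y where y: "(\<lambda>n. p (A n)) \<longlonglongrightarrow> y"
    unfolding Cauchy_convergent_iff convergent_def by blast
  have "x - y = 0"
  proof (rule complete_orthonormal_systemD(2)[OF E])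
    fix e assume e: "e \<in> E"
    interpret ci: bounded_linear "\<lambda>x. cinner x e"
      by (rule bounded_linear_cinner)
    have "(\<lambda>n. cinner (x - p (A n)) e) \<longlonglongrightarrow> cinner (x - y) e"
      by (intro ci.tendsto tendsto_intros y)
    moreover have "(\<lambda>n. cinner (x - p (A n)) e) \<longlonglongrightarrow> 0"
    proof (rule tendsto_norm_zero_cancel, rule tendsto_sandwich[OF _ _ tendsto_const])
      have "(cmod (cinner (x - p (A n)) e))\<^sup>2 \<le> (1/2) ^ n" for n
      proof (cases "e \<in> A n")
        case True
        then show ?thesis using bessel_decomposition(2)[OF E _ _ e, of "A n" x] A[of n]
          by (simp add: cinner_diff_left p_def \<F>_def)
      next
        case False
        \<comment> \<open>One more index cannot lift the mass above the supremum, so a coefficient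
          still missing from \<open>A n\<close> has squared modulus below
          \<open>(1/2) ^ n\<close>.\<close>
        have "q (insert e (A n)) \<le> s" using A[of n] e by (intro q_le) (auto simp: \<F>_def)
        moreover have "q (insert e (A n)) = (cmod (cinner x e))\<^sup>2 + q (A n)"
          unfolding q_def using False A[of n] by (auto simp: \<F>_def)
        ultimately show ?thesis using bessel_decomposition(2)[OF E _ _ e, of "A n" x] A[of n] qA[of n] False
          by (simp add: cinner_diff_left p_def \<F>_def)
      qed
      then show "\<forall>\<^sub>F n in sequentially. cmod (cinner (x - p (A n)) e) \<le> sqrt ((1/2) ^ n)"
        by (simp add: real_le_rsqrt)
      show "(\<lambda>n. sqrt ((1/2) ^ n)) \<longlonglongrightarrow> 0"
        using tendsto_real_sqrt[OF LIMSEQ_power_zero[of "1/2::real"]] by simp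
    qed simp
    ultimately show "cinner (x - y) e = 0" using LIMSEQ_unique by blast
  qed
  moreover have "D (p (A n)) = 0" for n
  proof -
    interpret D: bounded_linear D using D by (simp add: bounded_clinear_def)
    have "D (p (A n)) = (\<Sum>e\<in>A n. cinner x e *\<^sub>C D e)"
      unfolding p_def D.sum using D by (simp add: bounded_clinear_def)
    then show ?thesis using A[of n] D0 by (auto simp: \<F>_def subset_eq intro!: sum.neutral)
  qed
  then have "(\<lambda>n. 0) \<longlonglongrightarrow> D y"
    using bounded_linear.tendsto[OF _ y, of D] D by (simp add: bounded_clinear_def)
  then have "D y = 0" by (simp add: LIMSEQ_const_iff)
  ultimately show ?thesis by simp
qed

section \<open>The Hilbert-Schmidt norm as a metric\<close>

lemma L2_set_le_hs_norm:
  assumes "A \<in> hs_operators E" "finite F" "F \<subseteq> E"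
  shows "L2_set (\<lambda>e. norm (A e)) F \<le> hs_norm E A"
  unfolding L2_set_def hs_norm_def using assms
  by (intro real_sqrt_le_mono finite_sum_le_infsum) (auto simp: hs_operators_def)

text \<open>Minkowski's inequality on finite subsets of \<open>E\<close>, followed by passage to the
  supremum. Controlling \<open>C\<close> only through norms covers differences and the triangle
  inequality at once.\<close>

lemma hs_operators_add_bound:
  assumes A: "A \<in> hs_operators E" and B: "B \<in> hs_operators E"
    and C: "bounded_clinear C" "\<And>e. norm (C e) \<le> norm (A e) + norm (B e)"
  shows "C \<in> hs_operators E" and "hs_norm E C \<le> hs_norm E A + hs_norm E B"
proof -
  define K where "K = hs_norm E A + hs_norm E B"
  have K0: "K \<ge> 0" by (simp add: K_def hs_norm_def infsum_nonneg)
  have *: "(\<Sum>e\<in>F. (norm (C e))\<^sup>2) \<le> K\<^sup>2" if F: "finite F" "F \<subseteq> E" for F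
  proof -
    have "L2_set (\<lambda>e. norm (C e)) F \<le> L2_set (\<lambda>e. norm (A e) + norm (B e)) F"
      using C by (intro L2_set_mono) auto
    also have "\<dots> \<le> L2_set (\<lambda>e. norm (A e)) F + L2_set (\<lambda>e. norm (B e)) F"
      by (rule L2_set_triangle_ineq)
    also have "\<dots> \<le> K" unfolding K_def using F by (intro add_mono L2_set_le_hs_norm A B)
    finally have "(L2_set (\<lambda>e. norm (C e)) F)\<^sup>2 \<le> K\<^sup>2" by (intro power_mono) auto
    then show ?thesis by (simp add: L2_set_def sum_nonneg)
  qed
  have sm: "(\<lambda>e. (norm (C e))\<^sup>2) summable_on E"
    using * by (intro nonneg_bdd_above_summable_on bdd_aboveI2[where M = "K\<^sup>2"]) auto
  then show "C \<in> hs_operators E" using C by (simp add: hs_operators_def)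
  have "(\<Sum>\<^sub>\<infinity>e\<in>E. (norm (C e))\<^sup>2) \<le> K\<^sup>2" by (rule infsum_le_finite_sums[OF sm *])
  then have "hs_norm E C \<le> K" unfolding hs_norm_def by (intro real_le_lsqrt K0)
  then show "hs_norm E C \<le> hs_norm E A + hs_norm E B" by (simp only: K_def)
qed

lemma bounded_clinear_diff:
  assumes "bounded_clinear A" "bounded_clinear B"
  shows "bounded_clinear (\<lambda>z. A z - B z)"
proof -
  have "c *\<^sub>C (x - y) = c *\<^sub>C x - c *\<^sub>C (y::'a)" for c x y
    using scaleC_add_right[of c "x - y" y] by simp
  then show ?thesis using assms by (auto simp: bounded_clinear_def bounded_linear_sub)
qed

lemma hs_operators_diff:
  assumes "A \<in> hs_operators E" "B \<in> hs_operators E"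
  shows "(\<lambda>z. A z - B z) \<in> hs_operators E"
  by (rule hs_operators_add_bound(1)[OF assms])
     (use assms in \<open>auto simp: hs_operators_def norm_triangle_ineq4 intro: bounded_clinear_diff\<close>)

lemma Metric_space_hs:
  assumes E: "complete_orthonormal_system E"
  shows "Metric_space (hs_operators E) (\<lambda>A B. hs_norm E (\<lambda>z. A z - B z))"
proof
  fix A B C assume A: "A \<in> hs_operators E" and B: "B \<in> hs_operators E"
  show "hs_norm E (\<lambda>z. A z - B z) = 0 \<longleftrightarrow> A = B"
  proof
    assume 0: "hs_norm E (\<lambda>z. A z - B z) = 0"
    have D: "(\<lambda>z. A z - B z) \<in> hs_operators E" by (rule hs_operators_diff[OF A B])
    have "A e - B e = 0" if "e \<in> E" for e
      using L2_set_le_hs_norm[OF D, of "{e}"] that 0 by simp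
    then have "A x - B x = 0" for x
      using D bounded_clinear_eq_0_if_0_on_ons[OF E, of "\<lambda>z. A z - B z" x] by (simp add: hs_operators_def)
    then show "A = B" by auto
  qed (simp add: hs_norm_def)
  assume C: "C \<in> hs_operators E"
  have "norm (A e - C e) \<le> norm (A e - B e) + norm (B e - C e)" for e
    using norm_triangle_ineq[of "A e - B e" "B e - C e"] by simp
  moreover have "bounded_clinear (\<lambda>z. A z - C z)"
    using hs_operators_diff[OF A C] by (simp add: hs_operators_def)
  ultimately show "hs_norm E (\<lambda>z. A z - C z) \<le> hs_norm E (\<lambda>z. A z - B z) + hs_norm E (\<lambda>z. B z - C z)"
    using hs_operators_diff[OF A B] hs_operators_diff[OF B C] by (intro hs_operators_add_bound(2))
qed (auto simp: hs_norm_def infsum_nonneg norm_minus_commute)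

lemma space_hs_borel: "space (hs_borel E) = hs_operators E"
  by (simp add: hs_borel_def space_measure_of_conv)

text \<open>Balls are the sets of \<open>hs_borel\<close> that matter later: through them, closeness
  of an estimate to a hypothesis becomes a measurable event.\<close>

lemma hs_borel_dist_set:
  assumes E: "complete_orthonormal_system E" and F: "F \<in> hs_operators E"
  shows "{A \<in> hs_operators E. hs_norm E (\<lambda>z. A z - F z) < r} \<in> sets (hs_borel E)"
proof -
  interpret M: Metric_space "hs_operators E" "\<lambda>A B. hs_norm E (\<lambda>z. A z - B z)"
    by (rule Metric_space_hs[OF E])
  have "{U. openin M.mtopology U} \<subseteq> Pow (hs_operators E)"
    using openin_subset by fastforce
  then have "M.mball F r \<in> sets (hs_borel E)"
    unfolding hs_borel_def using M.openin_mball by (auto simp: sets_measure_of)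
  moreover have "M.mball F r = {A \<in> hs_operators E. hs_norm E (\<lambda>z. A z - F z) < r}"
    using F M.commute[of F] by (auto simp: M.mball_def)
  ultimately show ?thesis by simp
qed

section \<open>Multiples of a rank-one projection\<close>

text \<open>The form of every autocovariance and spectral density of a field along
  \<open>e\<close>.\<close>

definition rank1 :: "'h::complex_hilbert_space \<Rightarrow> complex \<Rightarrow> 'h \<Rightarrow> 'h" where
  "rank1 e c = (\<lambda>z. (c * cinner z e) *\<^sub>C e)"

lemma scaleC_diff_left: "(b - c) *\<^sub>C x = b *\<^sub>C x - c *\<^sub>C (x::'h::complex_hilbert_space)"
  using scaleC_add_left[of "b - c" c x] by simp

lemma rank1_diff: "rank1 e c z - rank1 e c' z = rank1 e (c - c') z"
  by (simp add: rank1_def left_diff_distrib scaleC_diff_left)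

lemma bounded_clinear_rank1:
  assumes "norm e = 1" shows "bounded_clinear (rank1 e c)"
proof -
  interpret ci: bounded_linear "\<lambda>x. cinner x e" by (rule bounded_linear_cinner)
  obtain K where K: "\<And>x. cmod (cinner x e) \<le> norm x * K" using ci.bounded by blast
  have "bounded_linear (rank1 e c)"
  proof (rule bounded_linear_intro)
    show "norm (rank1 e c x) \<le> norm x * (cmod c * K)" for x
      using mult_left_mono[OF K[of x], of "cmod c"] assms
      by (simp add: rank1_def norm_scaleC norm_mult mult_ac)
  qed (simp_all add: rank1_def cinner_add_left cinner_scaleC_left distrib_left scaleC_add_left
        scaleR_scaleC scaleC_scaleC mult_ac)
  then show ?thesis by (simp add: bounded_clinear_def rank1_def cinner_scaleC_left scaleC_scaleC mult_ac)
qed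

lemma rank1_on_ons:
  assumes "complete_orthonormal_system E" "e \<in> E" "e' \<in> E"
  shows "rank1 e c e' = (if e' = e then c *\<^sub>C e else 0)"
  using complete_orthonormal_systemD(1)[OF assms(1,3,2)] by (simp add: rank1_def)

lemma rank1_hs:
  assumes E: "complete_orthonormal_system E" "e \<in> E"
  shows "rank1 e c \<in> hs_operators E" "hs_norm E (rank1 e c) = cmod c"
proof -
  note e = complete_orthonormal_systemD(3)[OF E]
  have *: "(norm (rank1 e c e'))\<^sup>2 = (if e' = e then (cmod c)\<^sup>2 else 0)" if "e' \<in> E" for e'
    using rank1_on_ons[OF E that] e by (simp add: norm_scaleC)
  have "((\<lambda>e'. (norm (rank1 e c e'))\<^sup>2) has_sum (cmod c)\<^sup>2) E"
    by (rule has_sum_finite_neutralI[where B = "{e}"]) (use E * in auto)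
  then show "rank1 e c \<in> hs_operators E" "hs_norm E (rank1 e c) = cmod c"
    using bounded_clinear_rank1[OF e] 
    by (auto simp: hs_operators_def hs_norm_def has_sum_imp_summable infsumI)
qed

section \<open>Positive square roots and the trace norm\<close>

text \<open>Polarisation: reality of \<open>cinner (S z) z\<close> at \<open>x + y\<close> settles
  the imaginary part, and at \<open>x + \<i> *\<^sub>C y\<close> the real part.\<close>

lemma positive_operator_selfadjoint:
  assumes "positive_operator S" shows "cinner (S x) y = cinner x (S y)"
proof -
  have re: "Im (cinner (S z) z) = 0" for z
    using assms by (auto simp: positive_operator_def complex_is_Real_iff)
  interpret bounded_linear S using assms by (simp add: positive_operator_def bounded_clinear_def)
  have Sc: "S (c *\<^sub>C z) = c *\<^sub>C S z" for c z
    using assms by (simp add: positive_operator_def bounded_clinear_def)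
  have "Im (cinner (S x) y) + Im (cinner (S y) x) = 0"
    using re[of "x + y"] re[of x] re[of y] by (simp add: add cinner_add_left cinner_add_right)
  moreover have "Re (cinner (S x) y) = Re (cinner (S y) x)"
    using re[of "x + \<i> *\<^sub>C y"] re[of x] re[of y]
    by (simp add: add Sc cinner_add_left cinner_add_right cinner_scaleC_left cinner_scaleC_right)
  ultimately have "cinner (S x) y = cnj (cinner (S y) x)" by (simp add: complex_eq_iff)
  then show ?thesis using cinner_commute[of x "S y"] by simp
qed

lemma positive_operator_rank1:
  assumes "norm e = 1" "c \<ge> 0" shows "positive_operator (rank1 e (complex_of_real c))"
proof -
  have *: "cinner (rank1 e (complex_of_real c) x) x = complex_of_real (c * (cmod (cinner x e))\<^sup>2)" for x
    unfolding rank1_def using cinner_commute[of e x]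
    by (simp add: cinner_scaleC_left complex_norm_square mult_ac del: of_real_power)
  then show ?thesis
    using bounded_clinear_rank1[OF assms(1)] assms(2) by (simp add: positive_operator_def)
qed

lemma rank1_comp: "norm e = 1 \<Longrightarrow> rank1 e b \<circ> rank1 e c = rank1 e (b * c)"
  by (auto simp: rank1_def cinner_scaleC_left scaleC_scaleC cinner_self mult_ac)

lemma cadjoint_rank1: "cadjoint (rank1 e (complex_of_real c)) = rank1 e (complex_of_real c)"
proof -
  let ?T = "rank1 e (complex_of_real c)"
  have *: "cinner (?T x) y = cinner x (?T y)" for x y
    using cinner_commute[of e y] by (simp add: rank1_def cinner_scaleC_left cinner_scaleC_right)
  show ?thesis
    unfolding cadjoint_def
  proof (rule the_equality)
    fix B assume "\<forall>x y. cinner (?T x) y = cinner x (B y)"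
    with * show "B = ?T" by (intro ext cinner_left_eq_imp_eq) metis
  qed (use * in auto)
qed

text \<open>\<open>abs_operator\<close> is a definite description, so the positive square root must
  be shown to be unique. By self-adjointness the squared norm of \<open>S x\<close> is
  \<open>cinner (S (S x)) x\<close>, so \<open>S\<close> kills the complement of \<open>e\<close>;
  self-adjointness again leaves \<open>S e\<close> without a component there, and positivity selects
  the sign of the remaining factor.\<close>

lemma positive_operator_sqrt_rank1:
  assumes e: "norm e = 1" and S: "positive_operator S" "S \<circ> S = rank1 e (complex_of_real (c\<^sup>2))"
  shows "S = rank1 e (complex_of_real \<bar>c\<bar>)"
proof -
  interpret bounded_linear S using S by (simp add: positive_operator_def bounded_clinear_def)
  note sa = positive_operator_selfadjoint[OF S(1)]
  have Sc: "S (b *\<^sub>C z) = b *\<^sub>C S z" for b z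
    using S by (simp add: positive_operator_def bounded_clinear_def)
  have SS: "S (S x) = rank1 e (complex_of_real (c\<^sup>2)) x" for x using S(2) by (metis comp_apply)
  have ee: "cinner e e = 1" using e by (simp add: cinner_self)
  have perp: "S x = 0" if "cinner x e = 0" for x
  proof -
    have "cinner (S x) (S x) = cinner (S (S x)) x" using sa by metis
    also have "\<dots> = 0" using that by (simp add: SS rank1_def)
    finally show ?thesis by (simp add: cinner_self)
  qed
  define l where "l = cinner (S e) e"
  define r where "r = S e - l *\<^sub>C e"
  have re: "cinner r e = 0" by (simp add: r_def l_def cinner_diff_left cinner_scaleC_left ee)
  then have "cinner e r = 0" using cinner_commute[of e r] by simp
  moreover have "cinner (S e) r = 0" using sa perp[OF re] by simp
  ultimately have "cinner r r = 0" unfolding r_def by (simp add: cinner_diff_left cinner_scaleC_left)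
  then have Se: "S e = l *\<^sub>C e" by (simp add: cinner_self r_def)
  have l: "l \<in> \<real>" "Re l \<ge> 0" using S(1) by (auto simp: positive_operator_def l_def)
  then have lr: "l = complex_of_real (Re l)" by (simp add: of_real_Re)
  have "cinner (S (S e)) e = complex_of_real (c\<^sup>2)" by (simp add: SS rank1_def cinner_scaleC_left ee)
  then have "l * l = complex_of_real (c\<^sup>2)" by (simp add: Se Sc cinner_scaleC_left ee)
  then have "complex_of_real (Re l * Re l) = complex_of_real (c\<^sup>2)" using lr by (metis of_real_mult)
  then have "(Re l)\<^sup>2 = c\<^sup>2" by (simp only: of_real_eq_iff power2_eq_square)
  then have "Re l = \<bar>c\<bar>" using l by (metis abs_of_nonneg power2_abs power2_eq_iff_nonneg abs_ge_zero)
  then have l': "l = complex_of_real \<bar>c\<bar>" using lr by simp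
  show ?thesis
  proof
    fix x
    have "S (x - cinner x e *\<^sub>C e) = 0" by (rule perp) (simp add: cinner_diff_left cinner_scaleC_left ee)
    then have "S x = cinner x e *\<^sub>C S e" by (simp add: diff Sc)
    then show "S x = rank1 e (complex_of_real \<bar>c\<bar>) x"
      by (simp add: Se l' rank1_def scaleC_scaleC mult_ac)
  qed
qed

lemma trace_norm_rank1:
  assumes E: "complete_orthonormal_system E" "e \<in> E"
  shows "trace_norm E (rank1 e (complex_of_real c)) = ennreal \<bar>c\<bar>"
proof -
  note e = complete_orthonormal_systemD(3)[OF E]
  have sq: "cadjoint (rank1 e (complex_of_real c)) \<circ> rank1 e (complex_of_real c) = rank1 e (complex_of_real (c\<^sup>2))"
    by (simp add: cadjoint_rank1 rank1_comp[OF e] power2_eq_square)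
  have "abs_operator (rank1 e (complex_of_real c)) = rank1 e (complex_of_real \<bar>c\<bar>)"
    unfolding abs_operator_def sq
  proof (rule the_equality)
    have "complex_of_real \<bar>c\<bar> * complex_of_real \<bar>c\<bar> = complex_of_real (c\<^sup>2)"
      by (metis abs_mult_self_eq of_real_mult power2_eq_square)
    then show "positive_operator (rank1 e (complex_of_real \<bar>c\<bar>)) \<and>
        rank1 e (complex_of_real \<bar>c\<bar>) \<circ> rank1 e (complex_of_real \<bar>c\<bar>) = rank1 e (complex_of_real (c\<^sup>2))"
      by (simp add: positive_operator_rank1[OF e] rank1_comp[OF e])
  qed (blast intro: positive_operator_sqrt_rank1[OF e])
  then have *: "ennreal (Re (cinner (abs_operator (rank1 e (complex_of_real c)) e') e')) =
      (if e' = e then ennreal \<bar>c\<bar> else 0)" if "e' \<in> E" for e'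
    using rank1_on_ons[OF E that] e by (simp add: cinner_scaleC_left cinner_self)
  have "((\<lambda>e'. ennreal (Re (cinner (abs_operator (rank1 e (complex_of_real c)) e') e')))
      has_sum ennreal \<bar>c\<bar>) E"
    by (rule has_sum_finite_neutralI[where B = "{e}"]) (simp_all add: * E(2))
  then show ?thesis unfolding trace_norm_def by (rule infsumI)
qed

section \<open>Gaussian series\<close>

definition iid_normal :: "'i set \<Rightarrow> ('i \<Rightarrow> real) measure" where
  "iid_normal I = Pi\<^sub>M I (\<lambda>_. std_normal_distribution)"

lemma prob_space_std_normal: "prob_space std_normal_distribution"
  using real_dist_normal_dist by (simp add: real_distribution_def)

lemma prob_space_iid_normal: "prob_space (iid_normal I)"
  unfolding iid_normal_def by (intro prob_space_PiM prob_space_std_normal)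

lemma sets_iid_normal: "sets (iid_normal I) = sets (Pi\<^sub>M I (\<lambda>_. borel))"
  unfolding iid_normal_def by (rule sets_PiM_cong) auto

lemma measurable_iid_normal_component:
  "i \<in> I \<Longrightarrow> (\<lambda>\<omega>. \<omega> i) \<in> borel_measurable (iid_normal I)"
  unfolding measurable_cong_sets[OF sets_iid_normal refl] by (rule measurable_component_singleton)

lemma distr_iid_normal_component:
  assumes "i \<in> I" shows "distr (iid_normal I) borel (\<lambda>\<omega>. \<omega> i) = std_normal_distribution"
proof -
  have "distr (iid_normal I) borel (\<lambda>\<omega>. \<omega> i) = distr (iid_normal I) std_normal_distribution (\<lambda>\<omega>. \<omega> i)"
    by (rule distr_cong) auto
  also have "\<dots> = std_normal_distribution"
    unfolding iid_normal_def by (rule distr_PiM_component) (use assms prob_space_std_normal in auto)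
  finally show ?thesis .
qed

lemma indep_vars_iid_normal:
  "prob_space.indep_vars (iid_normal I) (\<lambda>_. borel) (\<lambda>i \<omega>. \<omega> i) I"
proof -
  interpret prob_space "iid_normal I" by (rule prob_space_iid_normal)
  show ?thesis
  proof (cases "I = {}")
    case True then show ?thesis unfolding indep_vars_def indep_sets_def by blast
  next
    case False
    have "distr (iid_normal I) (Pi\<^sub>M I (\<lambda>_. borel)) (\<lambda>x. \<lambda>i\<in>I. x i) = distr (iid_normal I) (iid_normal I) (\<lambda>x. x)"
    proof (rule distr_cong)
      fix x assume "x \<in> space (iid_normal I)"
      then show "restrict x I = x" by (simp add: iid_normal_def space_PiM PiE_restrict)
    qed (simp_all add: sets_iid_normal)
    also have "\<dots> = iid_normal I" by simp
    also have "\<dots> = Pi\<^sub>M I (\<lambda>i. distr (iid_normal I) borel (\<lambda>\<omega>. \<omega> i))"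
      unfolding iid_normal_def[of I] by (intro PiM_cong refl)
        (simp add: distr_iid_normal_component[unfolded iid_normal_def])
    finally show ?thesis
      by (subst indep_vars_iff_distr_eq_PiM'[OF False]) (auto intro: measurable_iid_normal_component)
  qed
qed

lemma char_iid_normal_sum:
  assumes "finite J" "J \<subseteq> I"
  shows "(CLINT \<omega>|iid_normal I. iexp (\<Sum>i\<in>J. b i * \<omega> i)) = exp (- (\<Sum>i\<in>J. (b i)\<^sup>2) / 2)"
proof -
  interpret prob_space "iid_normal I" by (rule prob_space_iid_normal)
  have ind: "indep_vars (\<lambda>_. borel) (\<lambda>i \<omega>. b i * \<omega> i) J"
    using indep_vars_compose2[OF indep_vars_subset[OF indep_vars_iid_normal assms(2)],
        of "\<lambda>i x. b i * x" "\<lambda>_. borel"] by simp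
  have m: "(\<lambda>\<omega>. b i * \<omega> i) \<in> borel_measurable (iid_normal I)" if "i \<in> J" for i
    using that assms(2) by (auto intro!: borel_measurable_times measurable_iid_normal_component)
  have c: "char (distr (iid_normal I) borel (\<lambda>\<omega>. b i * \<omega> i)) 1 = exp (- (b i)\<^sup>2 / 2)" if "i \<in> J" for i
  proof -
    have i: "i \<in> I" using that assms(2) by auto
    have "char (distr (iid_normal I) borel (\<lambda>\<omega>. b i * \<omega> i)) 1 = char (distr (iid_normal I) borel (\<lambda>\<omega>. \<omega> i)) (b i)"
      by (simp add: char_def integral_distr m[OF that] measurable_iid_normal_component[OF i])
    then show ?thesis by (simp add: distr_iid_normal_component[OF i] char_std_normal_distribution)
  qed
  have "(CLINT \<omega>|iid_normal I. iexp (\<Sum>i\<in>J. b i * \<omega> i)) = char (distr (iid_normal I) borel (\<lambda>\<omega>. \<Sum>i\<in>J. b i * \<omega> i)) 1"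
    using m by (simp add: char_def integral_distr borel_measurable_sum)
  also have "\<dots> = (\<Prod>i\<in>J. complex_of_real (exp (- (b i)\<^sup>2 / 2)))"
    by (simp only: char_distr_sum[OF ind] c cong: prod.cong)
  also have "\<dots> = exp (- (\<Sum>i\<in>J. (b i)\<^sup>2) / 2)"
    by (simp only: of_real_prod[symmetric] exp_sum[OF assms(1), symmetric] sum_divide_distrib
        sum_negf[symmetric] minus_divide_left)
  finally show ?thesis .
qed

text \<open>Tonelli: all coordinates have the same finite absolute mean, so the expected absolute
  sum is finite. Under mere square summability of \<open>b\<close> the absolute convergence can
  fail.\<close>

lemma AE_iid_normal_summable:
  assumes "summable (\<lambda>k. \<bar>b k\<bar>)"
  shows "AE \<omega> in iid_normal (UNIV::nat set). summable (\<lambda>k. \<bar>b k * \<omega> k\<bar>)"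
proof -
  define m where "m = (\<integral>\<^sup>+x. ennreal \<bar>x\<bar> \<partial>std_normal_distribution)"
  have "integrable std_normal_distribution (\<lambda>x. x)"
    using integrable_std_normal_distribution_moment[of 1] by simp
  then have m: "m < \<infinity>" by (simp add: m_def integrable_iff_bounded)
  have comp: "(\<integral>\<^sup>+\<omega>. ennreal \<bar>\<omega> k\<bar> \<partial>iid_normal UNIV) = m" for k :: nat
    unfolding m_def distr_iid_normal_component[of k UNIV, OF UNIV_I, symmetric]
    by (subst nn_integral_distr) (auto intro: measurable_iid_normal_component)
  note [measurable] = measurable_iid_normal_component
  have "(\<integral>\<^sup>+\<omega>. (\<Sum>k. ennreal \<bar>b k * \<omega> k\<bar>) \<partial>iid_normal UNIV)
      = (\<Sum>k. \<integral>\<^sup>+\<omega>. ennreal \<bar>b k\<bar> * ennreal \<bar>\<omega> k\<bar> \<partial>iid_normal UNIV)"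
    by (subst nn_integral_suminf) (auto simp: abs_mult ennreal_mult)
  also have "\<dots> = (\<Sum>k. ennreal \<bar>b k\<bar>) * m"
    by (simp add: nn_integral_cmult comp)
  also have "\<dots> < \<infinity>"
    using m assms by (simp add: suminf_ennreal2 ennreal_mult_less_top)
  finally have "(\<integral>\<^sup>+\<omega>. (\<Sum>k. ennreal \<bar>b k * \<omega> k\<bar>) \<partial>iid_normal UNIV) \<noteq> \<infinity>" by simp
  then have "AE \<omega> in iid_normal UNIV. (\<Sum>k. ennreal \<bar>b k * \<omega> k\<bar>) \<noteq> \<infinity>"
    by (intro nn_integral_PInf_AE) auto
  then show ?thesis
    by (rule AE_mp) (auto intro!: AE_I2 summable_suminf_not_top)
qed

lemma measurable_gaussian_series:
  "(\<lambda>\<omega>. \<Sum>k. b k * \<omega> k) \<in> borel_measurable (iid_normal (UNIV::nat set))"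
  by (intro borel_measurable_suminf borel_measurable_times borel_measurable_const measurable_iid_normal_component UNIV_I)

lemma char_gaussian_series:
  assumes b: "summable (\<lambda>k. \<bar>b k\<bar>)"
  shows "(CLINT \<omega>|iid_normal (UNIV::nat set). iexp (\<Sum>k. b k * \<omega> k)) = exp (- (\<Sum>k. (b k)\<^sup>2) / 2)"
proof (rule LIMSEQ_unique)
  interpret prob_space "iid_normal (UNIV::nat set)" by (rule prob_space_iid_normal)
  note [measurable] = measurable_iid_normal_component measurable_gaussian_series
  show "(\<lambda>n. CLINT \<omega>|iid_normal (UNIV::nat set). iexp (\<Sum>k<n. b k * \<omega> k))
      \<longlonglongrightarrow> (CLINT \<omega>|iid_normal UNIV. iexp (\<Sum>k. b k * \<omega> k))"
  proof (rule integral_dominated_convergence[where w = "\<lambda>_. 1"])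
    show "AE \<omega> in iid_normal (UNIV::nat set). (\<lambda>n. iexp (\<Sum>k<n. b k * \<omega> k)) \<longlonglongrightarrow> iexp (\<Sum>k. b k * \<omega> k)"
      using AE_iid_normal_summable[OF b]
    proof (rule AE_mp, intro AE_I2 impI)
      fix \<omega> :: "nat \<Rightarrow> real" assume "summable (\<lambda>k. \<bar>b k * \<omega> k\<bar>)"
      then have "summable (\<lambda>k. b k * \<omega> k)" by (rule summable_rabs_cancel)
      then show "(\<lambda>n. iexp (\<Sum>k<n. b k * \<omega> k)) \<longlonglongrightarrow> iexp (\<Sum>k. b k * \<omega> k)"
        by (intro tendsto_intros summable_LIMSEQ)
    qed
  qed auto
  have "summable (\<lambda>k. (b k)\<^sup>2)"
  proof (rule summable_comparison_test_ev[OF _ b])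
    have "(\<lambda>k. \<bar>b k\<bar>) \<longlonglongrightarrow> 0" by (rule summable_LIMSEQ_zero[OF b])
    then have "\<forall>\<^sub>F k in sequentially. \<bar>b k\<bar> < 1" by (rule order_tendstoD) simp
    then show "\<forall>\<^sub>F k in sequentially. norm ((b k)\<^sup>2) \<le> \<bar>b k\<bar>"
    proof eventually_elim
      case (elim k)
      then have "\<bar>b k\<bar> * \<bar>b k\<bar> \<le> 1 * \<bar>b k\<bar>" by (intro mult_right_mono) auto
      then show ?case by (simp add: power2_eq_square abs_mult)
    qed
  qed
  then have "(\<lambda>n. complex_of_real (exp (- (\<Sum>k<n. (b k)\<^sup>2) / 2))) \<longlonglongrightarrow> exp (- (\<Sum>k. (b k)\<^sup>2) / 2)"
    by (intro tendsto_intros summable_LIMSEQ) auto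
  then show "(\<lambda>n. CLINT \<omega>|iid_normal (UNIV::nat set). iexp (\<Sum>k<n. b k * \<omega> k))
      \<longlonglongrightarrow> exp (- (\<Sum>k. (b k)\<^sup>2) / 2)"
    by (simp only: char_iid_normal_sum finite_lessThan subset_UNIV)
qed

section \<open>Normal variables recognised by their characteristic functions\<close>

lemma distr_eq_scaled_normal:
  assumes M: "prob_space M" and Y [measurable]: "Y \<in> borel_measurable M"
    and char: "\<And>u. (CLINT \<omega>|M. iexp (u * Y \<omega>)) = exp (- (u\<^sup>2 * \<sigma>\<^sup>2) / 2)"
  shows "distr M borel Y = distr std_normal_distribution borel (\<lambda>x. \<sigma> * x)"
proof (rule Levy_uniqueness)
  show "real_distribution (distr M borel Y)"
    using prob_space.real_distribution_distr[OF M Y] .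
  show "real_distribution (distr std_normal_distribution borel (\<lambda>x. \<sigma> * x))"
    by (rule prob_space.real_distribution_distr[OF prob_space_std_normal]) auto
  show "char (distr M borel Y) = char (distr std_normal_distribution borel (\<lambda>x. \<sigma> * x))"
  proof
    fix u
    have "char (distr std_normal_distribution borel (\<lambda>x. \<sigma> * x)) u = char std_normal_distribution (u * \<sigma>)"
      by (simp add: char_def integral_distr mult.assoc)
    moreover have "char (distr M borel Y) u = (CLINT \<omega>|M. iexp (u * Y \<omega>))"
      unfolding char_def by (rule integral_distr[OF Y]) measurable
    ultimately show "char (distr M borel Y) u = char (distr std_normal_distribution borel (\<lambda>x. \<sigma> * x)) u"
      by (simp only: char char_std_normal_distribution power_mult_distrib)
  qed
qed

text \<open>The comparison is with a multiple of a standard normal variable, and the factor may be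
  0. All moments come from the standard normal ones in this way, and \<open>v = 0\<close> leads to
  the point mass clause of \<open>gaussian_variable\<close>.\<close>

lemma
  assumes M: "prob_space M" and Y [measurable]: "Y \<in> borel_measurable M"
    and char: "\<And>u. (CLINT \<omega>|M. iexp (u * Y \<omega>)) = exp (- (u\<^sup>2 * v) / 2)" and v: "v \<ge> 0"
  shows gaussian_variable_if_char: "gaussian_variable M Y"
    and gaussian_integrable_if_char: "integrable M Y" "integrable M (\<lambda>\<omega>. (Y \<omega>)\<^sup>2)"
    and gaussian_moments_if_char: "(LINT \<omega>|M. Y \<omega>) = 0" "(LINT \<omega>|M. (Y \<omega>)\<^sup>2) = v"
proof -
  interpret prob_space M by fact
  define \<sigma> where "\<sigma> = sqrt v"
  have \<sigma>: "\<sigma>\<^sup>2 = v" "\<sigma> \<ge> 0" using v by (auto simp: \<sigma>_def)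
  define N where "N = std_normal_distribution"
  have D: "distr M borel Y = distr N borel (\<lambda>x. \<sigma> * x)"
    unfolding N_def by (rule distr_eq_scaled_normal[OF M Y]) (simp only: char \<sigma>)
  have f: "fact 2 / (2 ^ 1 * fact 1) = (1::real)" by (simp add: fact_numeral)
  have i2: "integrable N (\<lambda>x. x\<^sup>2)" "(LINT x|N. x\<^sup>2) = 1"
    unfolding N_def using std_normal_distribution_even_moments[of 1] f by (simp_all only: mult_1_right)
  have i1: "integrable N (\<lambda>x. x)" "(LINT x|N. x) = 0"
    unfolding N_def using integrable_std_normal_distribution_moment[of 1] integral_std_normal_distribution_moment_odd[OF odd_one]
    by (simp_all only: power_one_right)
  have eqi: "integrable M (\<lambda>\<omega>. g (Y \<omega>)) = integrable N (\<lambda>x. g (\<sigma> * x))"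
    and eqI: "(LINT \<omega>|M. g (Y \<omega>)) = (LINT x|N. g (\<sigma> * x))"
    if [measurable]: "g \<in> borel_measurable borel" for g :: "real \<Rightarrow> real"
  proof -
    have m: "(\<lambda>x. \<sigma> * x) \<in> N \<rightarrow>\<^sub>M borel" by (simp add: N_def)
    show "integrable M (\<lambda>\<omega>. g (Y \<omega>)) = integrable N (\<lambda>x. g (\<sigma> * x))"
      by (rule trans[OF integrable_distr_eq[OF Y that, symmetric, unfolded D] integrable_distr_eq[OF m that]])
    show "(LINT \<omega>|M. g (Y \<omega>)) = (LINT x|N. g (\<sigma> * x))"
      by (rule trans[OF integral_distr[OF Y that, symmetric, unfolded D] integral_distr[OF m that]])
  qed
  have id: "(\<lambda>x::real. x) \<in> borel_measurable borel" and sq: "(\<lambda>x::real. x\<^sup>2) \<in> borel_measurable borel"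
    by simp_all
  have \<sigma>sq: "(\<lambda>x. (\<sigma> * x)\<^sup>2) = (\<lambda>x. v * x\<^sup>2)" by (simp only: power_mult_distrib \<sigma>)
  show "integrable M Y" by (rule iffD2[OF eqi[OF id] integrable_mult_right[OF i1(1)]])
  show "(LINT \<omega>|M. Y \<omega>) = 0" by (rule trans[OF eqI[OF id]]) (simp only: integral_mult_right_zero i1 mult_zero_right)
  show sqi: "integrable M (\<lambda>\<omega>. (Y \<omega>)\<^sup>2)"
    by (rule iffD2[OF eqi[OF sq]], unfold \<sigma>sq, rule integrable_mult_right[OF i2(1)])
  show sqI: "(LINT \<omega>|M. (Y \<omega>)\<^sup>2) = v"
    by (rule trans[OF eqI[OF sq]], unfold \<sigma>sq) (simp only: integral_mult_right_zero i2 mult_1_right)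
  show "gaussian_variable M Y"
  proof (cases "v = 0")
    case True
    then have "(LINT \<omega>|M. (Y \<omega>)\<^sup>2) = 0" using sqI by simp
    then have "AE \<omega> in M. (Y \<omega>)\<^sup>2 = 0"
      using integral_nonneg_eq_0_iff_AE[OF sqi] by simp
    then have "AE \<omega> in M. Y \<omega> = 0" by simp
    then show ?thesis unfolding gaussian_variable_def using Y by blast
  next
    case False
    then have pos: "\<sigma> > 0" using v by (simp add: \<sigma>_def)
    interpret N: prob_space std_normal_distribution by (rule prob_space_std_normal)
    have "distributed std_normal_distribution lborel (\<lambda>x. x) std_normal_density"
      by (auto simp: distributed_def distr_id2)
    from N.normal_density_affine[OF this, of \<sigma> 0] pos
    have dN: "distributed std_normal_distribution lborel (\<lambda>x. \<sigma> * x) (normal_density 0 \<sigma>)" by simp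
    have "distr M lborel Y = distr M borel Y" by (rule distr_cong) auto
    also have "\<dots> = distr std_normal_distribution lborel (\<lambda>x. \<sigma> * x)"
      unfolding D N_def by (rule distr_cong) auto
    also have "\<dots> = density lborel (normal_density 0 \<sigma>)"
      by (rule distributed_distr_eq_density[OF dN])
    finally have L: "distr M lborel Y = density lborel (normal_density 0 \<sigma>)" .
    have "distributed M lborel Y (normal_density 0 \<sigma>)"
      unfolding distributed_def
    proof (intro conjI L)
      show "Y \<in> M \<rightarrow>\<^sub>M lborel" unfolding measurable_lborel1 by (rule Y)
      show "(\<lambda>x. ennreal (normal_density 0 \<sigma> x)) \<in> borel_measurable lborel"
        unfolding measurable_lborel2 by (intro measurable_compose[OF borel_measurable_normal_density] measurable_ennreal)
    qed
    then show ?thesis unfolding gaussian_variable_def using pos Y by blast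
  qed
qed

section \<open>Covariance kernels with a summable feature map\<close>

text \<open>An expansion of Mercer type. Square summability of the features would be enough for a
  kernel; their absolute summability is what makes the associated Gaussian series converge
  absolutely almost everywhere. Kernels of this kind are automatically positive semidefinite and are
  stable under sums and products.\<close>

definition feature_map :: "('i \<Rightarrow> 't \<Rightarrow> real) \<Rightarrow> ('t \<Rightarrow> 't \<Rightarrow> real) \<Rightarrow> bool" where
  "feature_map \<psi> c \<longleftrightarrow> (\<forall>t. (\<lambda>i. norm (\<psi> i t)) summable_on UNIV) \<and>
     (\<forall>s t. ((\<lambda>i. \<psi> i s * \<psi> i t) has_sum c s t) UNIV)"

definition feature_kernel :: "('t \<Rightarrow> 't \<Rightarrow> real) \<Rightarrow> bool" where
  "feature_kernel c \<longleftrightarrow> (\<exists>\<psi> :: nat \<Rightarrow> 't \<Rightarrow> real. feature_map \<psi> c)"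

text \<open>Indices outside the range of \<open>to_nat\<close> receive the zero feature, so disjoint
  sums and pairs may serve as index types below.\<close>

lemma feature_kernelI:
  fixes \<psi> :: "'i::countable \<Rightarrow> 't \<Rightarrow> real"
  assumes "feature_map \<psi> c" shows "feature_kernel c"
proof -
  define \<phi> where "\<phi> n t = (if n \<in> range (to_nat :: 'i \<Rightarrow> nat) then \<psi> (from_nat n) t else 0)" for n t
  have inj: "inj (to_nat :: 'i \<Rightarrow> nat)" by simp
  have red: "(g has_sum S) UNIV" if "((\<lambda>i. g (to_nat i)) has_sum S) (UNIV :: 'i set)"
    and "\<And>n. n \<notin> range (to_nat :: 'i \<Rightarrow> nat) \<Longrightarrow> g n = 0" for g :: "nat \<Rightarrow> real" and S
  proof -
    have "(g has_sum S) (range (to_nat :: 'i \<Rightarrow> nat))"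
      using that(1) has_sum_reindex[OF inj, of g S] by (simp add: o_def)
    then show ?thesis by (subst has_sum_cong_neutral[of "range (to_nat :: 'i \<Rightarrow> nat)"]) (auto simp: that(2))
  qed
  have \<phi>: "\<phi> (to_nat i) t = \<psi> i t" for i t by (simp add: \<phi>_def)
  have "feature_map \<phi> c"
    unfolding feature_map_def
  proof (intro conjI allI)
    fix s t
    have "((\<lambda>i. norm (\<psi> i t)) has_sum infsum (\<lambda>i. norm (\<psi> i t)) UNIV) UNIV"
      using assms unfolding feature_map_def by (intro has_sum_infsum) simp
    then have "((\<lambda>n. norm (\<phi> n t)) has_sum infsum (\<lambda>i. norm (\<psi> i t)) UNIV) UNIV"
      by (intro red) (simp_all only: \<phi>, simp add: \<phi>_def)
    then show "(\<lambda>n. norm (\<phi> n t)) summable_on UNIV" by (rule has_sum_imp_summable)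
    have "((\<lambda>i. \<psi> i s * \<psi> i t) has_sum c s t) UNIV" using assms by (simp add: feature_map_def)
    then show "((\<lambda>n. \<phi> n s * \<phi> n t) has_sum c s t) UNIV"
      by (intro red) (simp_all only: \<phi>, simp add: \<phi>_def)
  qed
  then show ?thesis unfolding feature_kernel_def by blast
qed

lemma feature_kernel_rank1: "feature_kernel (\<lambda>s t. f s * f t)"
proof (rule feature_kernelI)
  show "feature_map (\<lambda>_::unit. f) (\<lambda>s t. f s * f t)"
    unfolding feature_map_def UNIV_unit by (auto intro!: has_sum_finiteI)
qed

lemma feature_kernel_const: "a \<ge> 0 \<Longrightarrow> feature_kernel (\<lambda>s t. a)"
  using feature_kernel_rank1[of "\<lambda>_. sqrt a"] by simp

lemma feature_kernel_add:
  assumes "feature_kernel c" "feature_kernel d"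
  shows "feature_kernel (\<lambda>s t. c s t + d s t)"
proof -
  obtain \<phi> \<psi> :: "nat \<Rightarrow> 'a \<Rightarrow> real" where \<phi>: "feature_map \<phi> c" and \<psi>: "feature_map \<psi> d"
    using assms unfolding feature_kernel_def by blast
  define \<eta> where "\<eta> = case_sum \<phi> \<psi>"
  have un: "(g has_sum S + T) UNIV" if "((\<lambda>i. g (Inl i)) has_sum S) UNIV" "((\<lambda>i. g (Inr i)) has_sum T) UNIV"
    for g :: "nat + nat \<Rightarrow> real" and S T
  proof -
    have "(g has_sum S) (range Inl)" "(g has_sum T) (range Inr)"
      using that has_sum_reindex[of Inl UNIV g S] has_sum_reindex[of Inr UNIV g T] by (simp_all add: o_def)
    then have "(g has_sum S + T) (range Inl \<union> range Inr)" by (rule has_sum_Un_disjoint) auto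
    then show ?thesis by (simp add: UNIV_sum)
  qed
  have "feature_map \<eta> (\<lambda>s t. c s t + d s t)"
    unfolding feature_map_def
  proof (intro conjI allI)
    fix s t
    have "((\<lambda>i. norm (\<phi> i t)) has_sum infsum (\<lambda>i. norm (\<phi> i t)) UNIV) UNIV"
      "((\<lambda>i. norm (\<psi> i t)) has_sum infsum (\<lambda>i. norm (\<psi> i t)) UNIV) UNIV"
      using \<phi> \<psi> unfolding feature_map_def by (auto intro!: has_sum_infsum)
    then show "(\<lambda>n. norm (\<eta> n t)) summable_on UNIV"
      by (intro has_sum_imp_summable[OF un]) (simp_all add: \<eta>_def)
    show "((\<lambda>n. \<eta> n s * \<eta> n t) has_sum c s t + d s t) UNIV"
      using \<phi> \<psi> by (intro un) (simp_all add: feature_map_def \<eta>_def)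
  qed
  then show ?thesis by (rule feature_kernelI)
qed

lemma abs_summable_on_times:
  fixes f :: "'i \<Rightarrow> real" and g :: "'j \<Rightarrow> real"
  assumes f: "(\<lambda>i. norm (f i)) summable_on A" and g: "(\<lambda>j. norm (g j)) summable_on B"
  shows "(\<lambda>x. norm (case x of (i, j) \<Rightarrow> f i * g j)) summable_on A \<times> B"
  unfolding Infinite_Sum.abs_summable_on_Sigma_iff
proof (intro conjI ballI)
  fix i
  show "(\<lambda>j. norm (case (i, j) of (i, j) \<Rightarrow> f i * g j)) summable_on B"
    using summable_on_cmult_right[OF g, of "norm (f i)"] by (simp add: abs_mult)
next
  have "(\<Sum>\<^sub>\<infinity>j\<in>B. norm (case (i, j) of (i, j) \<Rightarrow> f i * g j)) = norm (f i) * (\<Sum>\<^sub>\<infinity>j\<in>B. norm (g j))" for i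
    by (simp add: abs_mult infsum_cmult_right')
  then show "(\<lambda>i. norm (\<Sum>\<^sub>\<infinity>j\<in>B. norm (case (i, j) of (i, j) \<Rightarrow> f i * g j))) summable_on A"
    using summable_on_cmult_left[OF f, of "\<Sum>\<^sub>\<infinity>j\<in>B. norm (g j)"] 
    by (simp add: abs_mult infsum_nonneg)
qed

text \<open>The Schur product theorem in terms of features: the products of two features, indexed by
  pairs.\<close>

lemma feature_kernel_mult:
  assumes "feature_kernel c" "feature_kernel d"
  shows "feature_kernel (\<lambda>s t. c s t * d s t)"
proof -
  obtain \<phi> \<psi> :: "nat \<Rightarrow> 'a \<Rightarrow> real" where \<phi>: "feature_map \<phi> c" and \<psi>: "feature_map \<psi> d"
    using assms unfolding feature_kernel_def by blast
  define \<eta> where "\<eta> = (\<lambda>(i, j) t. \<phi> i t * \<psi> j t)"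
  have "feature_map \<eta> (\<lambda>s t. c s t * d s t)"
    unfolding feature_map_def
  proof (intro conjI allI)
    fix s t
    have "(\<lambda>x. norm (case x of (i, j) \<Rightarrow> \<phi> i t * \<psi> j t)) summable_on UNIV \<times> UNIV"
      using \<phi> \<psi> by (intro abs_summable_on_times) (simp_all add: feature_map_def)
    moreover have "(\<lambda>n. norm (\<eta> n t)) = (\<lambda>x. norm (case x of (i, j) \<Rightarrow> \<phi> i t * \<psi> j t))"
      by (auto simp: \<eta>_def)
    ultimately show "(\<lambda>n. norm (\<eta> n t)) summable_on UNIV" by simp
    have h: "((\<lambda>i. \<phi> i s * \<phi> i t) has_sum c s t) UNIV" "((\<lambda>i. \<psi> i s * \<psi> i t) has_sum d s t) UNIV"
      using \<phi> \<psi> by (simp_all add: feature_map_def)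
    have "(\<lambda>x. norm (case x of (i, j) \<Rightarrow> (\<phi> i s * \<phi> i t) * (\<psi> j s * \<psi> j t))) summable_on UNIV \<times> UNIV"
      by (intro abs_summable_on_times h[THEN has_sum_imp_summable, THEN iffD1[OF summable_on_iff_abs_summable_on_real]])
    then have sm: "(\<lambda>(i, j). (\<phi> i s * \<phi> i t) * (\<psi> j s * \<psi> j t)) summable_on UNIV \<times> UNIV"
      by (rule iffD2[OF summable_on_iff_abs_summable_on_real])
    have "((\<lambda>(i, j). (\<phi> i s * \<phi> i t) * (\<psi> j s * \<psi> j t)) has_sum c s t * d s t) (UNIV \<times> UNIV)"
    proof (rule has_sum_SigmaI[OF _ _ sm])
      show "((\<lambda>j. case (i, j) of (i, j) \<Rightarrow> (\<phi> i s * \<phi> i t) * (\<psi> j s * \<psi> j t))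
          has_sum (\<phi> i s * \<phi> i t) * d s t) UNIV" for i
        using has_sum_cmult_right[OF h(2), of "\<phi> i s * \<phi> i t"] by simp
      show "((\<lambda>i. (\<phi> i s * \<phi> i t) * d s t) has_sum c s t * d s t) UNIV"
        by (rule has_sum_cmult_left[OF h(1)])
    qed
    moreover have "(\<lambda>n. \<eta> n s * \<eta> n t) = (\<lambda>(i, j). (\<phi> i s * \<phi> i t) * (\<psi> j s * \<psi> j t))"
      by (auto simp: \<eta>_def)
    ultimately show "((\<lambda>n. \<eta> n s * \<eta> n t) has_sum c s t * d s t) UNIV" by simp
  qed
  then show ?thesis by (rule feature_kernelI)
qed

lemma feature_kernel_sum:
  "(\<And>i. i \<in> I \<Longrightarrow> feature_kernel (c i)) \<Longrightarrow> feature_kernel (\<lambda>s t. \<Sum>i\<in>I. c i s t)"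
  by (induction I rule: infinite_finite_induct) (auto intro: feature_kernel_add feature_kernel_const)

lemma feature_kernel_prod:
  "(\<And>i. i \<in> I \<Longrightarrow> feature_kernel (c i)) \<Longrightarrow> feature_kernel (\<lambda>s t. \<Prod>i\<in>I. c i s t)"
  by (induction I rule: infinite_finite_induct) (auto intro: feature_kernel_mult feature_kernel_const)

lemma feature_kernel_cos: "feature_kernel (\<lambda>s t. cos (g s - g t))"
  unfolding cos_diff by (intro feature_kernel_add feature_kernel_rank1)

lemma feature_kernel_exp: "feature_kernel (\<lambda>s t. exp (g s * g t))"
proof (rule feature_kernelI)
  define \<psi> where "\<psi> k t = g t ^ k / sqrt (fact k)" for k t
  \<comment> \<open>The features of the exponential series must be summable themselves, not only
    their squares. The inequality 2 x y \<le> x^2 + y^2 with factors \<open>(1/2) ^ k\<close> and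
    \<open>2 ^ k\<close> split off bounds them by a geometric plus an exponential series.\<close>
  have bound: "\<bar>\<psi> k t\<bar> \<le> ((1/4) ^ k + (4 * (g t)\<^sup>2) ^ k /\<^sub>R fact k) / 2" for k t
  proof -
    have "2 * ((1/2) ^ k * ((2 * \<bar>g t\<bar>) ^ k / sqrt (fact k)))
        \<le> ((1/2) ^ k)\<^sup>2 + ((2 * \<bar>g t\<bar>) ^ k / sqrt (fact k))\<^sup>2"
      using sum_squares_bound[of "(1/2) ^ k" "(2 * \<bar>g t\<bar>) ^ k / sqrt (fact k)"] by (simp only: mult.assoc)
    moreover have "(1/2) ^ k * ((2 * \<bar>g t\<bar>) ^ k / sqrt (fact k)) = \<bar>\<psi> k t\<bar>"
      by (simp add: \<psi>_def power_mult_distrib power_abs power_one_over)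
    moreover have "((1/2::real) ^ k)\<^sup>2 = (1/4) ^ k"
      by (simp add: power2_eq_square power_mult_distrib[symmetric])
    moreover have "((2 * \<bar>g t\<bar>) ^ k / sqrt (fact k))\<^sup>2 = (4 * (g t)\<^sup>2) ^ k /\<^sub>R fact k"
    proof -
      have "((2 * \<bar>g t\<bar>) ^ k)\<^sup>2 = ((2 * \<bar>g t\<bar>)\<^sup>2) ^ k" by (metis mult.commute power_mult)
      also have "(2 * \<bar>g t\<bar>)\<^sup>2 = 4 * (g t)\<^sup>2" by (simp add: power_mult_distrib)
      finally have "((2 * \<bar>g t\<bar>) ^ k)\<^sup>2 = (4 * (g t)\<^sup>2) ^ k" .
      moreover have "(sqrt (fact k))\<^sup>2 = fact k" by simp
      ultimately show ?thesis by (simp only: power_divide) (simp add: divide_inverse mult.commute)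
    qed
    ultimately have "2 * \<bar>\<psi> k t\<bar> \<le> (1/4) ^ k + (4 * (g t)\<^sup>2) ^ k /\<^sub>R fact k" by (simp only:)
    then show ?thesis by (subst pos_le_divide_eq) (simp_all only: mult.commute[of _ 2] zero_less_numeral)
  qed
  have "summable (\<lambda>k. ((1/4) ^ k + (4 * (g t)\<^sup>2) ^ k /\<^sub>R fact k) / 2)" for t
    by (intro summable_divide summable_add summable_geometric summable_exp_generic) simp
  then have sm: "summable (\<lambda>k. norm (\<psi> k t))" for t
    by (rule summable_comparison_test') (use bound in simp)
  have "inverse (sqrt (fact k)) * inverse (sqrt (fact k)) = inverse (fact k :: real)" for k :: nat
    by (metis inverse_mult_distrib real_sqrt_mult_self abs_of_nonneg fact_ge_zero)
  then have prod: "\<psi> k s * \<psi> k t = (g s * g t) ^ k /\<^sub>R fact k" for k s t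
    by (simp add: \<psi>_def power_mult_distrib divide_inverse mult_ac flip: real_sqrt_mult)
  show "feature_map \<psi> (\<lambda>s t. exp (g s * g t))"
    unfolding feature_map_def
  proof (intro conjI allI)
    fix s t
    show "(\<lambda>k. norm (\<psi> k t)) summable_on UNIV" using sm[of t] by (intro norm_summable_imp_summable_on) simp
    show "((\<lambda>k. \<psi> k s * \<psi> k t) has_sum exp (g s * g t)) UNIV"
      unfolding prod by (intro norm_summable_imp_has_sum summable_norm_exp exp_converges)
  qed
qed

lemma feature_kernel_gauss: "feature_kernel (\<lambda>s t. exp (- (g s - g t)\<^sup>2 / 2))"
proof -
  have "(\<lambda>s t. exp (- (g s - g t)\<^sup>2 / 2)) = (\<lambda>s t. exp (- (g s)\<^sup>2 / 2) * exp (- (g t)\<^sup>2 / 2) * exp (g s * g t))"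
    by (intro ext) (simp add: exp_add[symmetric] power2_diff field_simps)
  then show ?thesis
    by (simp only: feature_kernel_mult[OF feature_kernel_rank1 feature_kernel_exp])
qed

lemma has_sum_sum:
  fixes f :: "'j \<Rightarrow> 'i \<Rightarrow> real"
  shows "(\<And>j. j \<in> J \<Longrightarrow> (f j has_sum S j) A) \<Longrightarrow> ((\<lambda>i. \<Sum>j\<in>J. f j i) has_sum (\<Sum>j\<in>J. S j)) A"
  by (induction J rule: infinite_finite_induct) (auto intro: has_sum_add)

lemma feature_map_sym:
  assumes "feature_map \<psi> c" shows "c s t = c t s"
proof (rule has_sum_unique)
  show "((\<lambda>i. \<psi> i s * \<psi> i t) has_sum c s t) UNIV" using assms by (simp add: feature_map_def)
  have "((\<lambda>i. \<psi> i t * \<psi> i s) has_sum c t s) UNIV" using assms by (simp add: feature_map_def)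
  then show "((\<lambda>i. \<psi> i s * \<psi> i t) has_sum c t s) UNIV" by (simp only: mult.commute)
qed

text \<open>Serves twice: nonnegativity of the terms is positive semidefiniteness of
  \<open>c\<close>, and the value is the variance of the corresponding linear combination of the
  Gaussian field.\<close>

lemma feature_kernel_quadratic_form:
  assumes "feature_map \<psi> c"
  shows "((\<lambda>i. (\<Sum>t\<in>T. a t * \<psi> i t)\<^sup>2) has_sum (\<Sum>s\<in>T. \<Sum>t\<in>T. a s * a t * c s t)) UNIV"
proof -
  have "((\<lambda>i. \<Sum>s\<in>T. \<Sum>t\<in>T. (a s * a t) * (\<psi> i s * \<psi> i t)) has_sum (\<Sum>s\<in>T. \<Sum>t\<in>T. (a s * a t) * c s t)) UNIV"
    using assms by (intro has_sum_sum has_sum_cmult_right) (simp add: feature_map_def)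
  moreover have "(\<Sum>s\<in>T. \<Sum>t\<in>T. (a s * a t) * (\<psi> i s * \<psi> i t)) = (\<Sum>t\<in>T. a t * \<psi> i t)\<^sup>2" for i
    by (simp add: power2_eq_square sum_product mult_ac)
  ultimately show ?thesis by simp
qed

lemma feature_kernel_psd:
  assumes "feature_kernel c" shows "0 \<le> (\<Sum>s\<in>T. \<Sum>t\<in>T. a s * a t * c s t)"
proof -
  obtain \<psi> :: "nat \<Rightarrow> 'a \<Rightarrow> real" where "feature_map \<psi> c" using assms unfolding feature_kernel_def by blast
  from feature_kernel_quadratic_form[OF this] show ?thesis by (rule has_sum_nonneg) simp
qed

lemma feature_kernel_sym: "feature_kernel c \<Longrightarrow> c s t = c t s"
  unfolding feature_kernel_def by (elim exE) (rule feature_map_sym)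

section \<open>Gaussian fields with a given covariance kernel\<close>

definition gauss_field :: "(nat \<Rightarrow> 't \<Rightarrow> real) \<Rightarrow> 't \<Rightarrow> (nat \<Rightarrow> real) \<Rightarrow> real" where
  "gauss_field \<psi> t \<omega> = (\<Sum>k. \<psi> k t * \<omega> k)"

lemma measurable_gauss_field [measurable]: "gauss_field \<psi> t \<in> borel_measurable (iid_normal UNIV)"
  unfolding gauss_field_def by (rule measurable_gaussian_series)

lemma char_gauss_field:
  assumes \<psi>: "feature_map \<psi> c" and T: "finite T"
  shows "(CLINT \<omega>|iid_normal UNIV. iexp (\<Sum>t\<in>T. a t * gauss_field \<psi> t \<omega>))
    = exp (- (\<Sum>s\<in>T. \<Sum>t\<in>T. a s * a t * c s t) / 2)"
proof -
  note [measurable] = measurable_iid_normal_component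
  define b where "b k = (\<Sum>t\<in>T. a t * \<psi> k t)" for k
  have sm: "summable (\<lambda>k. \<bar>\<psi> k t\<bar>)" for t
    using \<psi> summable_on_imp_summable[of "\<lambda>k. norm (\<psi> k t)"] by (simp add: feature_map_def)
  have smb: "summable (\<lambda>k. \<bar>b k\<bar>)"
  proof (rule summable_comparison_test')
    show "summable (\<lambda>k. \<Sum>t\<in>T. \<bar>a t\<bar> * \<bar>\<psi> k t\<bar>)" by (intro summable_sum summable_mult sm)
    show "norm \<bar>b k\<bar> \<le> (\<Sum>t\<in>T. \<bar>a t\<bar> * \<bar>\<psi> k t\<bar>)" for k
      unfolding b_def using sum_abs[of "\<lambda>t. a t * \<psi> k t" T] by (simp add: abs_mult)
  qed
  \<comment> \<open>Each \<open>t\<close> has its own null set of divergence. For finite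
    \<open>T\<close> there is a common one, off which the series and the sum over \<open>T\<close>
    commute.\<close>
  have "AE \<omega> in iid_normal UNIV. \<forall>t\<in>T. summable (\<lambda>k. \<bar>\<psi> k t * \<omega> k\<bar>)"
    using T by (intro AE_finite_allI AE_iid_normal_summable sm)
  then have "AE \<omega> in iid_normal UNIV. iexp (\<Sum>t\<in>T. a t * gauss_field \<psi> t \<omega>) = iexp (\<Sum>k. b k * \<omega> k)"
  proof (rule AE_mp, intro AE_I2 impI)
    fix \<omega> :: "nat \<Rightarrow> real" assume "\<forall>t\<in>T. summable (\<lambda>k. \<bar>\<psi> k t * \<omega> k\<bar>)"
    then have s: "summable (\<lambda>k. \<psi> k t * \<omega> k)" if "t \<in> T" for t
      using that by (auto intro: summable_rabs_cancel)
    have "(\<lambda>k. \<Sum>t\<in>T. a t * (\<psi> k t * \<omega> k)) sums (\<Sum>t\<in>T. a t * gauss_field \<psi> t \<omega>)"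
      unfolding gauss_field_def by (intro sums_sum sums_mult summable_sums s)
    moreover have "(\<Sum>t\<in>T. a t * (\<psi> k t * \<omega> k)) = b k * \<omega> k" for k
      unfolding b_def by (simp add: sum_distrib_right mult.assoc)
    ultimately have "(\<Sum>t\<in>T. a t * gauss_field \<psi> t \<omega>) = (\<Sum>k. b k * \<omega> k)" by (simp add: sums_iff)
    then show "iexp (\<Sum>t\<in>T. a t * gauss_field \<psi> t \<omega>) = iexp (\<Sum>k. b k * \<omega> k)" by (simp only:)
  qed
  then have "(CLINT \<omega>|iid_normal UNIV. iexp (\<Sum>t\<in>T. a t * gauss_field \<psi> t \<omega>)) = (CLINT \<omega>|iid_normal UNIV. iexp (\<Sum>k. b k * \<omega> k))"
    by (intro integral_cong_AE) measurable
  also have "\<dots> = exp (- (\<Sum>k. (b k)\<^sup>2) / 2)" by (rule char_gaussian_series[OF smb])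
  also have "(\<Sum>k. (b k)\<^sup>2) = (\<Sum>s\<in>T. \<Sum>t\<in>T. a s * a t * c s t)"
    using has_sum_imp_sums[OF feature_kernel_quadratic_form[OF \<psi>, of a T]] by (simp add: b_def sums_iff)
  finally show ?thesis .
qed

lemma
  assumes \<psi>: "feature_map \<psi> c" and T: "finite T"
  shows gaussian_variable_field: "gaussian_variable (iid_normal UNIV) (\<lambda>\<omega>. \<Sum>t\<in>T. a t * gauss_field \<psi> t \<omega>)"
    and integrable_field_comb_sq: "integrable (iid_normal UNIV) (\<lambda>\<omega>. (\<Sum>t\<in>T. a t * gauss_field \<psi> t \<omega>)\<^sup>2)"
    and mean_field_comb: "(LINT \<omega>|iid_normal UNIV. (\<Sum>t\<in>T. a t * gauss_field \<psi> t \<omega>)) = 0"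
    and integrable_field_comb: "integrable (iid_normal UNIV) (\<lambda>\<omega>. \<Sum>t\<in>T. a t * gauss_field \<psi> t \<omega>)"
    and variance_field_comb: "(LINT \<omega>|iid_normal UNIV. (\<Sum>t\<in>T. a t * gauss_field \<psi> t \<omega>)\<^sup>2)
      = (\<Sum>s\<in>T. \<Sum>t\<in>T. a s * a t * c s t)"
proof -
  define v where "v = (\<Sum>s\<in>T. \<Sum>t\<in>T. a s * a t * c s t)"
  have v0: "v \<ge> 0"
    unfolding v_def by (rule has_sum_nonneg[OF feature_kernel_quadratic_form[OF \<psi>]]) simp
  have m: "(\<lambda>\<omega>. \<Sum>t\<in>T. a t * gauss_field \<psi> t \<omega>) \<in> borel_measurable (iid_normal UNIV)" by measurable
  have char: "(CLINT \<omega>|iid_normal UNIV. iexp (u * (\<Sum>t\<in>T. a t * gauss_field \<psi> t \<omega>))) = exp (- (u\<^sup>2 * v) / 2)" for u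
  proof -
    have "(CLINT \<omega>|iid_normal UNIV. iexp (\<Sum>t\<in>T. u * a t * gauss_field \<psi> t \<omega>))
        = exp (- (\<Sum>s\<in>T. \<Sum>t\<in>T. (u * a s) * (u * a t) * c s t) / 2)"
      by (rule char_gauss_field[OF \<psi> T])
    moreover have "(\<Sum>s\<in>T. \<Sum>t\<in>T. (u * a s) * (u * a t) * c s t) = u\<^sup>2 * v"
      unfolding v_def by (simp add: sum_distrib_left power2_eq_square mult_ac)
    ultimately show ?thesis by (simp only: sum_distrib_left mult.assoc)
  qed
  note g = prob_space_iid_normal m char v0
  show "gaussian_variable (iid_normal UNIV) (\<lambda>\<omega>. \<Sum>t\<in>T. a t * gauss_field \<psi> t \<omega>)"
    by (rule gaussian_variable_if_char[OF g])
  show "integrable (iid_normal UNIV) (\<lambda>\<omega>. (\<Sum>t\<in>T. a t * gauss_field \<psi> t \<omega>)\<^sup>2)"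
    by (rule gaussian_integrable_if_char(2)[OF g])
  show "integrable (iid_normal UNIV) (\<lambda>\<omega>. \<Sum>t\<in>T. a t * gauss_field \<psi> t \<omega>)"
    by (rule gaussian_integrable_if_char(1)[OF g])
  show "(LINT \<omega>|iid_normal UNIV. (\<Sum>t\<in>T. a t * gauss_field \<psi> t \<omega>)) = 0"
    by (rule gaussian_moments_if_char(1)[OF g])
  show "(LINT \<omega>|iid_normal UNIV. (\<Sum>t\<in>T. a t * gauss_field \<psi> t \<omega>)\<^sup>2) = (\<Sum>s\<in>T. \<Sum>t\<in>T. a s * a t * c s t)"
    by (rule gaussian_moments_if_char(2)[OF g, unfolded v_def])
qed

text \<open>Covariances come from variances by polarisation over \<open>{s, t}\<close>; the case
  \<open>s = t\<close> is separate because that set then has only one element.\<close>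

lemma
  assumes \<psi>: "feature_map \<psi> c"
  shows integrable_field: "integrable (iid_normal UNIV) (gauss_field \<psi> t)"
    and mean_field: "(LINT \<omega>|iid_normal UNIV. gauss_field \<psi> t \<omega>) = 0"
    and integrable_field_product: "integrable (iid_normal UNIV) (\<lambda>\<omega>. gauss_field \<psi> s \<omega> * gauss_field \<psi> t \<omega>)"
    and covariance_field: "(LINT \<omega>|iid_normal UNIV. gauss_field \<psi> s \<omega> * gauss_field \<psi> t \<omega>) = c s t"
proof -
  let ?N = "iid_normal (UNIV :: nat set)" and ?X = "gauss_field \<psi>"
  show "integrable ?N (?X t)" using integrable_field_comb[OF \<psi>, of "{t}" "\<lambda>_. 1"] by simp
  show "(LINT \<omega>|?N. ?X t \<omega>) = 0" using mean_field_comb[OF \<psi>, of "{t}" "\<lambda>_. 1"] by simp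
  have sq: "integrable ?N (\<lambda>\<omega>. (?X r \<omega>)\<^sup>2)" "(LINT \<omega>|?N. (?X r \<omega>)\<^sup>2) = c r r" for r
    using integrable_field_comb_sq[OF \<psi>, of "{r}" "\<lambda>_. 1"] variance_field_comb[OF \<psi>, of "{r}" "\<lambda>_. 1"] by simp_all
  have "integrable ?N (\<lambda>\<omega>. ?X s \<omega> * ?X t \<omega>) \<and> (LINT \<omega>|?N. ?X s \<omega> * ?X t \<omega>) = c s t"
  proof (cases "s = t")
    case True then show ?thesis using sq[of t] by (simp add: power2_eq_square)
  next
    case False
    have sum: "integrable ?N (\<lambda>\<omega>. (?X s \<omega> + ?X t \<omega>)\<^sup>2)"
      "(LINT \<omega>|?N. (?X s \<omega> + ?X t \<omega>)\<^sup>2) = c s s + c s t + (c t s + c t t)"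
      using integrable_field_comb_sq[OF \<psi>, of "{s, t}" "\<lambda>_. 1"] variance_field_comb[OF \<psi>, of "{s, t}" "\<lambda>_. 1"] False
      by simp_all
    have "integrable ?N (\<lambda>\<omega>. ((?X s \<omega> + ?X t \<omega>)\<^sup>2 - (?X s \<omega>)\<^sup>2 - (?X t \<omega>)\<^sup>2) / 2)"
      by (intro integrable_divide Bochner_Integration.integrable_diff sum(1) sq(1))
    moreover have "(LINT \<omega>|?N. ((?X s \<omega> + ?X t \<omega>)\<^sup>2 - (?X s \<omega>)\<^sup>2 - (?X t \<omega>)\<^sup>2) / 2)
        = (c s s + c s t + (c t s + c t t) - c s s - c t t) / 2"
      by (simp only: integral_divide_zero Bochner_Integration.integral_diff
          Bochner_Integration.integrable_diff sum sq)
    moreover have "(c s s + c s t + (c t s + c t t) - c s s - c t t) / 2 = c s t"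
      using feature_map_sym[OF \<psi>, of t s] by simp
    moreover have "((?X s \<omega> + ?X t \<omega>)\<^sup>2 - (?X s \<omega>)\<^sup>2 - (?X t \<omega>)\<^sup>2) / 2 = ?X s \<omega> * ?X t \<omega>" for \<omega>
      by (simp add: power2_sum)
    ultimately show ?thesis by (simp only:)
  qed
  then show "integrable ?N (\<lambda>\<omega>. ?X s \<omega> * ?X t \<omega>)" "(LINT \<omega>|?N. ?X s \<omega> * ?X t \<omega>) = c s t" by auto
qed

section \<open>Laws on path space of fields along one basis vector\<close>

lemma borel_measurable_bounded_linear:
  "bounded_linear f \<Longrightarrow> f \<in> borel_measurable borel"
  by (intro borel_measurable_continuous_onI) (simp add: linear_continuous_on)

lemma measurable_tensor:
  fixes z :: "'h::{complex_hilbert_space, second_countable_topology}"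
  assumes [measurable]: "X \<in> borel_measurable M" "Y \<in> borel_measurable M"
  shows "(\<lambda>\<omega>. tensor (X \<omega>) (Y \<omega>) z) \<in> borel_measurable M"
proof -
  note [measurable] = borel_measurable_bounded_linear[OF bounded_linear_cinner[of z]]
    borel_measurable_bounded_linear[OF bounded_linear_scaleC_right[of "\<i>", where 'h = 'h]]
  \<comment> \<open>Splitting the complex scalar reduces measurability to real scaling and
    continuous linear maps. The minus sign stems from exchanging the arguments of
    \<open>cinner\<close>.\<close>
  have "tensor (X \<omega>) (Y \<omega>) z = Re (cinner (Y \<omega>) z) *\<^sub>R X \<omega> + (- Im (cinner (Y \<omega>) z)) *\<^sub>R (\<i> *\<^sub>C X \<omega>)" for \<omega>
    unfolding tensor_def by (subst scaleC_Re_Im) (simp add: cinner_commute[of z])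
  then show ?thesis by simp
qed

lemma integrable_iexp_mult:
  assumes k: "integrable lborel (k :: real^'d \<Rightarrow> real)"
  shows "integrable lborel (\<lambda>h. iexp (h \<bullet> \<theta>) * complex_of_real (k h))"
proof (rule Bochner_Integration.integrable_bound[OF k])
  show "(\<lambda>h. iexp (h \<bullet> \<theta>) * complex_of_real (k h)) \<in> borel_measurable lborel"
    using borel_measurable_integrable[OF k] by measurable
  show "AE h in lborel. norm (iexp (h \<bullet> \<theta>) * complex_of_real (k h)) \<le> norm (k h)"
    by (rule AE_I2) (simp add: norm_mult)
qed

text \<open>As an image of a countable product measure, the law on uncountably many coordinates
  exists without an extension theorem. Where the series diverges a path has an unspecified value,
  for each fixed time only on a null set.\<close>

definition field_law :: "'h::{complex_hilbert_space, second_countable_topology} set \<Rightarrow> 'h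
    \<Rightarrow> (nat \<Rightarrow> real^'d \<Rightarrow> real) \<Rightarrow> ((real^'d) \<Rightarrow> 'h) measure" where
  "field_law E e \<psi> = distr (iid_normal UNIV) (real_path_space E) (\<lambda>\<omega> t. gauss_field \<psi> t \<omega> *\<^sub>R e)"

lemma measurable_path_component:
  "(\<lambda>\<omega>. \<omega> t) \<in> borel_measurable (real_path_space E)"
proof -
  have "(\<lambda>\<omega>. \<omega> t) \<in> real_path_space E \<rightarrow>\<^sub>M restrict_space borel {x. real_element E x}"
    unfolding real_path_space_def by (rule measurable_component_singleton) simp
  then show ?thesis by (rule measurable_restrict_space2_iff[THEN iffD1, THEN conjunct1])
qed

lemma gaussian_variable_distrI:
  assumes F [measurable]: "F \<in> M \<rightarrow>\<^sub>M N" and Y [measurable]: "Y \<in> borel_measurable N"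
    and g: "gaussian_variable M (\<lambda>\<omega>. Y (F \<omega>))"
  shows "gaussian_variable (distr M N F) Y"
proof -
  from g consider \<mu> \<sigma> where "0 < \<sigma>" "distributed M lborel (\<lambda>\<omega>. Y (F \<omega>)) (\<lambda>x. ennreal (normal_density \<mu> \<sigma> x))"
    | c where "AE \<omega> in M. Y (F \<omega>) = c"
    unfolding gaussian_variable_def by blast
  then show ?thesis
  proof cases
    case 1
    have YF: "Y \<in> N \<rightarrow>\<^sub>M lborel" unfolding measurable_lborel1 by (rule Y)
    have eq: "distr (distr M N F) lborel Y = distr M lborel (\<lambda>\<omega>. Y (F \<omega>))"
      using distr_distr[OF YF F] unfolding comp_def .
    have "distributed (distr M N F) lborel Y (\<lambda>x. ennreal (normal_density \<mu> \<sigma> x))"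
      unfolding distributed_def
    proof (intro conjI)
      show "distr (distr M N F) lborel Y = density lborel (\<lambda>x. ennreal (normal_density \<mu> \<sigma> x))"
        unfolding eq by (rule distributed_distr_eq_density[OF 1(2)])
      show "Y \<in> distr M N F \<rightarrow>\<^sub>M lborel" unfolding measurable_distr_eq1 by (rule YF)
      show "(\<lambda>x. ennreal (normal_density \<mu> \<sigma> x)) \<in> borel_measurable lborel"
        by (rule distributed_borel_measurable[OF 1(2)])
    qed
    moreover have "Y \<in> borel_measurable (distr M N F)" unfolding measurable_distr_eq1 by (rule Y)
    ultimately show ?thesis using 1(1) unfolding gaussian_variable_def by blast
  next
    case 2
    have "Y -` {c} \<inter> space N \<in> sets N" by (rule measurable_sets[OF Y]) simp
    also have "Y -` {c} \<inter> space N = {x \<in> space N. Y x = c}" by auto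
    finally have "{x \<in> space N. Y x = c} \<in> sets N" .
    then have "AE \<omega> in distr M N F. Y \<omega> = c" by (rule iffD2[OF AE_distr_iff[OF F] 2])
    moreover have "Y \<in> borel_measurable (distr M N F)" unfolding measurable_distr_eq1 by (rule Y)
    ultimately show ?thesis unfolding gaussian_variable_def by blast
  qed
qed

context
  fixes E :: "'h::{complex_hilbert_space, second_countable_topology} set" and e :: 'h
    and \<psi> :: "nat \<Rightarrow> real^'d \<Rightarrow> real" and k :: "real^'d \<Rightarrow> real"
  assumes E: "complete_orthonormal_system E" and e: "e \<in> E"
    and \<psi>: "feature_map \<psi> (\<lambda>s t. k (s - t))"
begin

lemma measurable_field_path [measurable]:
  "(\<lambda>\<omega> t. gauss_field \<psi> t \<omega> *\<^sub>R e) \<in> iid_normal UNIV \<rightarrow>\<^sub>M real_path_space E"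
proof -
  have re: "real_element E (x *\<^sub>R e)" for x
    using complete_orthonormal_systemD(1)[OF E e] by (auto simp: real_element_def cinner_scaleR_left)
  have comp: "(\<lambda>\<omega>. gauss_field \<psi> t \<omega> *\<^sub>R e) \<in> iid_normal UNIV \<rightarrow>\<^sub>M restrict_space borel {x. real_element E x}" for t
  proof (rule measurable_restrict_space2)
    show "(\<lambda>\<omega>. gauss_field \<psi> t \<omega> *\<^sub>R e) \<in> space (iid_normal UNIV) \<rightarrow> {x. real_element E x}"
      by (intro Pi_I) (simp only: mem_Collect_eq re)
    show "(\<lambda>\<omega>. gauss_field \<psi> t \<omega> *\<^sub>R e) \<in> borel_measurable (iid_normal UNIV)"
      by (intro borel_measurable_scaleR measurable_gauss_field borel_measurable_const)
  qed
  show ?thesis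
    unfolding real_path_space_def
  proof (rule measurable_PiM_single'[OF comp])
    show "(\<lambda>\<omega> t. gauss_field \<psi> t \<omega> *\<^sub>R e) \<in> space (iid_normal UNIV) \<rightarrow>
        (\<Pi>\<^sub>E t\<in>UNIV. space (restrict_space borel {x. real_element E x}))"
      by (intro Pi_I) (simp add: space_restrict_space PiE_UNIV_domain re Pi_I)
  qed
qed

lemma prob_space_field_law: "prob_space (field_law E e \<psi>)"
  unfolding field_law_def by (intro prob_space.prob_space_distr prob_space_iid_normal) measurable

lemma sets_field_law: "sets (field_law E e \<psi>) = sets (real_path_space E)"
  by (simp add: field_law_def)

lemma integral_field_law:
  fixes f :: "_ \<Rightarrow> 'b::{banach, second_countable_topology}"
  assumes "f \<in> borel_measurable (real_path_space E)"
  shows "(LINT \<omega>|field_law E e \<psi>. f \<omega>) = (LINT \<omega>|iid_normal UNIV. f (\<lambda>t. gauss_field \<psi> t \<omega> *\<^sub>R e))"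
  unfolding field_law_def by (rule integral_distr[OF measurable_field_path assms])

lemma norm_e: "norm e = 1" by (rule complete_orthonormal_systemD(3)[OF E e])

lemma cross_covariance_field_law:
  "cross_covariance (field_law E e \<psi>) s t = rank1 e (complex_of_real (k (s - t)))"
proof
  fix z
  have eq: "tensor (gauss_field \<psi> s \<omega> *\<^sub>R e) (gauss_field \<psi> t \<omega> *\<^sub>R e) z
      = (gauss_field \<psi> s \<omega> * gauss_field \<psi> t \<omega>) *\<^sub>R (cinner z e *\<^sub>C e)" for \<omega>
    by (simp add: tensor_def scaleR_scaleC cinner_scaleC_right scaleC_scaleC mult_ac)
  have "cross_covariance (field_law E e \<psi>) s t z
      = (LINT \<omega>|iid_normal UNIV. (gauss_field \<psi> s \<omega> * gauss_field \<psi> t \<omega>) *\<^sub>R (cinner z e *\<^sub>C e))"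
    unfolding cross_covariance_def
    by (subst integral_field_law, intro measurable_tensor measurable_path_component) (simp only: eq)
  also have "\<dots> = k (s - t) *\<^sub>R (cinner z e *\<^sub>C e)"
    by (subst integral_scaleR_left) (simp_all only: integrable_field_product[OF \<psi>] covariance_field[OF \<psi>])
  also have "\<dots> = rank1 e (complex_of_real (k (s - t))) z"
    by (simp add: rank1_def scaleR_scaleC scaleC_scaleC)
  finally show "cross_covariance (field_law E e \<psi>) s t z = rank1 e (complex_of_real (k (s - t))) z" .
qed

lemma autocovariance_field_law: "autocovariance (field_law E e \<psi>) h = rank1 e (complex_of_real (k h))"
  by (simp add: autocovariance_def cross_covariance_field_law)

lemma real_stationary_field_law:
  assumes k: "isCont k 0"
  shows "real_stationary_law E (field_law E e \<psi>)"
  unfolding real_stationary_law_def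
proof (intro conjI allI)
  note [measurable] = measurable_path_component
  have sq: "integrable (iid_normal UNIV) (\<lambda>\<omega>. (gauss_field \<psi> t \<omega>)\<^sup>2)"
    "(LINT \<omega>|iid_normal UNIV. (gauss_field \<psi> t \<omega>)\<^sup>2) = k 0" for t
    using integrable_field_product[OF \<psi>, of t t] covariance_field[OF \<psi>, of t t] by (simp_all add: power2_eq_square)
  show "integrable (field_law E e \<psi>) (\<lambda>\<omega>. (norm (\<omega> t))\<^sup>2)" for t
    unfolding field_law_def
    by (subst integrable_distr_eq[OF measurable_field_path]) (simp_all add: norm_e power_mult_distrib sq(1))
  show "(LINT \<omega>|field_law E e \<psi>. \<omega> t) = 0" for t
    using integrable_field[OF \<psi>, of t] mean_field[OF \<psi>, of t]
    by (simp add: integral_field_law)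
  show "cross_covariance (field_law E e \<psi>) (t + h) t = cross_covariance (field_law E e \<psi>) h 0" for t h
    by (simp add: cross_covariance_field_law)
  fix t
  have "(LINT \<omega>|field_law E e \<psi>. (norm (\<omega> s - \<omega> t))\<^sup>2) = 2 * k 0 - 2 * k (s - t)" for s
  proof -
    have "(norm (gauss_field \<psi> s \<omega> *\<^sub>R e - gauss_field \<psi> t \<omega> *\<^sub>R e))\<^sup>2
        = (gauss_field \<psi> s \<omega>)\<^sup>2 + (gauss_field \<psi> t \<omega>)\<^sup>2 - 2 * (gauss_field \<psi> s \<omega> * gauss_field \<psi> t \<omega>)" for \<omega>
      by (simp add: scaleR_diff_left[symmetric] norm_e power2_diff)
    then have "(LINT \<omega>|field_law E e \<psi>. (norm (\<omega> s - \<omega> t))\<^sup>2)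
        = (LINT \<omega>|iid_normal UNIV. (gauss_field \<psi> s \<omega>)\<^sup>2 + (gauss_field \<psi> t \<omega>)\<^sup>2 - 2 * (gauss_field \<psi> s \<omega> * gauss_field \<psi> t \<omega>))"
      by (subst integral_field_law) simp_all
    also have "\<dots> = k 0 + k 0 - 2 * k (s - t)"
      using sq integrable_field_product[OF \<psi>, of s t] by (simp add: covariance_field[OF \<psi>])
    finally show ?thesis by simp
  qed
  moreover have "((\<lambda>s. 2 * k 0 - 2 * k (s - t)) \<longlongrightarrow> 2 * k 0 - 2 * k 0) (at t)"
  proof (intro tendsto_intros)
    have "isCont (\<lambda>s. k (s - t)) t" by (rule isCont_o2[where f = "\<lambda>s. s - t" and g = k]) (simp_all add: k)
    then show "((\<lambda>s. k (s - t)) \<longlongrightarrow> k 0) (at t)" by (simp add: isCont_def)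
  qed
  ultimately show "((\<lambda>s. LINT \<omega>|field_law E e \<psi>. (norm (\<omega> s - \<omega> t))\<^sup>2) \<longlongrightarrow> 0) (at t)" by (simp only: diff_self)
qed (simp_all add: prob_space_field_law sets_field_law)

lemma gaussian_field_law: "gaussian_law (field_law E e \<psi>)"
  unfolding gaussian_law_def
proof (intro allI impI)
  fix T :: "(real^'d) set" and a :: "real^'d \<Rightarrow> 'h" assume T: "finite T"
  note [measurable] = borel_measurable_bounded_linear[OF bounded_linear_cinner] measurable_path_component
  have "(\<Sum>t\<in>T. Re (cinner (gauss_field \<psi> t \<omega> *\<^sub>R e) (a t))) = (\<Sum>t\<in>T. Re (cinner e (a t)) * gauss_field \<psi> t \<omega>)" for \<omega>
    by (simp add: cinner_scaleR_left mult.commute)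
  then show "gaussian_variable (field_law E e \<psi>) (\<lambda>\<omega>. \<Sum>t\<in>T. Re (cinner (\<omega> t) (a t)))"
    unfolding field_law_def
    by (intro gaussian_variable_distrI measurable_field_path)
       (measurable, simp add: gaussian_variable_field[OF \<psi> T])
qed

lemma trace_norm_field_law: "trace_norm E (autocovariance (field_law E e \<psi>) h) = ennreal \<bar>k h\<bar>"
  by (simp add: autocovariance_field_law trace_norm_rank1[OF E e])

lemma spectral_density_field_law:
  assumes k: "integrable lborel k"
  shows "spectral_density (field_law E e \<psi>) \<theta> = rank1 e (complex_of_real (1 / (2 * pi) ^ CARD('d)) *
    (CLINT h|lborel. iexp (h \<bullet> \<theta>) * complex_of_real (k h)))"
proof (rule ext)
  fix z
  note i = integrable_iexp_mult[OF k, of \<theta>]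
  have bl: "bounded_linear (\<lambda>u. u *\<^sub>C (cinner z e *\<^sub>C e))" by (rule bounded_linear_scaleC_left)
  have "(LINT h|lborel. iexp (h \<bullet> \<theta>) *\<^sub>C autocovariance (field_law E e \<psi>) h z)
      = (LINT h|lborel. (iexp (h \<bullet> \<theta>) * complex_of_real (k h)) *\<^sub>C (cinner z e *\<^sub>C e))"
    by (simp only: autocovariance_field_law rank1_def scaleC_scaleC mult_ac)
  also have "\<dots> = (CLINT h|lborel. iexp (h \<bullet> \<theta>) * complex_of_real (k h)) *\<^sub>C (cinner z e *\<^sub>C e)"
    by (rule integral_bounded_linear[OF bl i])
  finally show "spectral_density (field_law E e \<psi>) \<theta> z = rank1 e (complex_of_real (1 / (2 * pi) ^ CARD('d)) *
    (CLINT h|lborel. iexp (h \<bullet> \<theta>) * complex_of_real (k h))) z"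
    unfolding spectral_density_def by (simp only: rank1_def scaleC_scaleC mult_ac)
qed

end

section \<open>Uniqueness of multivariate characteristic functions\<close>

lemma integrable_iexp_weighted:
  fixes u :: "'a \<Rightarrow> complex"
  assumes "prob_space M" "X \<in> borel_measurable M" "u \<in> borel_measurable M" "\<And>\<omega>. norm (u \<omega>) \<le> C"
  shows "integrable M (\<lambda>\<omega>. u \<omega> * iexp (s * X \<omega>))"
proof -
  interpret prob_space M by fact
  show ?thesis
  proof (rule integrable_const_bound[where B = C])
    show "AE \<omega> in M. norm (u \<omega> * iexp (s * X \<omega>)) \<le> C"
      by (rule AE_I2) (simp add: norm_mult assms(4))
    show "(\<lambda>\<omega>. u \<omega> * iexp (s * X \<omega>)) \<in> borel_measurable M"
      using assms(2,3) by measurable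
  qed
qed

lemma integrable_weight:
  assumes "prob_space Q" "w \<in> borel_measurable Q" "\<And>\<omega>. 1 \<le> w \<omega>" "\<And>\<omega>. w \<omega> \<le> (3::real)"
  shows "integrable Q w"
proof -
  interpret prob_space Q by fact
  have "norm (w \<omega>) \<le> 3" for \<omega> using assms(3,4)[of \<omega>] by simp
  then show ?thesis using assms(2) by (intro integrable_const_bound[where B = 3] AE_I2) auto
qed

text \<open>Weights with values in \<open>{1..3}\<close> can be normalised to probability densities, so that Levy's
  one-dimensional uniqueness theorem applies; general bounded complex weights are reduced to them
  through \<open>2 + Re g\<close>. Indicators of the first coordinates are such weights, and this allows a
  multivariate characteristic function to be inverted one coordinate at a time.\<close>

definition weighted_law :: "'c measure \<Rightarrow> real \<Rightarrow> ('c \<Rightarrow> real) \<Rightarrow> ('c \<Rightarrow> real) \<Rightarrow> real measure" where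
  "weighted_law Q Z w W = distr (density Q (\<lambda>\<omega>. ennreal (w \<omega> / Z))) borel W"

lemma
  assumes Q: "prob_space Q" and W: "W \<in> borel_measurable Q"
    and w: "w \<in> borel_measurable Q" "\<And>\<omega>. 1 \<le> w \<omega>" "\<And>\<omega>. w \<omega> \<le> (3::real)"
    and Zw: "Z = (LINT \<omega>|Q. w \<omega>)" and Z: "Z \<ge> 1" and B: "B \<in> sets borel"
  shows real_distribution_weighted_law: "real_distribution (weighted_law Q Z w W)"
    and char_weighted_law: "char (weighted_law Q Z w W) s = (CLINT \<omega>|Q. w \<omega> * iexp (s * W \<omega>)) / Z"
    and measure_weighted_law: "Z * measure (weighted_law Q Z w W) B = (LINT \<omega>|Q. w \<omega> * indicator B (W \<omega>))"
proof -
  define D where "D = density Q (\<lambda>\<omega>. ennreal (w \<omega> / Z))"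
  have w0: "0 \<le> w \<omega> / Z" for \<omega> using w(2)[of \<omega>] Z by simp
  have wm: "(\<lambda>\<omega>. w \<omega> / Z) \<in> borel_measurable Q" using w(1) by measurable
  have WD: "W \<in> borel_measurable D" using W by (simp add: D_def)
  have dens: "(LINT \<omega>|D. f \<omega>) = (LINT \<omega>|Q. (w \<omega> / Z) *\<^sub>R f \<omega>)" if "f \<in> borel_measurable Q"
    for f   :: "'a \<Rightarrow> 'd::{banach, second_countable_topology}"
    unfolding D_def by (rule integral_density[OF that wm]) (simp add: w0)
  have "emeasure D (space D) = (\<integral>\<^sup>+\<omega>. ennreal (w \<omega> / Z) \<partial>Q)"
    using wm by (simp add: D_def emeasure_density cong: nn_integral_cong)
  also have "\<dots> = ennreal (LINT \<omega>|Q. w \<omega> / Z)"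
    using integrable_weight[OF Q w] w0 by (intro nn_integral_eq_integral) auto
  also have "(LINT \<omega>|Q. w \<omega> / Z) = 1" using Z Zw by simp
  finally have D: "prob_space D" by (intro prob_spaceI) simp
  show "real_distribution (weighted_law Q Z w W)"
    unfolding weighted_law_def D_def[symmetric] by (rule prob_space.real_distribution_distr[OF D WD])
  have "char (weighted_law Q Z w W) s = (CLINT \<omega>|D. iexp (s * W \<omega>))"
    unfolding weighted_law_def D_def[symmetric] char_def by (rule integral_distr[OF WD]) measurable
  also have "\<dots> = (CLINT \<omega>|Q. (w \<omega> / Z) *\<^sub>R iexp (s * W \<omega>))"
    by (rule dens) (use W in measurable)
  also have "\<dots> = (CLINT \<omega>|Q. (w \<omega> * iexp (s * W \<omega>)) / Z)"
    by (simp add: scaleR_conv_of_real)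
  also have "\<dots> = (CLINT \<omega>|Q. w \<omega> * iexp (s * W \<omega>)) / Z" by (rule integral_divide_zero)
  finally show "char (weighted_law Q Z w W) s = (CLINT \<omega>|Q. w \<omega> * iexp (s * W \<omega>)) / Z" .
  interpret D: prob_space D by (rule D)
  have m: "(\<lambda>\<omega>. indicator B (W \<omega>) :: real) \<in> borel_measurable Q" using W B by measurable
  have "measure (weighted_law Q Z w W) B = measure D (W -` B \<inter> space D)"
    unfolding weighted_law_def D_def[symmetric] by (rule measure_distr[OF WD B])
  also have "\<dots> = (LINT \<omega>|D. indicator (W -` B \<inter> space D) \<omega>)" by simp
  also have "\<dots> = (LINT \<omega>|D. indicator B (W \<omega>))"
    by (intro Bochner_Integration.integral_cong refl) (simp add: indicator_def)
  also have "\<dots> = (LINT \<omega>|Q. (w \<omega> / Z) *\<^sub>R indicator B (W \<omega>))" by (rule dens[OF m])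
  also have "\<dots> = (LINT \<omega>|Q. (w \<omega> * indicator B (W \<omega>)) / Z)" by simp
  also have "\<dots> = (LINT \<omega>|Q. w \<omega> * indicator B (W \<omega>)) / Z" by (rule integral_divide_zero)
  finally show "Z * measure (weighted_law Q Z w W) B = (LINT \<omega>|Q. w \<omega> * indicator B (W \<omega>))" using Z by simp
qed

lemma weighted_char_unique_real:
  fixes u :: "'a \<Rightarrow> real" and v :: "'b \<Rightarrow> real"
  assumes M: "prob_space M" and N: "prob_space N"
    and X: "X \<in> borel_measurable M" and Y: "Y \<in> borel_measurable N"
    and u: "u \<in> borel_measurable M" "\<And>\<omega>. 1 \<le> u \<omega>" "\<And>\<omega>. u \<omega> \<le> 3"
    and v: "v \<in> borel_measurable N" "\<And>\<omega>. 1 \<le> v \<omega>" "\<And>\<omega>. v \<omega> \<le> 3"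
    and char: "\<And>s. (CLINT \<omega>|M. u \<omega> * iexp (s * X \<omega>)) = (CLINT \<omega>|N. v \<omega> * iexp (s * Y \<omega>))"
    and B: "B \<in> sets borel"
  shows "(LINT \<omega>|M. u \<omega> * indicator B (X \<omega>)) = (LINT \<omega>|N. v \<omega> * indicator B (Y \<omega>))"
proof -
  define Z where "Z = (LINT \<omega>|M. u \<omega>)"
  \<comment> \<open>At frequency 0 the transforms are the total masses of the weights, so a single
    constant \<open>Z\<close> normalises both laws.\<close>
  have ZN: "Z = (LINT \<omega>|N. v \<omega>)"
  proof -
    have "complex_of_real Z = complex_of_real (LINT \<omega>|N. v \<omega>)"
      using char[of 0] unfolding Z_def
      by (simp only: integral_complex_of_real[symmetric]) simp
    then show ?thesis using of_real_eq_iff by blast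
  qed
  have Z: "Z \<ge> 1"
  proof -
    interpret prob_space M by fact
    have "(LINT \<omega>|M. 1) \<le> Z" unfolding Z_def using integrable_weight[OF M u] u(2) by (intro integral_mono) auto
    then show ?thesis using prob_space by simp
  qed
  have "weighted_law M Z u X = weighted_law N Z v Y"
    using real_distribution_weighted_law[OF M X u Z_def Z B] char_weighted_law[OF M X u Z_def Z B] real_distribution_weighted_law[OF N Y v ZN Z B] char_weighted_law[OF N Y v ZN Z B] char
    by (intro Levy_uniqueness) (auto simp: fun_eq_iff)
  then show ?thesis using measure_weighted_law[OF M X u Z_def Z B] measure_weighted_law[OF N Y v ZN Z B] by simp
qed

lemma weighted_char_unique_Re:
  fixes g :: "'a \<Rightarrow> complex" and h :: "'b \<Rightarrow> complex"
  assumes M: "prob_space M" and N: "prob_space N"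
    and X: "X \<in> borel_measurable M" and Y: "Y \<in> borel_measurable N"
    and g: "g \<in> borel_measurable M" "\<And>\<omega>. norm (g \<omega>) \<le> 1"
    and h: "h \<in> borel_measurable N" "\<And>\<omega>. norm (h \<omega>) \<le> 1"
    and char: "\<And>s. (CLINT \<omega>|M. g \<omega> * iexp (s * X \<omega>)) = (CLINT \<omega>|N. h \<omega> * iexp (s * Y \<omega>))"
    and char1: "\<And>s. (CLINT \<omega>|M. iexp (s * X \<omega>)) = (CLINT \<omega>|N. iexp (s * Y \<omega>))"
    and B: "B \<in> sets borel"
  shows "(LINT \<omega>|M. Re (g \<omega>) * indicator B (X \<omega>)) = (LINT \<omega>|N. Re (h \<omega>) * indicator B (Y \<omega>))"
proof -
  \<comment> \<open>\<open>Re w\<close> is half the sum of \<open>w\<close> and its conjugate, and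
    conjugation reverses the frequency. Hence the transform of the weight \<open>2 + Re w\<close> is
    determined by the transforms of 1 and of \<open>w\<close>.\<close>
  have red: "(CLINT \<omega>|Q. complex_of_real (2 + Re (w \<omega>)) * iexp (s * W \<omega>))
      = 2 * (CLINT \<omega>|Q. iexp (s * W \<omega>))
        + ((CLINT \<omega>|Q. w \<omega> * iexp (s * W \<omega>)) + cnj (CLINT \<omega>|Q. w \<omega> * iexp ((- s) * W \<omega>))) / 2"
    if Q: "prob_space Q" and W: "W \<in> borel_measurable Q" and w: "w \<in> borel_measurable Q" "\<And>\<omega>. norm (w \<omega>) \<le> 1"
    for Q :: "'c measure" and w W s
  proof -
    have i: "integrable Q (\<lambda>\<omega>. w \<omega> * iexp (r * W \<omega>))" for r
      by (rule integrable_iexp_weighted[OF Q W w])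
    have i1: "integrable Q (\<lambda>\<omega>. iexp (s * W \<omega>))"
      using integrable_iexp_weighted[OF Q W, of "\<lambda>_. 1" 1 s] by simp
    have ic: "integrable Q (\<lambda>\<omega>. cnj (w \<omega> * iexp ((- s) * W \<omega>)))"
      by (rule integrable_cnj[OF i])
    have "complex_of_real (2 + Re (w \<omega>)) * iexp (s * W \<omega>)
        = 2 * iexp (s * W \<omega>) + (w \<omega> * iexp (s * W \<omega>) + cnj (w \<omega> * iexp ((- s) * W \<omega>))) / 2" for \<omega>
    proof -
      have "complex_of_real (Re (w \<omega>)) = (w \<omega> + cnj (w \<omega>)) / 2" by (simp add: complex_eq_iff)
      moreover have "cnj (iexp ((- s) * W \<omega>)) = iexp (s * W \<omega>)" by (simp add: exp_cnj)
      ultimately show ?thesis by (simp only: of_real_add complex_cnj_mult) (simp add: field_simps)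
    qed
    then have "(CLINT \<omega>|Q. complex_of_real (2 + Re (w \<omega>)) * iexp (s * W \<omega>))
        = (CLINT \<omega>|Q. 2 * iexp (s * W \<omega>) + (w \<omega> * iexp (s * W \<omega>) + cnj (w \<omega> * iexp ((- s) * W \<omega>))) / 2)"
      by (simp only:)
    also have "\<dots> = 2 * (CLINT \<omega>|Q. iexp (s * W \<omega>))
        + ((CLINT \<omega>|Q. w \<omega> * iexp (s * W \<omega>)) + (CLINT \<omega>|Q. cnj (w \<omega> * iexp ((- s) * W \<omega>)))) / 2"
      by (simp only: Bochner_Integration.integral_add integral_mult_right_zero integral_divide_zero
          i i1 ic Bochner_Integration.integrable_add integrable_mult_right integrable_divide)
    also have "(CLINT \<omega>|Q. cnj (w \<omega> * iexp ((- s) * W \<omega>))) = cnj (CLINT \<omega>|Q. w \<omega> * iexp ((- s) * W \<omega>))"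
      by (rule Bochner_Integration.integral_cnj)
    finally show ?thesis .
  qed
  have bd: "1 \<le> 2 + Re z" "2 + Re z \<le> 3" if "norm z \<le> 1" for z
    using abs_Re_le_cmod[of z] that by (auto simp: abs_le_iff)
  have key: "(LINT \<omega>|M. (2 + Re (g \<omega>)) * indicator B (X \<omega>)) = (LINT \<omega>|N. (2 + Re (h \<omega>)) * indicator B (Y \<omega>))"
  proof (rule weighted_char_unique_real[OF M N X Y])
    show "(\<lambda>\<omega>. 2 + Re (g \<omega>)) \<in> borel_measurable M" "(\<lambda>\<omega>. 2 + Re (h \<omega>)) \<in> borel_measurable N"
      using g(1) h(1) by measurable
    show "(CLINT \<omega>|M. complex_of_real (2 + Re (g \<omega>)) * iexp (s * X \<omega>))
        = (CLINT \<omega>|N. complex_of_real (2 + Re (h \<omega>)) * iexp (s * Y \<omega>))" for s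
      unfolding red[OF M X g] red[OF N Y h] char char1 ..
  qed (use bd g(2) h(2) B in blast)+
  \<comment> \<open>The constant weight 1 serves to remove the shift by 2 afterwards.\<close>
  have one: "(LINT \<omega>|M. 1 * indicator B (X \<omega>)) = (LINT \<omega>|N. 1 * indicator B (Y \<omega>) :: real)"
    by (rule weighted_char_unique_real[OF M N X Y, where B = B]) (use B char1 in auto)
  have split: "(LINT \<omega>|Q. (2 + Re (w \<omega>)) * indicator B (W \<omega>))
      = 2 * (LINT \<omega>|Q. 1 * indicator B (W \<omega>)) + (LINT \<omega>|Q. Re (w \<omega>) * indicator B (W \<omega>))"
    if Q: "prob_space Q" and W: "W \<in> borel_measurable Q" and w: "w \<in> borel_measurable Q" "\<And>\<omega>. norm (w \<omega>) \<le> 1"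
    for Q :: "'c measure" and w W
  proof -
    interpret prob_space Q by fact
    have m: "(\<lambda>\<omega>. indicator B (W \<omega>) :: real) \<in> borel_measurable Q" using W B by measurable
    have i1: "integrable Q (\<lambda>\<omega>. 1 * indicator B (W \<omega>) :: real)"
      using m by (intro integrable_const_bound[where B = 1] AE_I2) (auto simp: indicator_def)
    have i2: "integrable Q (\<lambda>\<omega>. Re (w \<omega>) * indicator B (W \<omega>) :: real)"
    proof (rule integrable_const_bound[where B = 1])
      show "AE \<omega> in Q. norm (Re (w \<omega>) * indicator B (W \<omega>)) \<le> 1"
        using abs_Re_le_cmod order_trans[OF _ w(2)] by (intro AE_I2) (auto simp: indicator_def)
      show "(\<lambda>\<omega>. Re (w \<omega>) * indicator B (W \<omega>)) \<in> borel_measurable Q" using m w(1) by measurable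
    qed
    have "(LINT \<omega>|Q. (2 + Re (w \<omega>)) * indicator B (W \<omega>))
        = (LINT \<omega>|Q. 2 * (1 * indicator B (W \<omega>)) + Re (w \<omega>) * indicator B (W \<omega>))"
      by (simp only: distrib_right mult_1_left)
    then show ?thesis
      by (simp only: Bochner_Integration.integral_add integrable_mult_right i1 i2 integral_mult_right_zero)
  qed
  show ?thesis using key one split[OF M X g] split[OF N Y h] by linarith
qed

lemma weighted_char_unique:
  fixes g :: "'a \<Rightarrow> complex" and h :: "'b \<Rightarrow> complex"
  assumes M: "prob_space M" and N: "prob_space N"
    and X: "X \<in> borel_measurable M" and Y: "Y \<in> borel_measurable N"
    and g: "g \<in> borel_measurable M" "\<And>\<omega>. norm (g \<omega>) \<le> 1"
    and h: "h \<in> borel_measurable N" "\<And>\<omega>. norm (h \<omega>) \<le> 1"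
    and char: "\<And>s. (CLINT \<omega>|M. g \<omega> * iexp (s * X \<omega>)) = (CLINT \<omega>|N. h \<omega> * iexp (s * Y \<omega>))"
    and char1: "\<And>s. (CLINT \<omega>|M. iexp (s * X \<omega>)) = (CLINT \<omega>|N. iexp (s * Y \<omega>))"
    and B: "B \<in> sets borel"
  shows "(CLINT \<omega>|M. g \<omega> * indicator B (X \<omega>)) = (CLINT \<omega>|N. h \<omega> * indicator B (Y \<omega>))"
proof -
  have R: "(LINT \<omega>|M. Re (g \<omega>) * indicator B (X \<omega>)) = (LINT \<omega>|N. Re (h \<omega>) * indicator B (Y \<omega>))"
    by (rule weighted_char_unique_Re[OF M N X Y g h char char1 B])
  \<comment> \<open>The imaginary part of a weight is the real part of \<open>- \<i>\<close> times
    the weight.\<close>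
  have "(LINT \<omega>|M. Re (- \<i> * g \<omega>) * indicator B (X \<omega>)) = (LINT \<omega>|N. Re (- \<i> * h \<omega>) * indicator B (Y \<omega>))"
  proof (rule weighted_char_unique_Re[OF M N X Y _ _ _ _ _ char1 B])
    show "(CLINT \<omega>|M. - \<i> * g \<omega> * iexp (s * X \<omega>)) = (CLINT \<omega>|N. - \<i> * h \<omega> * iexp (s * Y \<omega>))" for s
      by (simp only: mult.assoc integral_mult_right_zero char)
    show "(\<lambda>\<omega>. - \<i> * g \<omega>) \<in> borel_measurable M" "(\<lambda>\<omega>. - \<i> * h \<omega>) \<in> borel_measurable N"
      using g(1) h(1) by measurable
  qed (simp_all add: norm_mult g(2) h(2))
  then have I: "(LINT \<omega>|M. Im (g \<omega>) * indicator B (X \<omega>)) = (LINT \<omega>|N. Im (h \<omega>) * indicator B (Y \<omega>))"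
    by simp
  have split: "(CLINT \<omega>|Q. w \<omega> * indicator B (W \<omega>))
      = Complex (LINT \<omega>|Q. Re (w \<omega>) * indicator B (W \<omega>)) (LINT \<omega>|Q. Im (w \<omega>) * indicator B (W \<omega>))"
    if Q: "prob_space Q" and W: "W \<in> borel_measurable Q" and w: "w \<in> borel_measurable Q" "\<And>\<omega>. norm (w \<omega>) \<le> 1"
    for Q :: "'c measure" and w :: "'c \<Rightarrow> complex" and W
  proof -
    interpret prob_space Q by fact
    have m: "(\<lambda>\<omega>. indicator B (W \<omega>) :: complex) \<in> borel_measurable Q" using W B by measurable
    have i: "integrable Q (\<lambda>\<omega>. w \<omega> * indicator B (W \<omega>))"
    proof (rule integrable_const_bound[where B = 1])
      show "AE \<omega> in Q. norm (w \<omega> * indicator B (W \<omega>)) \<le> 1"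
        using w(2) by (intro AE_I2) (auto simp: indicator_def)
      show "(\<lambda>\<omega>. w \<omega> * indicator B (W \<omega>)) \<in> borel_measurable Q" using m w(1) by measurable
    qed
    have "Re (w \<omega> * indicator B (W \<omega>)) = Re (w \<omega>) * indicator B (W \<omega>)"
      "Im (w \<omega> * indicator B (W \<omega>)) = Im (w \<omega>) * indicator B (W \<omega>)" for \<omega>
      by (auto simp: indicator_def)
    then show ?thesis using integral_Re[OF i] integral_Im[OF i] by (simp add: complex_eq_iff)
  qed
  show ?thesis unfolding split[OF M X g] split[OF N Y h] R I ..
qed

text \<open>Coordinates in \<open>K\<close> are tested with indicators, the others still with
  exponentials. Moving the coordinates from the second group to the first ends, at
  \<open>K = J\<close>, with the measures of boxes.\<close>

lemma char_unique_boxes: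
  fixes \<mu> \<nu> :: "('j \<Rightarrow> real) measure"
  assumes J: "finite J" and \<mu>: "prob_space \<mu>" "sets \<mu> = sets (Pi\<^sub>M J (\<lambda>_. borel))"
    and \<nu>: "prob_space \<nu>" "sets \<nu> = sets (Pi\<^sub>M J (\<lambda>_. borel))"
    and char: "\<And>a. (CLINT x|\<mu>. iexp (\<Sum>j\<in>J. a j * x j)) = (CLINT x|\<nu>. iexp (\<Sum>j\<in>J. a j * x j))"
    and B: "\<And>j. B j \<in> sets borel" and K: "finite K" "K \<subseteq> J"
  shows "(CLINT x|\<mu>. (\<Prod>k\<in>K. indicator (B k) (x k)) * iexp (\<Sum>j\<in>J-K. a j * x j))
    = (CLINT x|\<nu>. (\<Prod>k\<in>K. indicator (B k) (x k)) * iexp (\<Sum>j\<in>J-K. a j * x j))"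
  using K
proof (induction K arbitrary: a)
  case empty
  show ?case using char[of a] by (simp only: prod.empty mult_1_left Diff_empty)
next
  case (insert k K)
  have k: "k \<in> J" "k \<notin> K" "J - K = insert k (J - insert k K)" and fin: "finite (J - insert k K)"
    using insert J by auto
  define w :: "('j \<Rightarrow> real) \<Rightarrow> complex" where
    "w x = (\<Prod>k\<in>K. indicator (B k) (x k)) * iexp (\<Sum>j\<in>J - insert k K. a j * x j)" for x
  have comp: "(\<lambda>x. x j) \<in> borel_measurable \<mu>" "(\<lambda>x. x j) \<in> borel_measurable \<nu>" if "j \<in> J" for j
    using measurable_cong_sets[OF \<mu>(2) refl] measurable_cong_sets[OF \<nu>(2) refl]
      measurable_component_singleton[OF that, of "\<lambda>_. borel"] by auto
  have wm: "w \<in> borel_measurable Q" if Q: "\<And>j. j \<in> J \<Longrightarrow> (\<lambda>x. x j) \<in> borel_measurable Q" for Q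
  proof -
    have "(\<lambda>x. indicator (B k) (x k) :: complex) \<in> borel_measurable Q" if "k \<in> K" for k
      using Q[of k] that insert.prems B[of k] by (intro measurable_compose[OF Q] borel_measurable_indicator) auto
    moreover have "(\<lambda>x. \<Sum>j\<in>J - insert k K. a j * x j) \<in> borel_measurable Q"
      using Q by (intro borel_measurable_sum borel_measurable_times borel_measurable_const) auto
    then have "(\<lambda>x. iexp (\<Sum>j\<in>J - insert k K. a j * x j)) \<in> borel_measurable Q" by measurable
    ultimately show ?thesis unfolding w_def by (intro borel_measurable_times borel_measurable_prod)
  qed
  have w1: "norm (w x) \<le> 1" for x
  proof -
    have "norm (\<Prod>k\<in>K. indicator (B k) (x k) :: complex) \<le> 1"
      unfolding prod_norm[symmetric] by (intro prod_le_1) (auto simp: indicator_def)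
    then show ?thesis by (simp add: w_def norm_mult)
  qed
  \<comment> \<open>Varying only the frequency of coordinate \<open>k\<close> in the induction
    hypothesis produces the transform in \<open>x k\<close> under the weight \<open>w\<close>, for
    all frequencies, as the one-dimensional result requires.\<close>
  have s1: "(\<Prod>k\<in>K. indicator (B k) (x k)) * iexp (\<Sum>j\<in>J-K. (a(k := s)) j * x j) = w x * iexp (s * x k)" for x s
  proof -
    have "(\<Sum>j\<in>J-K. (a(k := s)) j * x j) = (\<Sum>j\<in>J - insert k K. a j * x j) + s * x k"
      using fin by (subst k(3)) (simp add: sum.insert add.commute)
    then show ?thesis by (simp only: w_def of_real_add distrib_left exp_add mult.assoc)
  qed
  have s2: "(\<Prod>k\<in>insert k K. indicator (B k) (x k)) * iexp (\<Sum>j\<in>J - insert k K. a j * x j)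
      = w x * indicator (B k) (x k)" for x
    using insert k(2) by (simp add: w_def mult_ac)
  have s3: "(\<Sum>j\<in>J. (if j = k then s else 0) * x j) = s * x k" for x :: "'j \<Rightarrow> real" and s
    using J k(1) by (simp add: if_distrib[of "\<lambda>u. u * _"] cong: if_cong)
  have "(CLINT x|\<mu>. w x * indicator (B k) (x k)) = (CLINT x|\<nu>. w x * indicator (B k) (x k))"
  proof (rule weighted_char_unique[OF \<mu>(1) \<nu>(1) comp[OF k(1)] wm w1 wm w1 _ _ B])
    show "(CLINT x|\<mu>. w x * iexp (s * x k)) = (CLINT x|\<nu>. w x * iexp (s * x k))" for s
      using insert.IH[of "a(k := s)"] insert.prems unfolding s1 by simp
    show "(CLINT x|\<mu>. iexp (s * x k)) = (CLINT x|\<nu>. iexp (s * x k))" for s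
      using char[of "\<lambda>j. if j = k then s else 0"] unfolding s3 .
  qed (use comp in blast)+
  then show ?case unfolding s2 .
qed

lemma measure_eqI_char:
  fixes \<mu> \<nu> :: "('j \<Rightarrow> real) measure"
  assumes J: "finite J" and \<mu>: "prob_space \<mu>" "sets \<mu> = sets (Pi\<^sub>M J (\<lambda>_. borel))"
    and \<nu>: "prob_space \<nu>" "sets \<nu> = sets (Pi\<^sub>M J (\<lambda>_. borel))"
    and char: "\<And>a. (CLINT x|\<mu>. iexp (\<Sum>j\<in>J. a j * x j)) = (CLINT x|\<nu>. iexp (\<Sum>j\<in>J. a j * x j))"
  shows "\<mu> = \<nu>"
proof (rule measure_eqI_PiM_finite[OF J \<mu>(2) \<nu>(2)])
  have em: "complex_of_real (measure Q (Pi\<^sub>E J A)) = (CLINT x|Q. (\<Prod>k\<in>J. indicator (A k) (x k)))"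
    if Q: "prob_space Q" "sets Q = sets (Pi\<^sub>M J (\<lambda>_. borel))" and A: "\<And>j. A j \<in> sets borel"
    for Q :: "('j \<Rightarrow> real) measure" and A
  proof -
    interpret prob_space Q by fact
    have S: "Pi\<^sub>E J A \<in> sets Q" unfolding Q(2) using J A by (intro sets_PiM_I_finite) auto
    have sp: "space Q = Pi\<^sub>E J (\<lambda>_. UNIV)" using sets_eq_imp_space_eq[OF Q(2)] by (simp add: space_PiM)
    have "(CLINT x|Q. (\<Prod>k\<in>J. indicator (A k) (x k))) = (CLINT x|Q. complex_of_real (indicator (Pi\<^sub>E J A) x))"
    proof (rule Bochner_Integration.integral_cong[OF refl])
      fix x assume "x \<in> space Q"
      then have "x \<in> Pi\<^sub>E J A \<longleftrightarrow> (\<forall>j\<in>J. x j \<in> A j)" by (auto simp: sp PiE_iff)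
      then show "(\<Prod>k\<in>J. indicator (A k) (x k)) = complex_of_real (indicator (Pi\<^sub>E J A) x)"
        using J by (cases "\<forall>j\<in>J. x j \<in> A j") (auto simp: indicator_def intro!: prod_zero)
    qed
    also have "\<dots> = complex_of_real (measure Q (Pi\<^sub>E J A))"
      using S sets.sets_into_space[OF S] by (simp only: integral_complex_of_real) (simp add: Int_absorb2)
    finally show ?thesis by simp
  qed
  fix A :: "'j \<Rightarrow> real set" assume A: "\<And>i. i \<in> J \<Longrightarrow> A i \<in> sets borel"
  define A' where "A' j = (if j \<in> J then A j else UNIV)" for j
  have A': "A' j \<in> sets borel" for j using A by (simp add: A'_def)
  have eq: "Pi\<^sub>E J A = Pi\<^sub>E J A'" by (auto simp: A'_def PiE_iff)
  have "complex_of_real (measure \<mu> (Pi\<^sub>E J A')) = complex_of_real (measure \<nu> (Pi\<^sub>E J A'))"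
    unfolding em[OF \<mu> A'] em[OF \<nu> A']
    using char_unique_boxes[OF J \<mu> \<nu> char A' J subset_refl, where a = "\<lambda>_. 0"]
    by (simp only: Diff_cancel sum.empty of_real_0 mult_zero_right exp_zero mult_1_right)
  then have "measure \<mu> (Pi\<^sub>E J A) = measure \<nu> (Pi\<^sub>E J A)" unfolding eq using of_real_eq_iff by blast
  then show "emeasure \<mu> (Pi\<^sub>E J A) = emeasure \<nu> (Pi\<^sub>E J A)"
    using finite_measure.emeasure_eq_measure[OF prob_space.finite_measure[OF \<mu>(1)]]
      finite_measure.emeasure_eq_measure[OF prob_space.finite_measure[OF \<nu>(1)]] by simp
next
  show "range (\<lambda>_::nat. Pi\<^sub>E J (\<lambda>_. UNIV)) \<subseteq> prod_algebra J (\<lambda>_. borel :: real measure)"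
    using J by (auto intro!: prod_algebraI_finite)
  show "(\<Union>i::nat. Pi\<^sub>E J (\<lambda>_. UNIV)) = space (Pi\<^sub>M J (\<lambda>_. borel :: real measure))" by (simp add: space_PiM)
  show "emeasure \<mu> (Pi\<^sub>E J (\<lambda>_. UNIV)) \<noteq> \<infinity>" for i :: nat
    using finite_measure.emeasure_finite[OF prob_space.finite_measure[OF \<mu>(1)]] by simp
qed

section \<open>Cholesky factors of perturbations of the identity\<close>

lemma lower_triangular_solve:
  fixes L :: "nat \<Rightarrow> nat \<Rightarrow> real"
  assumes "\<And>i j. i < j \<Longrightarrow> L i j = 0" "\<And>i. i < m \<Longrightarrow> L i i \<noteq> 0"
  shows "\<exists>l. \<forall>j<m. (\<Sum>k<m. L j k * l k) = b j"
  using assms(2)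
proof (induction m)
  case (Suc m)
  then obtain l where l: "\<And>j. j < m \<Longrightarrow> (\<Sum>k<m. L j k * l k) = b j" by auto
  define l' where "l' = l(m := (b m - (\<Sum>k<m. L m k * l k)) / L m m)"
  have "(\<Sum>k<m. L j k * l' k) = (\<Sum>k<m. L j k * l k)" for j
    by (intro sum.cong) (auto simp: l'_def)
  moreover have "L m m * l' m = b m - (\<Sum>k<m. L m k * l k)" using Suc.prems[of m] by (simp add: l'_def)
  ultimately have "(\<Sum>k<Suc m. L j k * l' k) = b j" if "j < Suc m" for j
    using l[of j] that assms(1)[of j m] by (cases "j = m") auto
  then show ?case by blast
qed simp

text \<open>Back substitution: the last unknown is determined at once, and its contribution changes
  the right-hand side of the smaller system; hence the induction is over all
  \<open>l\<close>.\<close>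

lemma lower_triangular_solve_transpose:
  fixes L :: "nat \<Rightarrow> nat \<Rightarrow> real"
  assumes "\<And>i j. i < j \<Longrightarrow> L i j = 0" "\<And>i. i < m \<Longrightarrow> L i i \<noteq> 0"
  shows "\<exists>x. \<forall>k<m. (\<Sum>j<m. L j k * x j) = l k"
  using assms(2)
proof (induction m arbitrary: l)
  case (Suc m)
  define t where "t = l m / L m m"
  obtain x where x: "\<And>k. k < m \<Longrightarrow> (\<Sum>j<m. L j k * x j) = l k - L m k * t"
    using Suc.IH[of "\<lambda>k. l k - L m k * t"] Suc.prems by auto
  define x' where "x' = x(m := t)"
  have eq: "(\<Sum>j<m. L j k * x' j) = (\<Sum>j<m. L j k * x j)" for k
    by (intro sum.cong) (auto simp: x'_def)
  have "(\<Sum>j<Suc m. L j k * x' j) = l k" if "k < Suc m" for k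
  proof (cases "k = m")
    case True
    have "(\<Sum>j<m. L j m * x j) = 0" using assms(1) by (intro sum.neutral) auto
    then show ?thesis using True Suc.prems[of m] eq[of m] by (simp add: x'_def t_def)
  next
    case False
    then show ?thesis using x[of k] eq[of k] that by (simp add: x'_def)
  qed
  then show ?case by blast
qed simp

text \<open>Beyond existence of the factor, the point is the control of its rows: diagonal entries
  are at least 1, and the off-diagonal part is no longer than the same part of the row of
  \<open>M\<close>. This later bounds the entropy row by row, without eigenvalues or
  determinants.\<close>

lemma cholesky_identity_plus:
  fixes M :: "nat \<Rightarrow> nat \<Rightarrow> real"
  assumes sym: "\<And>i j. M i j = M j i"
    and psd: "\<And>x. 0 \<le> (\<Sum>i<m. \<Sum>j<m. x i * x j * M i j)"
  shows "\<exists>L. (\<forall>i j. i < j \<longrightarrow> L i j = 0) \<and> (\<forall>i<m. 1 \<le> L i i \<and> (L i i)\<^sup>2 \<le> 1 + M i i) \<and>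
    (\<forall>i<m. \<forall>j<m. (\<Sum>k<m. L i k * L j k) = (if i = j then 1 else 0) + M i j) \<and>
    (\<forall>i<m. (\<Sum>j<i. (L i j)\<^sup>2) \<le> (\<Sum>j<i. (M i j)\<^sup>2))"
  using psd
proof (induction m)
  case 0
  then show ?case by (intro exI[of _ "\<lambda>_ _. 0"]) simp
next
  case (Suc m)
  have "0 \<le> (\<Sum>i<m. \<Sum>j<m. x i * x j * M i j)" for x
  proof -
    have "(\<Sum>i<Suc m. \<Sum>j<Suc m. (x(m := 0)) i * (x(m := 0)) j * M i j) = (\<Sum>i<m. \<Sum>j<m. x i * x j * M i j)"
      by simp
    then show ?thesis using Suc.prems[of "x(m := 0)"] by simp
  qed
  then obtain L where tri: "\<And>i j. i < j \<Longrightarrow> L i j = 0"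
    and diag: "\<And>i. i < m \<Longrightarrow> 1 \<le> L i i \<and> (L i i)\<^sup>2 \<le> 1 + M i i"
    and LL: "\<And>i j. i < m \<Longrightarrow> j < m \<Longrightarrow> (\<Sum>k<m. L i k * L j k) = (if i = j then 1 else 0) + M i j"
    and off: "\<And>i. i < m \<Longrightarrow> (\<Sum>j<i. (L i j)\<^sup>2) \<le> (\<Sum>j<i. (M i j)\<^sup>2)"
    using Suc.IH by blast
  have nz: "L i i \<noteq> 0" if "i < m" for i using diag[OF that] by linarith
  \<comment> \<open>\<open>l\<close> is the off-diagonal part of the new row. With \<open>x\<close>
    solving the transposed system, (I + M) x agrees with the row \<open>M m\<close> on the first
    \<open>m\<close> indices, so the squared length \<open>q\<close> of \<open>l\<close> is both a
    scalar product of \<open>x\<close> with that row and a quadratic form in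
    \<open>x\<close>.\<close>
  obtain l where l: "\<And>j. j < m \<Longrightarrow> (\<Sum>k<m. L j k * l k) = M m j"
    using lower_triangular_solve[of L m "M m"] tri nz by blast
  obtain x where x: "\<And>k. k < m \<Longrightarrow> (\<Sum>j<m. L j k * x j) = l k"
    using lower_triangular_solve_transpose[of L m l] tri nz by blast
  define q where "q = (\<Sum>k<m. (l k)\<^sup>2)"
  define r where "r = (\<Sum>j<m. (x j)\<^sup>2)"
  define s where "s = (\<Sum>i<m. \<Sum>j<m. x i * x j * M i j)"
  have q1: "q = (\<Sum>j<m. x j * M m j)"
  proof -
    have "q = (\<Sum>k<m. l k * (\<Sum>j<m. L j k * x j))"
      unfolding q_def by (intro sum.cong refl) (simp add: x power2_eq_square)
    also have "\<dots> = (\<Sum>j<m. x j * (\<Sum>k<m. L j k * l k))"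
      by (simp only: sum_distrib_left) (subst sum.swap, simp only: mult_ac)
    also have "\<dots> = (\<Sum>j<m. x j * M m j)" by (intro sum.cong refl) (simp add: l)
    finally show ?thesis .
  qed
  have q2: "q = r + s"
  proof -
    have "q = (\<Sum>k<m. (\<Sum>i<m. L i k * x i) * (\<Sum>j<m. L j k * x j))"
      unfolding q_def by (intro sum.cong refl) (simp add: x power2_eq_square)
    also have "\<dots> = (\<Sum>k<m. \<Sum>i<m. \<Sum>j<m. x i * x j * (L i k * L j k))"
      by (simp only: sum_product mult_ac)
    also have "\<dots> = (\<Sum>i<m. \<Sum>j<m. \<Sum>k<m. x i * x j * (L i k * L j k))"
      by (subst sum.swap) (intro sum.cong refl sum.swap)
    also have "\<dots> = (\<Sum>i<m. \<Sum>j<m. x i * x j * ((if i = j then 1 else 0) + M i j))"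
      by (intro sum.cong refl) (simp add: LL sum_distrib_left[symmetric])
    also have "\<dots> = (\<Sum>i<m. \<Sum>j<m. if i = j then x i * x j else 0) + s"
      unfolding s_def sum.distrib[symmetric] by (intro sum.cong refl) (simp add: distrib_left)
    also have "(\<Sum>i<m. \<Sum>j<m. if i = j then x i * x j else 0) = r"
      unfolding r_def by (intro sum.cong refl) (simp add: power2_eq_square)
    finally show ?thesis .
  qed
  have "0 \<le> s" unfolding s_def by fact
  \<comment> \<open>Since \<open>q = r + s\<close> with \<open>s\<close> nonnegative,
    \<open>r \<le> q\<close>; the arithmetic-geometric inequality then bounds \<open>q\<close> by
    half of itself plus half of the squared row of \<open>M\<close>.\<close>
  have "q \<le> (\<Sum>j<m. ((x j)\<^sup>2 + (M m j)\<^sup>2) / 2)"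
    unfolding q1
  proof (rule sum_mono)
    fix j show "x j * M m j \<le> ((x j)\<^sup>2 + (M m j)\<^sup>2) / 2"
      using sum_squares_bound[of "x j" "M m j"] by simp
  qed
  also have "\<dots> = (r + (\<Sum>j<m. (M m j)\<^sup>2)) / 2"
    by (simp add: r_def sum.distrib sum_divide_distrib[symmetric])
  finally have qM: "q \<le> (\<Sum>j<m. (M m j)\<^sup>2)" using q2 \<open>0 \<le> s\<close> by simp
  \<comment> \<open>Testing positive semidefiniteness at the vector (x, -1) gives 0 \<le> s - 2 q +
    M m m, which with \<open>q = r + s\<close> is q \<le> M m m - r. Hence the new diagonal entry
    \<open>d\<close> is at least 1.\<close>
  define x' where "x' = x(m := -1)"
  have "(\<Sum>i<Suc m. \<Sum>j<Suc m. x' i * x' j * M i j) = s - q - (q - M m m)"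
  proof -
    have "(\<Sum>j<Suc m. x' i * x' j * M i j) = (\<Sum>j<m. x i * x j * M i j) - x i * M m i" if "i < m" for i
      using that sym[of i m] by (simp add: x'_def)
    then have "(\<Sum>i<m. \<Sum>j<Suc m. x' i * x' j * M i j) = s - q"
      unfolding s_def q1 sum_subtractf[symmetric] by (intro sum.cong refl) simp
    moreover have "(\<Sum>j<Suc m. x' m * x' j * M m j) = - q + M m m"
      unfolding q1 by (simp add: x'_def sum_negf)
    ultimately show ?thesis by simp
  qed
  moreover have "0 \<le> r" unfolding r_def by (intro sum_nonneg) simp
  ultimately have qm: "q \<le> M m m" using Suc.prems[of x'] q2 by simp
  define d where "d = sqrt (1 + M m m - q)"
  have q0: "q \<ge> 0" unfolding q_def by (intro sum_nonneg) simp
  have d: "d \<ge> 1" "d\<^sup>2 = 1 + M m m - q" using qm by (auto simp: d_def)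
  define L' where "L' i j = (if i < m then L i j else if j < m then l j else if i = m \<and> j = m then d else 0)" for i j
  have L'1: "L' i j = L i j" if "i < m" for i j using that by (simp add: L'_def)
  have L'2: "L' m j = l j" if "j < m" for j using that by (simp add: L'_def)
  have L'3: "L' m m = d" by (simp add: L'_def)
  show ?case
  proof (intro exI[of _ "\<lambda>i j. if i \<le> m then L' i j else 0"] conjI allI impI)
    fix i j :: nat assume "i < j" then show "(if i \<le> m then L' i j else 0) = 0"
      using tri[of i j] by (auto simp: L'_def)
  next
    fix i assume "i < Suc m"
    then show "1 \<le> (if i \<le> m then L' i i else 0)" "(if i \<le> m then L' i i else 0)\<^sup>2 \<le> 1 + M i i"
      using diag[of i] d q0 by (cases "i = m"; simp add: L'1 L'3)+
    show "(\<Sum>j<i. (if i \<le> m then L' i j else 0)\<^sup>2) \<le> (\<Sum>j<i. (M i j)\<^sup>2)"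
      using off[of i] \<open>i < Suc m\<close> qM by (cases "i = m"; simp add: L'1 L'2 q_def)
  next
    fix i j assume ij: "i < Suc m" "j < Suc m"
    have mm: "(\<Sum>k<Suc m. L' m k * L' m k) = 1 + M m m"
      using d by (simp add: L'2 L'3 q_def power2_eq_square[symmetric])
    have im: "(\<Sum>k<Suc m. L' i k * L' m k) = M i m" if "i < m" for i
      using l[OF that] tri[OF that] sym[of i m] that by (simp add: L'1 L'2 L'3)
    have ii: "(\<Sum>k<Suc m. L' i k * L' j k) = (if i = j then 1 else 0) + M i j" if "i < m" "j < m" for i j
      using LL[OF that] tri[of i m] that by (simp add: L'1)
    have "(\<Sum>k<Suc m. L' i k * L' j k) = (if i = j then 1 else 0) + M i j"
    proof (cases "i = m"; cases "j = m")
      assume "i = m" "j \<noteq> m"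
      then show ?thesis using im[of j] ij sym[of j m] by (simp only: mult.commute[of "L' m _"]) simp
    qed (use mm im[of i] ii[of i j] ij in auto)
    then show "(\<Sum>k<Suc m. (if i \<le> m then L' i k else 0) * (if j \<le> m then L' j k else 0))
        = (if i = j then 1 else 0) + M i j"
      using ij by simp
  qed
qed

section \<open>Comparison of a Gaussian vector with a standard one\<close>

definition tri_map :: "(nat \<Rightarrow> nat \<Rightarrow> real) \<Rightarrow> nat \<Rightarrow> (nat \<Rightarrow> real) \<Rightarrow> nat \<Rightarrow> real" where
  "tri_map L m \<xi> = (\<lambda>i\<in>{..<m}. \<Sum>j\<le>i. L i j * \<xi> j)"

text \<open>The standard normal density at \<open>tri_map L m \<xi>\<close> divided by that at
  \<xi>, times the Jacobian, which for a triangular map is the product of the diagonal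
  entries.\<close>

definition tri_weight :: "(nat \<Rightarrow> nat \<Rightarrow> real) \<Rightarrow> nat \<Rightarrow> (nat \<Rightarrow> real) \<Rightarrow> real" where
  "tri_weight L m \<xi> = (\<Prod>i<m. L i i * exp (- ((tri_map L m \<xi> i)\<^sup>2 - (\<xi> i)\<^sup>2) / 2))"

lemma measurable_tri_map:
  "tri_map L m \<in> iid_normal {..<m} \<rightarrow>\<^sub>M Pi\<^sub>M {..<m} (\<lambda>_. borel)"
  unfolding tri_map_def
proof (rule measurable_restrict, rule borel_measurable_sum)
  fix i j assume "i \<in> {..<m}" "j \<in> {..i}"
  then have "j \<in> {..<m}" by simp
  then show "(\<lambda>\<xi>. L i j * \<xi> j) \<in> borel_measurable (iid_normal {..<m})"
    by (rule borel_measurable_times[OF borel_measurable_const measurable_iid_normal_component])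
qed

lemma borel_measurable_gaussian_ratio:
  assumes [measurable]: "f \<in> borel_measurable M" "g \<in> borel_measurable M"
  shows "(\<lambda>x. c * exp (- ((f x)\<^sup>2 - (g x)\<^sup>2) / 2) :: real) \<in> borel_measurable M"
  by measurable

lemma measurable_tri_weight: "tri_weight L m \<in> borel_measurable (iid_normal {..<m})"
  unfolding tri_weight_def
proof (rule borel_measurable_prod, rule borel_measurable_gaussian_ratio)
  fix i assume i: "i \<in> {..<m}"
  show "(\<lambda>\<xi>. tri_map L m \<xi> i) \<in> borel_measurable (iid_normal {..<m})"
    by (rule measurable_compose[OF measurable_tri_map measurable_component_singleton[OF i]])
  show "(\<lambda>\<xi>. \<xi> i) \<in> borel_measurable (iid_normal {..<m})"
    by (rule measurable_iid_normal_component[OF i])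
qed

lemma nn_integral_std_normal_affine:
  assumes g: "g \<in> borel_measurable borel" and a: "a > 0"
  shows "(\<integral>\<^sup>+y. g y \<partial>std_normal_distribution)
    = (\<integral>\<^sup>+y. g (c + a * y) * ennreal (a * exp (- ((c + a * y)\<^sup>2 - y\<^sup>2) / 2)) \<partial>std_normal_distribution)"
proof -
  have gm: "(\<lambda>y. g (c + a * y)) \<in> borel_measurable borel"
    by (rule measurable_compose[OF _ g]) simp
  have af: "(\<lambda>y. c + a * y) \<in> borel_measurable borel" by simp
  have dm: "(\<lambda>y. ennreal (std_normal_density (c + a * y))) \<in> borel_measurable borel"
    "(\<lambda>y. ennreal (std_normal_density y)) \<in> borel_measurable borel"
    "(\<lambda>y. ennreal (a * exp (- ((c + a * y)\<^sup>2 - y\<^sup>2) / 2))) \<in> borel_measurable borel"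
    by (rule measurable_compose[OF _ measurable_ennreal] measurable_compose[OF af borel_measurable_normal_density]
        borel_measurable_normal_density borel_measurable_gaussian_ratio[OF af] measurable_ident_sets[OF refl])+
  have "(\<integral>\<^sup>+y. g y \<partial>std_normal_distribution) = (\<integral>\<^sup>+y. ennreal (std_normal_density y) * g y \<partial>lborel)"
    using g dm(2) by (intro nn_integral_density) simp_all
  also have "\<dots> = ennreal a * (\<integral>\<^sup>+y. ennreal (std_normal_density (c + a * y)) * g (c + a * y) \<partial>lborel)"
    using a borel_measurable_times_ennreal[OF dm(2) g]
    by (subst nn_integral_real_affine[where c = a and t = c]) simp_all
  also have "\<dots> = (\<integral>\<^sup>+y. ennreal a * (ennreal (std_normal_density (c + a * y)) * g (c + a * y)) \<partial>lborel)"
    using borel_measurable_times_ennreal[OF dm(1) gm] by (intro nn_integral_cmult[symmetric]) simp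
  also have "\<dots> = (\<integral>\<^sup>+y. ennreal (std_normal_density y) *
      (g (c + a * y) * ennreal (a * exp (- ((c + a * y)\<^sup>2 - y\<^sup>2) / 2))) \<partial>lborel)"
  proof (rule nn_integral_cong)
    fix y
    have "a * std_normal_density (c + a * y)
        = std_normal_density y * (a * exp (- ((c + a * y)\<^sup>2 - y\<^sup>2) / 2))"
      unfolding std_normal_density_def
      by (simp add: exp_add[symmetric] diff_divide_distrib)
    then have "ennreal a * ennreal (std_normal_density (c + a * y))
        = ennreal (std_normal_density y) * ennreal (a * exp (- ((c + a * y)\<^sup>2 - y\<^sup>2) / 2))"
      using a by (simp only: ennreal_mult[symmetric] normal_density_nonneg mult_nonneg_nonneg exp_ge_zero less_imp_le)
    moreover have "A * (B * E) = C * (E * D)" if "A * B = C * D" for A B C D E :: ennreal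
      using that by (metis mult.assoc mult.commute)
    ultimately show "ennreal a * (ennreal (std_normal_density (c + a * y)) * g (c + a * y))
        = ennreal (std_normal_density y) * (g (c + a * y) * ennreal (a * exp (- ((c + a * y)\<^sup>2 - y\<^sup>2) / 2)))"
      by blast
  qed
  also have "\<dots> = (\<integral>\<^sup>+y. g (c + a * y) * ennreal (a * exp (- ((c + a * y)\<^sup>2 - y\<^sup>2) / 2)) \<partial>std_normal_distribution)"
    using borel_measurable_times_ennreal[OF gm dm(3)] dm(2) by (intro nn_integral_density[symmetric]) simp_all
  finally show ?thesis .
qed

lemma nn_integral_iid_normal_Suc:
  assumes G: "G \<in> borel_measurable (Pi\<^sub>M {..<Suc m} (\<lambda>_. borel))"
  shows "(\<integral>\<^sup>+x. G x \<partial>iid_normal {..<Suc m})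
    = (\<integral>\<^sup>+x. (\<integral>\<^sup>+y. G (x(m := y)) \<partial>std_normal_distribution) \<partial>iid_normal {..<m})"
    and "(\<lambda>(x, y). G (x(m := y))) \<in> borel_measurable (Pi\<^sub>M {..<m} (\<lambda>_. borel) \<Otimes>\<^sub>M std_normal_distribution)"
proof -
  interpret product_prob_space "\<lambda>_::nat. std_normal_distribution"
    by (intro product_prob_spaceI prob_space_std_normal)
  have ins: "{..<Suc m} = insert m {..<m}" by auto
  have G': "G \<in> borel_measurable (Pi\<^sub>M (insert m {..<m}) (\<lambda>_. std_normal_distribution))"
    using G measurable_cong_sets[OF sets_iid_normal refl, of "{..<Suc m}"] unfolding iid_normal_def ins by blast
  show "(\<integral>\<^sup>+x. G x \<partial>iid_normal {..<Suc m})
    = (\<integral>\<^sup>+x. (\<integral>\<^sup>+y. G (x(m := y)) \<partial>std_normal_distribution) \<partial>iid_normal {..<m})"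
    unfolding iid_normal_def ins by (rule product_nn_integral_insert[OF _ _ G']) auto
  have s: "sets (Pi\<^sub>M {..<m} (\<lambda>_. borel) \<Otimes>\<^sub>M std_normal_distribution)
      = sets (Pi\<^sub>M {..<m} (\<lambda>_. std_normal_distribution) \<Otimes>\<^sub>M std_normal_distribution)"
    by (intro sets_pair_measure_cong sets_iid_normal[unfolded iid_normal_def, symmetric] refl)
  have "(\<lambda>(x, y). x(m := y)) \<in> Pi\<^sub>M {..<m} (\<lambda>_. std_normal_distribution) \<Otimes>\<^sub>M std_normal_distribution
      \<rightarrow>\<^sub>M Pi\<^sub>M (insert m {..<m}) (\<lambda>_. std_normal_distribution)"
    by (rule measurable_add_dim)
  from measurable_compose[OF this G']
  show "(\<lambda>(x, y). G (x(m := y))) \<in> borel_measurable (Pi\<^sub>M {..<m} (\<lambda>_. borel) \<Otimes>\<^sub>M std_normal_distribution)"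
    unfolding measurable_cong_sets[OF s refl] by (simp add: case_prod_beta')
qed

text \<open>The last output coordinate is affine in the last input, with an offset that depends on
  the earlier inputs only. By Tonelli the change of variables thus reduces to the one-dimensional
  affine one, coordinate by coordinate.\<close>

lemma nn_integral_tri_map:
  assumes "\<And>i. i < m \<Longrightarrow> L i i > 0" and "G \<in> borel_measurable (Pi\<^sub>M {..<m} (\<lambda>_. borel))"
  shows "(\<integral>\<^sup>+x. G x \<partial>iid_normal {..<m}) = (\<integral>\<^sup>+\<xi>. G (tri_map L m \<xi>) * ennreal (tri_weight L m \<xi>) \<partial>iid_normal {..<m})"
  using assms
proof (induction m arbitrary: G)
  case 0
  show ?case
  proof (rule nn_integral_cong)
    fix x assume "x \<in> space (iid_normal {..<0::nat})"
    then have "x = tri_map L 0 x" by (simp add: tri_map_def iid_normal_def space_PiM restrict_def)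
    then show "G x = G (tri_map L 0 x) * ennreal (tri_weight L 0 x)" by (simp add: tri_weight_def)
  qed
next
  case (Suc m)
  note Gm = nn_integral_iid_normal_Suc[OF Suc.prems(2)]
  interpret N: prob_space std_normal_distribution by (rule prob_space_std_normal)
  define c where "c \<xi> = (\<Sum>j<m. L m j * \<xi> j)" for \<xi>
  define w where "w \<xi> y = L m m * exp (- ((c \<xi> + L m m * y)\<^sup>2 - y\<^sup>2) / 2)" for \<xi> y
  have Lm: "L m m > 0" using Suc.prems(1) by simp
  have map: "tri_map L (Suc m) (\<xi>(m := y)) = (tri_map L m \<xi>)(m := c \<xi> + L m m * y)" for \<xi> y
  proof
    fix i
    have "(\<Sum>j\<le>i. L i j * (\<xi>(m := y)) j) = (\<Sum>j\<le>i. L i j * \<xi> j)" if "i < m"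
      using that by (intro sum.cong) auto
    moreover have "(\<Sum>j<m. L m j * (\<xi>(m := y)) j) = c \<xi>"
      unfolding c_def by (intro sum.cong) auto
    then have "(\<Sum>j\<le>m. L m j * (\<xi>(m := y)) j) = c \<xi> + L m m * y"
      unfolding lessThan_Suc_atMost[symmetric] sum.lessThan_Suc by (simp only: fun_upd_same)
    ultimately show "tri_map L (Suc m) (\<xi>(m := y)) i = ((tri_map L m \<xi>)(m := c \<xi> + L m m * y)) i"
      unfolding tri_map_def by (cases "i < m"; cases "i = m"; simp)
  qed
  have wt: "tri_weight L (Suc m) (\<xi>(m := y)) = w \<xi> y * tri_weight L m \<xi>" for \<xi> y
    unfolding tri_weight_def map w_def by (simp add: mult.commute)
  have wt0: "0 \<le> tri_weight L m \<xi>" for \<xi>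
    unfolding tri_weight_def using Suc.prems(1) by (intro prod_nonneg mult_nonneg_nonneg) (auto intro: less_imp_le)
  have w0: "0 \<le> w \<xi> y" for \<xi> y using Lm by (simp add: w_def)
  have G1: "(\<lambda>x. \<integral>\<^sup>+y. G (x(m := y)) \<partial>std_normal_distribution) \<in> borel_measurable (Pi\<^sub>M {..<m} (\<lambda>_. borel))"
    by (rule N.borel_measurable_nn_integral[OF Gm(2)])
  have meas_y: "(\<lambda>y. G (x(m := y))) \<in> borel_measurable borel" if "x \<in> space (Pi\<^sub>M {..<m} (\<lambda>_. borel))" for x
    using measurable_Pair2[OF Gm(2) that] unfolding prod.case by simp
  have "(\<integral>\<^sup>+x. G x \<partial>iid_normal {..<Suc m})
      = (\<integral>\<^sup>+x. (\<integral>\<^sup>+y. G (x(m := y)) \<partial>std_normal_distribution) \<partial>iid_normal {..<m})"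
    by (rule Gm(1))
  \<comment> \<open>The induction hypothesis is applied to the function obtained from
    \<open>G\<close> by integrating out the last coordinate.\<close>
  also have "\<dots> = (\<integral>\<^sup>+\<xi>. (\<integral>\<^sup>+y. G ((tri_map L m \<xi>)(m := y)) \<partial>std_normal_distribution)
      * ennreal (tri_weight L m \<xi>) \<partial>iid_normal {..<m})"
    by (rule Suc.IH[OF _ G1]) (use Suc.prems(1) in simp)
  also have "\<dots> = (\<integral>\<^sup>+\<xi>. (\<integral>\<^sup>+y. G (tri_map L (Suc m) (\<xi>(m := y))) * ennreal (tri_weight L (Suc m) (\<xi>(m := y)))
      \<partial>std_normal_distribution) \<partial>iid_normal {..<m})"
  proof (rule nn_integral_cong)
    fix \<xi> assume \<xi>: "\<xi> \<in> space (iid_normal {..<m})"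
    have sp: "tri_map L m \<xi> \<in> space (Pi\<^sub>M {..<m} (\<lambda>_. borel))" by (rule measurable_space[OF measurable_tri_map \<xi>])
    note my = meas_y[OF sp]
    have "(\<integral>\<^sup>+y. G ((tri_map L m \<xi>)(m := y)) \<partial>std_normal_distribution)
        = (\<integral>\<^sup>+y. G ((tri_map L m \<xi>)(m := c \<xi> + L m m * y)) * ennreal (w \<xi> y) \<partial>std_normal_distribution)"
      unfolding w_def by (rule nn_integral_std_normal_affine[OF my Lm])
    then have "(\<integral>\<^sup>+y. G ((tri_map L m \<xi>)(m := y)) \<partial>std_normal_distribution) * ennreal (tri_weight L m \<xi>)
        = (\<integral>\<^sup>+y. (G ((tri_map L m \<xi>)(m := c \<xi> + L m m * y)) * ennreal (w \<xi> y)) * ennreal (tri_weight L m \<xi>)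
          \<partial>std_normal_distribution)"
      using measurable_compose[OF _ my, of "\<lambda>y. c \<xi> + L m m * y" borel]
      by (subst nn_integral_multc) (auto simp: w_def intro!: borel_measurable_times_ennreal)
    then show "(\<integral>\<^sup>+y. G ((tri_map L m \<xi>)(m := y)) \<partial>std_normal_distribution) * ennreal (tri_weight L m \<xi>)
        = (\<integral>\<^sup>+y. G (tri_map L (Suc m) (\<xi>(m := y))) * ennreal (tri_weight L (Suc m) (\<xi>(m := y))) \<partial>std_normal_distribution)"
      unfolding map wt by (simp only: ennreal_mult[OF w0 wt0] mult.assoc)
  qed
  also have "\<dots> = (\<integral>\<^sup>+\<xi>. G (tri_map L (Suc m) \<xi>) * ennreal (tri_weight L (Suc m) \<xi>) \<partial>iid_normal {..<Suc m})"
  proof (rule nn_integral_iid_normal_Suc(1)[symmetric])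
    have "(\<lambda>\<xi>. G (tri_map L (Suc m) \<xi>)) \<in> borel_measurable (iid_normal {..<Suc m})"
      by (rule measurable_compose[OF measurable_tri_map Suc.prems(2)])
    then have "(\<lambda>\<xi>. G (tri_map L (Suc m) \<xi>) * ennreal (tri_weight L (Suc m) \<xi>)) \<in> borel_measurable (iid_normal {..<Suc m})"
      by (intro borel_measurable_times_ennreal measurable_compose[OF measurable_tri_weight measurable_ennreal])
    then show "(\<lambda>\<xi>. G (tri_map L (Suc m) \<xi>) * ennreal (tri_weight L (Suc m) \<xi>)) \<in> borel_measurable (Pi\<^sub>M {..<Suc m} (\<lambda>_. borel))"
      unfolding measurable_cong_sets[OF sets_iid_normal refl] .
  qed
  finally show ?case .
qed

section \<open>Relative entropy and testing\<close>

lemma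
  assumes J: "finite J" "J \<subseteq> I"
  shows integrable_iid_normal_comb_sq: "integrable (iid_normal I) (\<lambda>\<omega>. (\<Sum>i\<in>J. b i * \<omega> i)\<^sup>2)"
    and integral_iid_normal_comb_sq: "(LINT \<omega>|iid_normal I. (\<Sum>i\<in>J. b i * \<omega> i)\<^sup>2) = (\<Sum>i\<in>J. (b i)\<^sup>2)"
proof -
  have m: "(\<lambda>\<omega>. \<Sum>i\<in>J. b i * \<omega> i) \<in> borel_measurable (iid_normal I)"
    using J by (intro borel_measurable_sum borel_measurable_times borel_measurable_const
        measurable_iid_normal_component) auto
  have char: "(CLINT \<omega>|iid_normal I. iexp (u * (\<Sum>i\<in>J. b i * \<omega> i))) = exp (- (u\<^sup>2 * (\<Sum>i\<in>J. (b i)\<^sup>2)) / 2)" for u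
    using char_iid_normal_sum[OF J, of "\<lambda>i. u * b i"]
    by (simp only: sum_distrib_left power_mult_distrib mult.assoc)
  have v: "0 \<le> (\<Sum>i\<in>J. (b i)\<^sup>2)" by (intro sum_nonneg) simp
  show "integrable (iid_normal I) (\<lambda>\<omega>. (\<Sum>i\<in>J. b i * \<omega> i)\<^sup>2)"
    by (rule gaussian_integrable_if_char(2)[OF prob_space_iid_normal m char v])
  show "(LINT \<omega>|iid_normal I. (\<Sum>i\<in>J. b i * \<omega> i)\<^sup>2) = (\<Sum>i\<in>J. (b i)\<^sup>2)"
    by (rule gaussian_moments_if_char(2)[OF prob_space_iid_normal m char v])
qed

text \<open>The Gibbs variational inequality for the function \<open>l\<cdot>1\<^sub>A\<close>; the expression \<open>D\<close> is the
  relative entropy of the law of \<open>tri_map L m\<close> with respect to the standard normal law.\<close>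

lemma tri_map_variational:
  fixes L :: "nat \<Rightarrow> nat \<Rightarrow> real"
  assumes L: "\<And>i. i < m \<Longrightarrow> L i i > 0" and A: "A \<in> sets (Pi\<^sub>M {..<m} (\<lambda>_. borel))" and l: "l \<ge> 0"
  defines "D \<equiv> (\<Sum>i<m. (\<Sum>j\<le>i. (L i j)\<^sup>2) - 1 - 2 * ln (L i i)) / 2"
  shows "exp (l * measure (distr (iid_normal {..<m}) (Pi\<^sub>M {..<m} (\<lambda>_. borel)) (tri_map L m)) A - D)
    \<le> 1 + (exp l - 1) * measure (iid_normal {..<m}) A"
proof -
  define \<gamma> where "\<gamma> = iid_normal {..<m}"
  interpret prob_space \<gamma> unfolding \<gamma>_def by (rule prob_space_iid_normal)
  note T = measurable_tri_map[of L m, folded \<gamma>_def]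
  define p where "p = measure (distr \<gamma> (Pi\<^sub>M {..<m} (\<lambda>_. borel)) (tri_map L m)) A"
  define I where "I \<xi> = (indicator A (tri_map L m \<xi>) :: real)" for \<xi>
  \<comment> \<open>The logarithm of \<open>tri_weight\<close>; its mean is minus the relative
    entropy \<open>D\<close>.\<close>
  define S where "S \<xi> = (\<Sum>i<m. ln (L i i) - ((tri_map L m \<xi> i)\<^sup>2 - (\<xi> i)\<^sup>2) / 2)" for \<xi>
  have A\<gamma>: "A \<in> sets \<gamma>" using A by (simp add: \<gamma>_def sets_iid_normal)
  have Im: "I \<in> borel_measurable \<gamma>"
    unfolding I_def by (rule measurable_compose[OF T borel_measurable_indicator[OF A]])
  have Ii: "integrable \<gamma> I" by (rule integrable_const_bound[where B = 1]) (auto simp: I_def indicator_def Im intro!: AE_I2)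
  have IE: "(LINT \<xi>|\<gamma>. I \<xi>) = p"
  proof -
    have "(LINT \<xi>|\<gamma>. I \<xi>) = (LINT x|distr \<gamma> (Pi\<^sub>M {..<m} (\<lambda>_. borel)) (tri_map L m). indicator A x)"
      unfolding I_def by (rule integral_distr[OF T borel_measurable_indicator[OF A], symmetric])
    also have "\<dots> = p" unfolding p_def using A sets.sets_into_space[OF A] by (simp add: Int_absorb2)
    finally show ?thesis .
  qed
  have tm: "integrable \<gamma> (\<lambda>\<xi>. ln (L i i) - ((tri_map L m \<xi> i)\<^sup>2 - (\<xi> i)\<^sup>2) / 2)"
    "(LINT \<xi>|\<gamma>. ln (L i i) - ((tri_map L m \<xi> i)\<^sup>2 - (\<xi> i)\<^sup>2) / 2) = ln (L i i) - ((\<Sum>j\<le>i. (L i j)\<^sup>2) - 1) / 2"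
    if i: "i < m" for i
  proof -
    have t: "tri_map L m \<xi> i = (\<Sum>j\<le>i. L i j * \<xi> j)" for \<xi> using i by (simp add: tri_map_def)
    have sub: "{..i} \<subseteq> {..<m}" using i by auto
    have i1: "integrable \<gamma> (\<lambda>\<xi>. (tri_map L m \<xi> i)\<^sup>2)" "(LINT \<xi>|\<gamma>. (tri_map L m \<xi> i)\<^sup>2) = (\<Sum>j\<le>i. (L i j)\<^sup>2)"
      unfolding t \<gamma>_def
      using integrable_iid_normal_comb_sq[OF finite_atMost sub] integral_iid_normal_comb_sq[OF finite_atMost sub] by blast+
    have i2: "integrable \<gamma> (\<lambda>\<xi>. (\<xi> i)\<^sup>2)" "(LINT \<xi>|\<gamma>. (\<xi> i)\<^sup>2) = 1"
      using integrable_iid_normal_comb_sq[of "{i}" "{..<m}" "\<lambda>_. 1"] integral_iid_normal_comb_sq[of "{i}" "{..<m}" "\<lambda>_. 1"] i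
      by (simp_all add: \<gamma>_def)
    show "integrable \<gamma> (\<lambda>\<xi>. ln (L i i) - ((tri_map L m \<xi> i)\<^sup>2 - (\<xi> i)\<^sup>2) / 2)"
      by (intro Bochner_Integration.integrable_diff integrable_divide integrable_const i1 i2)
    show "(LINT \<xi>|\<gamma>. ln (L i i) - ((tri_map L m \<xi> i)\<^sup>2 - (\<xi> i)\<^sup>2) / 2) = ln (L i i) - ((\<Sum>j\<le>i. (L i j)\<^sup>2) - 1) / 2"
      by (simp only: Bochner_Integration.integral_diff Bochner_Integration.integrable_diff integral_divide_zero
          integrable_divide integrable_const i1 i2 lebesgue_integral_const prob_space scaleR_one)
  qed
  have Si: "integrable \<gamma> S" unfolding S_def by (intro Bochner_Integration.integrable_sum tm) simp
  have SE: "(LINT \<xi>|\<gamma>. S \<xi>) = - D"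
  proof -
    have "(LINT \<xi>|\<gamma>. S \<xi>) = (\<Sum>i<m. ln (L i i) - ((\<Sum>j\<le>i. (L i j)\<^sup>2) - 1) / 2)"
      unfolding S_def by (subst Bochner_Integration.integral_sum) (simp_all add: tm)
    also have "\<dots> = - D"
      unfolding D_def sum_divide_distrib sum_negf[symmetric] by (intro sum.cong refl) (simp add: field_simps)
    finally show ?thesis .
  qed
  define H where "H \<xi> = l * I \<xi> + S \<xi>" for \<xi>
  have Hi: "integrable \<gamma> H" unfolding H_def by (intro Bochner_Integration.integrable_add integrable_mult_right Ii Si)
  have HE: "(LINT \<xi>|\<gamma>. H \<xi>) = l * p - D"
    unfolding H_def by (simp add: Ii Si IE SE)
  have G: "(\<lambda>x. ennreal (exp (l * indicator A x))) \<in> borel_measurable (Pi\<^sub>M {..<m} (\<lambda>_. borel))"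
    using A by measurable
  have w: "tri_weight L m \<xi> = exp (S \<xi>)" for \<xi>
    unfolding tri_weight_def S_def exp_sum[OF finite_lessThan]
  proof (rule prod.cong[OF refl])
    fix i assume "i \<in> {..<m}"
    then have "L i i = exp (ln (L i i))" using L by simp
    then show "L i i * exp (- ((tri_map L m \<xi> i)\<^sup>2 - (\<xi> i)\<^sup>2) / 2) = exp (ln (L i i) - ((tri_map L m \<xi> i)\<^sup>2 - (\<xi> i)\<^sup>2) / 2)"
      by (metis exp_add minus_divide_left diff_conv_add_uminus)
  qed
  have "(\<integral>\<^sup>+x. ennreal (exp (l * indicator A x)) \<partial>\<gamma>)
      = (\<integral>\<^sup>+\<xi>. ennreal (exp (l * indicator A (tri_map L m \<xi>))) * ennreal (tri_weight L m \<xi>) \<partial>\<gamma>)"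
    unfolding \<gamma>_def by (rule nn_integral_tri_map[OF L G])
  also have "\<dots> = (\<integral>\<^sup>+\<xi>. ennreal (exp (H \<xi>)) \<partial>\<gamma>)"
    by (intro nn_integral_cong) (simp add: w H_def I_def exp_add ennreal_mult)
  finally have eq: "(\<integral>\<^sup>+\<xi>. ennreal (exp (H \<xi>)) \<partial>\<gamma>) = (\<integral>\<^sup>+x. ennreal (exp (l * indicator A x)) \<partial>\<gamma>)" ..
  have "(\<lambda>x. exp (l * indicator A x)) = (\<lambda>x. 1 + (exp l - 1) * indicator A x :: real)"
    by (auto simp: indicator_def)
  moreover have iA: "integrable \<gamma> (\<lambda>x. indicator A x :: real)"
  proof (rule integrable_const_bound[where B = 1])
    show "AE x in \<gamma>. norm (indicator A x :: real) \<le> 1" by (intro AE_I2) (simp add: indicator_def)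
    show "(\<lambda>x. indicator A x :: real) \<in> borel_measurable \<gamma>" by (rule borel_measurable_indicator[OF A\<gamma>])
  qed
  moreover have "integrable \<gamma> (\<lambda>x. 1 + (exp l - 1) * indicator A x :: real)"
    by (intro Bochner_Integration.integrable_add integrable_const integrable_mult_right iA)
  moreover have "(LINT x|\<gamma>. indicator A x) = measure \<gamma> A"
    using sets.sets_into_space[OF A\<gamma>] by (simp add: Int_absorb2)
  then have "(LINT x|\<gamma>. 1 + (exp l - 1) * indicator A x) = 1 + (exp l - 1) * measure \<gamma> A"
    by (simp only: Bochner_Integration.integral_add integrable_const integrable_mult_right iA
        integral_mult_right_zero lebesgue_integral_const prob_space scaleR_one)
  ultimately have nn: "(\<integral>\<^sup>+x. ennreal (exp (l * indicator A x)) \<partial>\<gamma>) = ennreal (1 + (exp l - 1) * measure \<gamma> A)"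
    by (subst nn_integral_eq_integral) auto
  have q0: "0 \<le> 1 + (exp l - 1) * measure \<gamma> A" using l by simp
  have eHm: "(\<lambda>\<xi>. exp (H \<xi>)) \<in> borel_measurable \<gamma>"
    using Hi by (intro measurable_compose[OF borel_measurable_integrable borel_measurable_exp])
  have "has_bochner_integral \<gamma> (\<lambda>\<xi>. exp (H \<xi>)) (1 + (exp l - 1) * measure \<gamma> A)"
    by (rule has_bochner_integral_nn_integral[OF eHm _ q0]) (simp_all add: eq nn)
  then have eHi: "integrable \<gamma> (\<lambda>\<xi>. exp (H \<xi>))" and eHE: "(LINT \<xi>|\<gamma>. exp (H \<xi>)) = 1 + (exp l - 1) * measure \<gamma> A"
    by (auto simp: has_bochner_integral_iff)
  \<comment> \<open>Jensen's inequality for \<open>exp\<close>, through the tangent at the mean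
    \<open>c\<close> of \<open>H\<close>.\<close>
  define c where "c = l * p - D"
  have "(LINT \<xi>|\<gamma>. exp c * (1 + (H \<xi> - c))) \<le> (LINT \<xi>|\<gamma>. exp (H \<xi>))"
  proof (rule integral_mono[OF _ eHi])
    show "integrable \<gamma> (\<lambda>\<xi>. exp c * (1 + (H \<xi> - c)))" using Hi by simp
    fix \<xi>
    have "exp c * (1 + (H \<xi> - c)) \<le> exp c * exp (H \<xi> - c)" by (intro mult_left_mono exp_ge_add_one_self) simp
    then show "exp c * (1 + (H \<xi> - c)) \<le> exp (H \<xi>)" by (simp add: exp_add[symmetric])
  qed
  moreover have "(LINT \<xi>|\<gamma>. exp c * (1 + (H \<xi> - c))) = exp c"
    using Hi HE by (simp add: prob_space c_def)
  ultimately show ?thesis using eHE unfolding c_def p_def \<gamma>_def by simp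
qed

lemma distr_tri_map_char:
  assumes tri: "\<And>i j. i < j \<Longrightarrow> L i j = 0"
  shows "(CLINT x|distr (iid_normal {..<m}) (Pi\<^sub>M {..<m} (\<lambda>_. borel)) (tri_map L m). iexp (\<Sum>i<m. a i * x i))
    = exp (- (\<Sum>i<m. \<Sum>j<m. a i * a j * (\<Sum>k<m. L i k * L j k)) / 2)"
proof -
  define b where "b j = (\<Sum>i<m. a i * L i j)" for j
  have m: "(\<lambda>x. iexp (\<Sum>i<m. a i * x i)) \<in> borel_measurable (Pi\<^sub>M {..<m} (\<lambda>_. borel))"
  proof -
    have "(\<lambda>x. \<Sum>i<m. a i * x i) \<in> borel_measurable (Pi\<^sub>M {..<m} (\<lambda>_. borel))"
      by (intro borel_measurable_sum borel_measurable_times borel_measurable_const measurable_component_singleton)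
    then show ?thesis by measurable
  qed
  have lin: "(\<Sum>i<m. a i * tri_map L m \<xi> i) = (\<Sum>j<m. b j * \<xi> j)" for \<xi>
  proof -
    have "tri_map L m \<xi> i = (\<Sum>j<m. L i j * \<xi> j)" if "i < m" for i
    proof -
      have "tri_map L m \<xi> i = (\<Sum>j\<le>i. L i j * \<xi> j)" using that by (simp add: tri_map_def)
      also have "\<dots> = (\<Sum>j<m. L i j * \<xi> j)"
        using that by (intro sum.mono_neutral_left) (auto simp: tri not_le)
      finally show ?thesis .
    qed
    then have "(\<Sum>i<m. a i * tri_map L m \<xi> i) = (\<Sum>i<m. \<Sum>j<m. a i * L i j * \<xi> j)"
      by (intro sum.cong refl) (simp add: sum_distrib_left mult.assoc)
    then show ?thesis unfolding b_def sum_distrib_right by (subst (asm) sum.swap)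
  qed
  have sq: "(\<Sum>k<m. (b k)\<^sup>2) = (\<Sum>i<m. \<Sum>j<m. a i * a j * (\<Sum>k<m. L i k * L j k))"
  proof -
    have "(\<Sum>k<m. (b k)\<^sup>2) = (\<Sum>k<m. \<Sum>i<m. \<Sum>j<m. a i * a j * (L i k * L j k))"
      unfolding b_def power2_eq_square sum_product by (simp only: mult_ac)
    also have "\<dots> = (\<Sum>i<m. \<Sum>j<m. \<Sum>k<m. a i * a j * (L i k * L j k))"
      by (subst sum.swap) (intro sum.cong refl sum.swap)
    finally show ?thesis by (simp only: sum_distrib_left)
  qed
  have "(CLINT x|distr (iid_normal {..<m}) (Pi\<^sub>M {..<m} (\<lambda>_. borel)) (tri_map L m). iexp (\<Sum>i<m. a i * x i))
      = (CLINT \<xi>|iid_normal {..<m}. iexp (\<Sum>i<m. a i * tri_map L m \<xi> i))"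
    by (rule integral_distr[OF measurable_tri_map m])
  also have "\<dots> = exp (- (\<Sum>k<m. (b k)\<^sup>2) / 2)"
    unfolding lin by (rule char_iid_normal_sum) auto
  finally show ?thesis unfolding sq .
qed

text \<open>The entropy of \<nu> with respect to \<mu> turns out to be at most \<open>K / 2\<close>,
  and bounded entropy prevents an event that is likely under \<nu> from being very unlikely under
  \<mu>. The characteristic functions serve to replace both laws by a standard normal vector and its
  triangular image.\<close>

lemma gaussian_test_lower_bound:
  fixes M :: "nat \<Rightarrow> nat \<Rightarrow> real" and \<mu> \<nu> :: "(nat \<Rightarrow> real) measure"
  assumes \<mu>: "prob_space \<mu>" "sets \<mu> = sets (Pi\<^sub>M {..<m} (\<lambda>_. borel))"
    and \<nu>: "prob_space \<nu>" "sets \<nu> = sets (Pi\<^sub>M {..<m} (\<lambda>_. borel))"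
    and char\<mu>: "\<And>a. (CLINT x|\<mu>. iexp (\<Sum>i<m. a i * x i)) = exp (- (\<Sum>i<m. (a i)\<^sup>2) / 2)"
    and char\<nu>: "\<And>a. (CLINT x|\<nu>. iexp (\<Sum>i<m. a i * x i))
      = exp (- (\<Sum>i<m. \<Sum>j<m. a i * a j * ((if i = j then 1 else 0) + M i j)) / 2)"
    and sym: "\<And>i j. M i j = M j i"
    and psd: "\<And>x. 0 \<le> (\<Sum>i<m. \<Sum>j<m. x i * x j * M i j)"
    and K: "(\<Sum>i<m. \<Sum>j<m. (M i j)\<^sup>2) \<le> K"
    and A: "A \<in> sets (Pi\<^sub>M {..<m} (\<lambda>_. borel))" and half: "measure \<nu> A \<ge> 1 / 2"
  shows "measure \<mu> A \<ge> exp (- (K + 2))"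
proof -
  obtain L where tri: "\<And>i j. i < j \<Longrightarrow> L i j = 0"
    and diag: "\<And>i. i < m \<Longrightarrow> 1 \<le> L i i \<and> (L i i)\<^sup>2 \<le> 1 + M i i"
    and LL: "\<And>i j. i < m \<Longrightarrow> j < m \<Longrightarrow> (\<Sum>k<m. L i k * L j k) = (if i = j then 1 else 0) + M i j"
    and off: "\<And>i. i < m \<Longrightarrow> (\<Sum>j<i. (L i j)\<^sup>2) \<le> (\<Sum>j<i. (M i j)\<^sup>2)"
    using cholesky_identity_plus[OF sym psd] by blast
  have \<mu>_eq: "\<mu> = iid_normal {..<m}"
  proof (rule measure_eqI_char[OF finite_lessThan \<mu> prob_space_iid_normal sets_iid_normal])
    show "(CLINT x|\<mu>. iexp (\<Sum>j<m. a j * x j)) = (CLINT x|iid_normal {..<m}. iexp (\<Sum>j<m. a j * x j))" for a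
      unfolding char\<mu> by (rule char_iid_normal_sum[symmetric]) auto
  qed
  have \<nu>_eq: "\<nu> = distr (iid_normal {..<m}) (Pi\<^sub>M {..<m} (\<lambda>_. borel)) (tri_map L m)"
  proof (rule measure_eqI_char[OF finite_lessThan \<nu>])
    show "prob_space (distr (iid_normal {..<m}) (Pi\<^sub>M {..<m} (\<lambda>_. borel)) (tri_map L m))"
      by (rule prob_space.prob_space_distr[OF prob_space_iid_normal measurable_tri_map])
    show "(CLINT x|\<nu>. iexp (\<Sum>j<m. a j * x j))
        = (CLINT x|distr (iid_normal {..<m}) (Pi\<^sub>M {..<m} (\<lambda>_. borel)) (tri_map L m). iexp (\<Sum>j<m. a j * x j))" for a
    proof -
      have "(\<Sum>i<m. \<Sum>j<m. a i * a j * ((if i = j then 1 else 0) + M i j))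
          = (\<Sum>i<m. \<Sum>j<m. a i * a j * (\<Sum>k<m. L i k * L j k))"
        by (intro sum.cong refl) (simp add: LL)
      then have "(CLINT x|\<nu>. iexp (\<Sum>j<m. a j * x j)) = exp (- (\<Sum>i<m. \<Sum>j<m. a i * a j * (\<Sum>k<m. L i k * L j k)) / 2)"
        unfolding char\<nu> by (simp only:)
      also have "\<dots> = (CLINT x|distr (iid_normal {..<m}) (Pi\<^sub>M {..<m} (\<lambda>_. borel)) (tri_map L m). iexp (\<Sum>j<m. a j * x j))"
        by (rule distr_tri_map_char[symmetric]) (rule tri)
      finally show ?thesis .
    qed
  qed simp
  define D where "D = (\<Sum>i<m. (\<Sum>j\<le>i. (L i j)\<^sup>2) - 1 - 2 * ln (L i i)) / 2"
  \<comment> \<open>With u the excess of the squared diagonal entry over 1, the diagonal contributes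
    u - ln (1 + u) \<le> u^2. The terms of first order cancel, which is why sums of squares of
    \<open>M\<close> suffice.\<close>
  have "(\<Sum>j\<le>i. (L i j)\<^sup>2) - 1 - 2 * ln (L i i) \<le> (\<Sum>j<m. (M i j)\<^sup>2)" if i: "i < m" for i
  proof -
    define u where "u = (L i i)\<^sup>2 - 1"
    have L1: "1 \<le> L i i" using diag[OF i] by simp
    then have u: "0 \<le> u" "u \<le> M i i" using diag[OF i] by (auto simp: u_def one_le_power)
    have "ln (1 / (1 + u)) \<le> 1 / (1 + u) - 1" using u by (intro ln_le_minus_one) simp
    then have "- ln (1 + u) \<le> - (u / (1 + u))" using u by (simp add: ln_div field_simps)
    moreover have "u - u / (1 + u) \<le> u\<^sup>2"
    proof -
      have "u - u / (1 + u) = u\<^sup>2 / (1 + u)" using u by (simp add: field_simps power2_eq_square)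
      also have "\<dots> \<le> u\<^sup>2 / 1" using u by (intro divide_left_mono) auto
      finally show ?thesis by simp
    qed
    moreover have "u\<^sup>2 \<le> (M i i)\<^sup>2" using u by (intro power_mono)
    moreover have "2 * ln (L i i) = ln (1 + u)" using L1 by (simp add: u_def ln_realpow)
    moreover have "(\<Sum>j\<le>i. (L i j)\<^sup>2) = (\<Sum>j<i. (L i j)\<^sup>2) + (1 + u)"
      by (simp add: lessThan_Suc_atMost[symmetric] u_def)
    ultimately have "(\<Sum>j\<le>i. (L i j)\<^sup>2) - 1 - 2 * ln (L i i) \<le> (\<Sum>j<i. (M i j)\<^sup>2) + (M i i)\<^sup>2"
      using off[OF i] by linarith
    also have "\<dots> = (\<Sum>j<Suc i. (M i j)\<^sup>2)" by simp
    also have "\<dots> \<le> (\<Sum>j<m. (M i j)\<^sup>2)" using i by (intro sum_mono2) auto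
    finally show ?thesis .
  qed
  then have "(\<Sum>i<m. (\<Sum>j\<le>i. (L i j)\<^sup>2) - 1 - 2 * ln (L i i)) \<le> (\<Sum>i<m. \<Sum>j<m. (M i j)\<^sup>2)"
    by (intro sum_mono) simp
  then have D: "D \<le> K / 2" using K unfolding D_def by linarith
  have "0 \<le> (\<Sum>i<m. \<Sum>j<m. (M i j)\<^sup>2)" by (intro sum_nonneg) simp
  then have K0: "0 \<le> K" using K by linarith
  \<comment> \<open>This value makes l / 2 - K / 2 equal to 1, and \<open>exp 1\<close> is at least
    2, which absorbs the summand 1 on the right of the variational inequality.\<close>
  define l where "l = K + 2"
  have l: "l \<ge> 0" using K0 by (simp add: l_def)
  have pos: "L i i > 0" if "i < m" for i using diag[OF that] by linarith
  have "exp (l * measure \<nu> A - D) \<le> 1 + (exp l - 1) * measure \<mu> A"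
    unfolding \<nu>_eq \<mu>_eq D_def by (rule tri_map_variational[OF pos A l])
  moreover have "1 \<le> l * measure \<nu> A - D"
  proof -
    have "l * (1 / 2) \<le> l * measure \<nu> A" using half l by (rule mult_left_mono)
    then show ?thesis using D by (simp add: l_def field_simps)
  qed
  then have "exp 1 \<le> exp (l * measure \<nu> A - D)" by simp
  moreover have "(2::real) \<le> exp 1" using exp_ge_add_one_self[of 1] by simp
  moreover have "(exp l - 1) * measure \<mu> A \<le> exp l * measure \<mu> A" by (intro mult_right_mono) auto
  ultimately have "1 \<le> exp l * measure \<mu> A" by linarith
  then have "exp (- l) * 1 \<le> exp (- l) * (exp l * measure \<mu> A)" by (intro mult_left_mono) auto
  then show ?thesis by (simp add: l_def mult.assoc[symmetric] exp_add[symmetric])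
qed

section \<open>Gaussian integrals on Euclidean space\<close>

lemma
  fixes f :: "'d::finite \<Rightarrow> real \<Rightarrow> 'b::{real_normed_field, banach, second_countable_topology}"
  assumes f: "\<And>i. integrable lborel (f i)"
  shows integral_lborel_prod_vec: "(LINT x|lborel. (\<Prod>i\<in>UNIV. f i ((x :: real^'d) $ i))) = (\<Prod>i\<in>UNIV. LINT x|lborel. f i x)"
    and integrable_lborel_prod_vec: "integrable lborel (\<lambda>x :: real^'d. \<Prod>i\<in>UNIV. f i (x $ i))"
proof -
  interpret product_sigma_finite "\<lambda>_ :: real^'d. lborel :: real measure" by standard
  \<comment> \<open>\<open>lborel_eq\<close> presents Lebesgue measure as a product over basis
    vectors; \<open>ix\<close> recovers the coordinate that belongs to a basis vector.\<close>
  define ix where "ix = inv (\<lambda>i. axis i (1::real) :: real^'d)"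
  have inj: "inj (\<lambda>i. axis i (1::real) :: real^'d)" by (auto simp: inj_on_def axis_eq_axis)
  have ix: "ix (axis i 1) = i" for i unfolding ix_def by (rule inv_f_f[OF inj])
  have B: "(Basis :: (real^'d) set) = range (\<lambda>i. axis i 1)" by (auto simp: Basis_vec_def)
  have reix: "(\<Prod>b\<in>Basis. g b) = (\<Prod>i\<in>UNIV. g (axis i 1))" for g :: "real^'d \<Rightarrow> 'b"
    unfolding B by (simp add: prod.reindex[OF inj])
  define E where "E g = (\<Sum>b\<in>Basis. g b *\<^sub>R b)" for g :: "real^'d \<Rightarrow> real"
  have Em: "E \<in> Pi\<^sub>M Basis (\<lambda>_. lborel) \<rightarrow>\<^sub>M borel"
    unfolding E_def by (intro borel_measurable_sum borel_measurable_scaleR borel_measurable_const) auto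
  have lb: "lborel = distr (Pi\<^sub>M Basis (\<lambda>_. lborel)) borel E" unfolding E_def by (rule lborel_eq)
  have Ei: "E g $ i = g (axis i 1)" for g i
  proof -
    have "E g $ i = E g \<bullet> axis i 1" by (simp add: inner_axis)
    also have "\<dots> = g (axis i 1)"
      unfolding E_def by (subst inner_sum_left_Basis) (simp_all add: B)
    finally show ?thesis .
  qed
  have fm: "(\<lambda>x :: real^'d. \<Prod>i\<in>UNIV. f i (x $ i)) \<in> borel_measurable borel"
  proof (rule borel_measurable_prod)
    fix i
    have "f i \<in> borel_measurable borel" using borel_measurable_integrable[OF f[of i]] by simp
    moreover have "(\<lambda>x :: real^'d. x $ i) \<in> borel_measurable borel"
      by (intro borel_measurable_continuous_onI continuous_intros)
    ultimately show "(\<lambda>x :: real^'d. f i (x $ i)) \<in> borel_measurable borel" by (rule measurable_compose[rotated])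
  qed
  have pe: "(\<Prod>i\<in>UNIV. f i (E g $ i)) = (\<Prod>b\<in>Basis. f (ix b) (g b))" for g
    unfolding reix Ei ix ..
  have pi: "integrable (Pi\<^sub>M Basis (\<lambda>_. lborel)) (\<lambda>g. \<Prod>b\<in>Basis. f (ix b) (g b))"
    by (rule product_integrable_prod) (auto simp: f)
  have "(LINT x|lborel. (\<Prod>i\<in>UNIV. f i ((x :: real^'d) $ i)))
      = (LINT g|Pi\<^sub>M Basis (\<lambda>_. lborel). (\<Prod>i\<in>UNIV. f i (E g $ i)))"
    unfolding lb by (rule integral_distr[OF Em fm])
  also have "\<dots> = (\<Prod>b\<in>Basis. LINT x|lborel. f (ix b) x)"
    unfolding pe by (rule product_integral_prod) (auto simp: f)
  also have "\<dots> = (\<Prod>i\<in>UNIV. LINT x|lborel. f i x)" unfolding reix ix ..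
  finally show "(LINT x|lborel. (\<Prod>i\<in>UNIV. f i ((x :: real^'d) $ i))) = (\<Prod>i\<in>UNIV. LINT x|lborel. f i x)" .
  show "integrable lborel (\<lambda>x :: real^'d. \<Prod>i\<in>UNIV. f i (x $ i))"
    unfolding lb integrable_distr_eq[OF Em fm] pe by (rule pi)
qed

definition gauss :: "real^'d \<Rightarrow> real" where
  "gauss x = exp (- (norm x)\<^sup>2 / 2)"

lemma gauss_prod: "gauss x = (\<Prod>i\<in>UNIV. exp (- (x $ i)\<^sup>2 / 2))"
proof -
  have "(norm x)\<^sup>2 = (\<Sum>i\<in>UNIV. (x $ i)\<^sup>2)"
    by (simp add: norm_vec_def L2_set_def sum_nonneg)
  then show ?thesis by (simp add: gauss_def exp_sum[symmetric] sum_divide_distrib sum_negf)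
qed

lemma gauss_nonneg: "0 \<le> gauss x" and gauss_0: "gauss 0 = 1"
  by (simp_all add: gauss_def)

lemma borel_measurable_gauss [measurable]: "gauss \<in> borel_measurable borel"
  unfolding gauss_def[abs_def] by measurable

lemma has_bochner_integral_iexp_exp_sq:
  fixes u :: real
  shows "has_bochner_integral lborel (\<lambda>t::real. iexp (u * t) * complex_of_real (exp (- t\<^sup>2 / 2)))
    (complex_of_real (sqrt (2 * pi) * exp (- u\<^sup>2 / 2)))"
proof -
  have eq: "iexp (u * t) * complex_of_real (exp (- t\<^sup>2 / 2)) = sqrt (2 * pi) *\<^sub>R (std_normal_density t *\<^sub>R iexp (u * t))" for t
    by (simp add: std_normal_density_def scaleR_conv_of_real)
  have i: "integrable lborel (\<lambda>t. std_normal_density t *\<^sub>R iexp (u * t))"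
  proof (rule Bochner_Integration.integrable_bound)
    show "integrable lborel std_normal_density" by simp
    show "(\<lambda>t. std_normal_density t *\<^sub>R iexp (u * t)) \<in> borel_measurable lborel" by measurable
    show "AE t in lborel. norm (std_normal_density t *\<^sub>R iexp (u * t)) \<le> norm (std_normal_density t)"
      by (rule AE_I2) simp
  qed
  have "(CLINT t|lborel. std_normal_density t *\<^sub>R iexp (u * t)) = char std_normal_distribution u"
    unfolding char_def by (subst integral_density) auto
  then have "(CLINT t|lborel. std_normal_density t *\<^sub>R iexp (u * t)) = complex_of_real (exp (- u\<^sup>2 / 2))"
    by (simp only: char_std_normal_distribution)
  then have "has_bochner_integral lborel (\<lambda>t. std_normal_density t *\<^sub>R iexp (u * t)) (complex_of_real (exp (- u\<^sup>2 / 2)))"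
    using i by (simp only: has_bochner_integral_iff simp_thms)
  then have "has_bochner_integral lborel (\<lambda>t. sqrt (2 * pi) *\<^sub>R (std_normal_density t *\<^sub>R iexp (u * t)))
      (sqrt (2 * pi) *\<^sub>R complex_of_real (exp (- u\<^sup>2 / 2)))"
    by (intro has_bochner_integral_scaleR_right)
  then show ?thesis unfolding eq by (simp only: scaleR_conv_of_real of_real_mult)
qed

lemmas integrable_iexp_exp_sq = integrable.intros[OF has_bochner_integral_iexp_exp_sq]
lemmas integral_iexp_exp_sq = has_bochner_integral_integral_eq[OF has_bochner_integral_iexp_exp_sq]

lemma
  fixes v :: "real^'d"
  shows integrable_iexp_gauss: "integrable lborel (\<lambda>x. iexp (x \<bullet> v) * complex_of_real (gauss x))"
    and integral_iexp_gauss: "(CLINT x|lborel. iexp (x \<bullet> v) * complex_of_real (gauss x))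
      = complex_of_real (sqrt (2 * pi) ^ CARD('d) * gauss v)"
proof -
  have eq: "iexp (x \<bullet> v) * complex_of_real (gauss x)
      = (\<Prod>i\<in>UNIV. iexp (v $ i * (x $ i)) * complex_of_real (exp (- (x $ i)\<^sup>2 / 2)))" for x
  proof -
    have "iexp (x \<bullet> v) = (\<Prod>i\<in>UNIV. iexp (v $ i * (x $ i)))"
      by (simp add: inner_vec_def exp_sum[symmetric] sum_distrib_left[symmetric] mult.commute)
    then show ?thesis unfolding gauss_prod by (simp only: prod.distrib of_real_prod)
  qed
  show "integrable lborel (\<lambda>x. iexp (x \<bullet> v) * complex_of_real (gauss x))"
    unfolding eq by (rule integrable_lborel_prod_vec[OF integrable_iexp_exp_sq])
  have "(CLINT x|lborel. iexp (x \<bullet> v) * complex_of_real (gauss x))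
      = (\<Prod>i\<in>UNIV. complex_of_real (sqrt (2 * pi) * exp (- (v $ i)\<^sup>2 / 2)))"
    unfolding eq integral_lborel_prod_vec[OF integrable_iexp_exp_sq] integral_iexp_exp_sq ..
  also have "\<dots> = complex_of_real (sqrt (2 * pi) ^ CARD('d) * gauss v)"
    unfolding gauss_prod of_real_prod[symmetric] prod.distrib by simp
  finally show "(CLINT x|lborel. iexp (x \<bullet> v) * complex_of_real (gauss x))
      = complex_of_real (sqrt (2 * pi) ^ CARD('d) * gauss v)" .
qed

lemma
  shows integrable_gauss: "integrable lborel (gauss :: real^'d \<Rightarrow> real)"
    and integral_gauss: "(LINT x|lborel. gauss (x :: real^'d)) = sqrt (2 * pi) ^ CARD('d)"
proof -
  have 1: "integrable lborel (\<lambda>x :: real^'d. complex_of_real (gauss x))"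
    "(CLINT x|lborel. complex_of_real (gauss (x :: real^'d))) = complex_of_real (sqrt (2 * pi) ^ CARD('d))"
    using integrable_iexp_gauss[of "0 :: real^'d"] integral_iexp_gauss[of "0 :: real^'d"] by (simp_all add: gauss_0)
  show "integrable lborel (gauss :: real^'d \<Rightarrow> real)" using integrable_Re[OF 1(1)] by simp
  show "(LINT x|lborel. gauss (x :: real^'d)) = sqrt (2 * pi) ^ CARD('d)"
    using 1(2) unfolding integral_complex_of_real of_real_eq_iff .
qed

section \<open>Scaling and weighted Gaussian integrals\<close>

lemma lborel_scale:
  fixes s :: real
  assumes "s > 0"
  shows "lborel = density (distr lborel borel (\<lambda>x :: real^'d. s *\<^sub>R x)) (\<lambda>_. ennreal (s ^ CARD('d)))"
  using lborel_affine[of s "0 :: real^'d"] assms by (simp add: ennreal_power)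

lemma
  fixes F :: "real^'d \<Rightarrow> 'b::{banach, second_countable_topology}"
  assumes s: "s > 0" and F: "integrable lborel F"
  shows integrable_lborel_scale: "integrable lborel (\<lambda>x. F (s *\<^sub>R x))"
    and integral_lborel_scale: "(LINT x|lborel. F (s *\<^sub>R x)) = (1 / s ^ CARD('d)) *\<^sub>R (LINT x|lborel. F x)"
proof -
  have m: "(\<lambda>x :: real^'d. s *\<^sub>R x) \<in> lborel \<rightarrow>\<^sub>M borel" by simp
  have Fm: "F \<in> borel_measurable borel" using borel_measurable_integrable[OF F] by simp
  have Fd: "F \<in> borel_measurable (distr lborel borel (\<lambda>x :: real^'d. s *\<^sub>R x))" using Fm by simp
  have s0: "0 \<le> s ^ CARD('d)" "s ^ CARD('d) \<noteq> 0" using s by auto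
  have "integrable (density (distr lborel borel (\<lambda>x :: real^'d. s *\<^sub>R x)) (\<lambda>_. ennreal (s ^ CARD('d)))) F"
    using F unfolding lborel_scale[OF s, symmetric] .
  then have "integrable (distr lborel borel (\<lambda>x :: real^'d. s *\<^sub>R x)) (\<lambda>x. s ^ CARD('d) *\<^sub>R F x)"
    by (subst (asm) integrable_density[OF Fd]) (auto simp: s0)
  then have "integrable (distr lborel borel (\<lambda>x :: real^'d. s *\<^sub>R x)) F"
    using s0 integrable_scaleR_right[of "1 / s ^ CARD('d)" _ "\<lambda>x. s ^ CARD('d) *\<^sub>R F x"] by simp
  then show "integrable lborel (\<lambda>x. F (s *\<^sub>R x))" unfolding integrable_distr_eq[OF m Fm] .
  have "(LINT x|lborel. F x) = (LINT x|density (distr lborel borel (\<lambda>x :: real^'d. s *\<^sub>R x)) (\<lambda>_. ennreal (s ^ CARD('d))). F x)"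
    unfolding lborel_scale[OF s, symmetric] ..
  also have "\<dots> = (LINT x|distr lborel borel (\<lambda>x :: real^'d. s *\<^sub>R x). s ^ CARD('d) *\<^sub>R F x)"
    by (rule integral_density[OF Fd]) (auto simp: s0)
  also have "\<dots> = s ^ CARD('d) *\<^sub>R (LINT x|lborel. F (s *\<^sub>R x))"
    unfolding integral_scaleR_right integral_distr[OF m Fm] ..
  finally show "(LINT x|lborel. F (s *\<^sub>R x)) = (1 / s ^ CARD('d)) *\<^sub>R (LINT x|lborel. F x)"
    using s0 by simp
qed

lemma nn_integral_lborel_scale:
  fixes F :: "real^'d \<Rightarrow> ennreal"
  assumes s: "s > 0" and F: "F \<in> borel_measurable borel"
  shows "(\<integral>\<^sup>+x. F (s *\<^sub>R x) \<partial>lborel) = ennreal (1 / s ^ CARD('d)) * (\<integral>\<^sup>+x. F x \<partial>lborel)"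
proof -
  have m: "(\<lambda>x :: real^'d. s *\<^sub>R x) \<in> lborel \<rightarrow>\<^sub>M borel" by simp
  have "(\<integral>\<^sup>+x. F x \<partial>lborel) = (\<integral>\<^sup>+x. ennreal (s ^ CARD('d)) * F x \<partial>distr lborel borel (\<lambda>x. s *\<^sub>R x))"
    by (subst lborel_scale[OF s]) (subst nn_integral_density, auto simp: F)
  also have "\<dots> = ennreal (s ^ CARD('d)) * (\<integral>\<^sup>+x. F (s *\<^sub>R x) \<partial>lborel)"
    using F by (simp add: nn_integral_cmult nn_integral_distr[OF m])
  finally have "ennreal (1 / s ^ CARD('d)) * (\<integral>\<^sup>+x. F x \<partial>lborel)
      = (ennreal (1 / s ^ CARD('d)) * ennreal (s ^ CARD('d))) * (\<integral>\<^sup>+x. F (s *\<^sub>R x) \<partial>lborel)"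
    by (simp only: mult.assoc)
  also have "ennreal (1 / s ^ CARD('d)) * ennreal (s ^ CARD('d)) = 1"
    using s by (simp add: ennreal_mult[symmetric])
  finally show ?thesis by simp
qed

text \<open>Combines ln r \<le> r with b r \<le> b^2 + r^2 / 4. The quarter leaves half of the
  exponent of \<open>gauss\<close> over, so a power of the norm costs only a rescaling of the
  Gaussian.\<close>

lemma powr_le_exp:
  fixes r b :: real
  shows "0 \<le> r \<Longrightarrow> 0 < b \<Longrightarrow> r powr b \<le> exp (b\<^sup>2 + r\<^sup>2 / 4)"
proof (cases "r = 0")
  case False
  assume r: "0 \<le> r" and b: "0 < b"
  have "ln r \<le> r - 1" using False r by (intro ln_le_minus_one) simp
  then have "b * ln r \<le> b * r" using b by (intro mult_left_mono) auto
  also have "\<dots> \<le> b\<^sup>2 + r\<^sup>2 / 4" using zero_le_power2[of "b - r / 2"] by (simp add: power2_diff power_divide)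
  finally show ?thesis using False by (simp add: powr_def)
qed simp

lemma nn_integral_powr_gauss_finite:
  assumes b: "b > 0"
  shows "(\<integral>\<^sup>+x. ennreal (norm (x :: real^'d) powr b * gauss x) \<partial>lborel) < \<infinity>"
proof -
  define s :: real where "s = 1 / sqrt 2"
  have s: "s > 0" "s\<^sup>2 = 1 / 2" by (auto simp: s_def power_divide)
  have "norm x powr b * gauss x \<le> exp (b\<^sup>2) * gauss (s *\<^sub>R x)" for x :: "real^'d"
  proof -
    have "norm x powr b * gauss x \<le> exp (b\<^sup>2 + (norm x)\<^sup>2 / 4) * gauss x"
      by (intro mult_right_mono powr_le_exp b gauss_nonneg) simp
    also have "\<dots> = exp (b\<^sup>2) * gauss (s *\<^sub>R x)"
      by (simp add: gauss_def power_mult_distrib s exp_add[symmetric])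
    finally show ?thesis .
  qed
  then have "(\<integral>\<^sup>+x. ennreal (norm (x :: real^'d) powr b * gauss x) \<partial>lborel)
      \<le> (\<integral>\<^sup>+x. ennreal (exp (b\<^sup>2)) * ennreal (gauss (s *\<^sub>R x :: real^'d)) \<partial>lborel)"
    by (intro nn_integral_mono) (simp add: ennreal_mult[symmetric] gauss_nonneg ennreal_leI)
  also have "\<dots> = ennreal (exp (b\<^sup>2)) * (ennreal (1 / s ^ CARD('d)) * (\<integral>\<^sup>+x. ennreal (gauss (x :: real^'d)) \<partial>lborel))"
    by (subst nn_integral_cmult) (simp_all add: nn_integral_lborel_scale[OF s(1), of "\<lambda>x. ennreal (gauss x)"])
  also have "(\<integral>\<^sup>+x. ennreal (gauss (x :: real^'d)) \<partial>lborel) = ennreal (sqrt (2 * pi) ^ CARD('d))"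
    by (subst nn_integral_eq_integral[OF integrable_gauss]) (simp_all add: gauss_nonneg integral_gauss)
  also have "ennreal (exp (b\<^sup>2)) * (ennreal (1 / s ^ CARD('d)) * ennreal (sqrt (2 * pi) ^ CARD('d))) < \<infinity>"
    by (simp add: ennreal_mult_less_top)
  finally show ?thesis .
qed

text \<open>The scaling law behind the rate: \<open>B / s ^ CARD('d)\<close> is of the order of the
  spectral height, and the polynomial weight multiplies it by \<open>1 / s powr b\<close>. A bounded
  total thus ties the admissible height to the width.\<close>

lemma nn_integral_weighted_gauss:
  fixes B s b :: real
  assumes s: "s > 0" and b: "b > 0" and B: "B \<ge> 0"
  defines "Gb \<equiv> enn2real (\<integral>\<^sup>+x. ennreal (norm (x :: real^'d) powr b * gauss x) \<partial>lborel)"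
  shows "(\<integral>\<^sup>+x. ennreal (1 + norm (x :: real^'d) powr b) * ennreal (B * gauss (s *\<^sub>R x)) \<partial>lborel)
    = ennreal (B / s ^ CARD('d) * (sqrt (2 * pi) ^ CARD('d) + Gb / s powr b))"
proof -
  define F :: "real^'d \<Rightarrow> ennreal" where "F x = ennreal (B * gauss x) + ennreal (B / s powr b) * ennreal (norm x powr b * gauss x)" for x
  have F: "F \<in> borel_measurable borel" unfolding F_def by measurable
  have Gb: "(\<integral>\<^sup>+x. ennreal (norm (x :: real^'d) powr b * gauss x) \<partial>lborel) = ennreal Gb" "Gb \<ge> 0"
    using nn_integral_powr_gauss_finite[OF b, where 'd = 'd] by (simp_all add: Gb_def)
  have G0: "(\<integral>\<^sup>+x. ennreal (gauss (x :: real^'d)) \<partial>lborel) = ennreal (sqrt (2 * pi) ^ CARD('d))"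
    by (subst nn_integral_eq_integral[OF integrable_gauss]) (simp_all add: gauss_nonneg integral_gauss)
  have "ennreal (1 + norm x powr b) * ennreal (B * gauss (s *\<^sub>R x)) = F (s *\<^sub>R x)" for x :: "real^'d"
  proof -
    have "(1 + norm x powr b) * (B * gauss (s *\<^sub>R x))
        = B * gauss (s *\<^sub>R x) + B / s powr b * (norm (s *\<^sub>R x) powr b * gauss (s *\<^sub>R x))"
      using s by (simp add: powr_mult field_simps)
    then show ?thesis
      unfolding F_def using B s
      by (simp add: ennreal_mult[symmetric] ennreal_plus[symmetric] gauss_nonneg del: ennreal_plus)
  qed
  then have "(\<integral>\<^sup>+x. ennreal (1 + norm (x :: real^'d) powr b) * ennreal (B * gauss (s *\<^sub>R x)) \<partial>lborel)
      = ennreal (1 / s ^ CARD('d)) * (\<integral>\<^sup>+x. F x \<partial>lborel)"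
    using nn_integral_lborel_scale[OF s F] by simp
  also have "(\<integral>\<^sup>+x. F x \<partial>lborel) = (\<integral>\<^sup>+x. ennreal B * ennreal (gauss (x :: real^'d)) \<partial>lborel)
      + (\<integral>\<^sup>+x. ennreal (B / s powr b) * ennreal (norm (x :: real^'d) powr b * gauss x) \<partial>lborel)"
    unfolding F_def using B by (subst nn_integral_add) (simp_all add: ennreal_mult gauss_nonneg)
  also have "\<dots> = ennreal B * ennreal (sqrt (2 * pi) ^ CARD('d)) + ennreal (B / s powr b) * ennreal Gb"
    by (subst (1 2) nn_integral_cmult) (simp_all add: Gb G0)
  also have "\<dots> = ennreal (B * sqrt (2 * pi) ^ CARD('d) + B / s powr b * Gb)"
    using B s Gb(2) by (simp add: ennreal_mult[symmetric] ennreal_plus[symmetric] del: ennreal_plus)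
  also have "ennreal (1 / s ^ CARD('d)) * \<dots> = ennreal (B / s ^ CARD('d) * (sqrt (2 * pi) ^ CARD('d) + Gb / s powr b))"
    using B s Gb(2) by (subst ennreal_mult[symmetric]) (auto simp: field_simps)
  finally show ?thesis .
qed

section \<open>Two trigonometric and Gaussian sums\<close>

text \<open>As y^2 \<ge> y - 1/4, a Gaussian term is at most twice a power of
  \<open>exp (- x)\<close>, and on each side of \<open>j\<close> the geometric series is at most
  \<open>2 / x\<close>; this gives the 8. The bound is free of \<open>j\<close> and
  \<open>n\<close>, as a bound for row sums of a matrix has to be.\<close>

lemma sum_exp_abs_diff_le:
  fixes x :: real and j :: nat
  assumes x: "0 < x" "x \<le> 1"
  shows "(\<Sum>k\<in>{1..n}. exp (- (x * (real j - real k))\<^sup>2)) \<le> 8 / x"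
proof -
  define q where "q = exp (- x)"
  have q: "0 < q" "q < 1" using x by (auto simp: q_def)
  \<comment> \<open>A lower bound for \<open>1 - exp (- x)\<close> proportional to \<open>x\<close>
    holds only for bounded \<open>x\<close>; here \<open>x \<le> 1\<close> enters.\<close>
  have xq: "x / 2 \<le> 1 - q"
  proof -
    have "1 + x \<le> exp x" by (rule exp_ge_add_one_self)
    then have "q \<le> 1 / (1 + x)" using x by (simp add: q_def exp_minus field_simps)
    moreover have "1 / (1 + x) \<le> 1 - x / 2"
    proof -
      have "(1 - x / 2) * (1 + x) = 1 + x * (1 - x) / 2" by (simp add: field_simps power2_eq_square)
      also have "\<dots> \<ge> 1" using x by simp
      finally show ?thesis using x by (simp add: divide_le_eq)
    qed
    ultimately show ?thesis by linarith
  qed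
  have geo: "(\<Sum>k\<in>K. q ^ f k) \<le> 2 / x" if "finite K" "inj_on f K" for K and f :: "nat \<Rightarrow> nat"
  proof -
    have "(\<Sum>k\<in>K. q ^ f k) = (\<Sum>i\<in>f ` K. q ^ i)" using that by (simp add: sum.reindex)
    also have "\<dots> \<le> (\<Sum>i. q ^ i)" using q that by (intro sum_le_suminf summable_geometric) auto
    also have "\<dots> = 1 / (1 - q)" using q by (intro suminf_geometric) auto
    also have "\<dots> \<le> 1 / (x / 2)" using xq x by (intro divide_left_mono) auto
    finally show ?thesis by simp
  qed
  have bound: "exp (- (x * (real j - real k))\<^sup>2) \<le> 2 * q ^ (if k \<le> j then j - k else k - j)" for k
  proof -
    define d where "d = (if k \<le> j then j - k else k - j)"
    have d: "(real j - real k)\<^sup>2 = (real d)\<^sup>2" by (auto simp: d_def power2_commute)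
    have "x * real d - 1 / 4 \<le> (x * real d)\<^sup>2"
      using zero_le_power2[of "x * real d - 1 / 2"] by (simp add: power2_diff power_divide)
    then have "- (x * (real j - real k))\<^sup>2 \<le> 1 / 4 + - (real d * x)"
      by (simp add: power_mult_distrib d mult.commute)
    then have "exp (- (x * (real j - real k))\<^sup>2) \<le> exp (1 / 4) * q ^ d"
      unfolding q_def exp_of_nat_mult[symmetric] exp_add[symmetric] by simp
    also have "\<dots> \<le> 2 * q ^ d"
    proof (rule mult_right_mono)
      have "exp (1 / 4 :: real) \<le> 1 + 1 / 4 + (1 / 4)\<^sup>2" by (rule exp_bound) auto
      also have "\<dots> \<le> 2" by (simp add: power2_eq_square)
      finally show "exp (1 / 4 :: real) \<le> 2" .
    qed (use q in simp)
    finally show ?thesis by (simp add: d_def)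
  qed
  define A where "A = {k \<in> {1..n}. k \<le> j}"
  define B where "B = {k \<in> {1..n}. \<not> k \<le> j}"
  have "(\<Sum>k\<in>{1..n}. exp (- (x * (real j - real k))\<^sup>2)) \<le> (\<Sum>k\<in>{1..n}. 2 * q ^ (if k \<le> j then j - k else k - j))"
    by (intro sum_mono bound)
  also have "\<dots> = 2 * (\<Sum>k\<in>A \<union> B. q ^ (if k \<le> j then j - k else k - j))"
    unfolding sum_distrib_left by (intro sum.cong) (auto simp: A_def B_def)
  also have "(\<Sum>k\<in>A \<union> B. q ^ (if k \<le> j then j - k else k - j))
      = (\<Sum>k\<in>A. q ^ (if k \<le> j then j - k else k - j)) + (\<Sum>k\<in>B. q ^ (if k \<le> j then j - k else k - j))"
    by (intro sum.union_disjoint) (auto simp: A_def B_def)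
  also have "(\<Sum>k\<in>A. q ^ (if k \<le> j then j - k else k - j)) = (\<Sum>k\<in>A. q ^ (j - k))"
    by (intro sum.cong) (auto simp: A_def)
  also have "(\<Sum>k\<in>B. q ^ (if k \<le> j then j - k else k - j)) = (\<Sum>k\<in>B. q ^ (k - j))"
    by (intro sum.cong) (auto simp: B_def)
  also have "2 * ((\<Sum>k\<in>A. q ^ (j - k)) + (\<Sum>k\<in>B. q ^ (k - j))) \<le> 2 * (2 / x + 2 / x)"
  proof (intro mult_left_mono add_mono geo)
    show "inj_on (\<lambda>k. j - k) A" unfolding A_def inj_on_def by auto
    show "inj_on (\<lambda>k. k - j) B" unfolding B_def inj_on_def by auto
  qed (auto simp: A_def B_def)
  finally show ?thesis by simp
qed

text \<open>The real part of a normalised Dirichlet kernel. As an average of cosines it is a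
  covariance function.\<close>

definition comb :: "nat \<Rightarrow> real \<Rightarrow> real" where
  "comb n r = (\<Sum>k<n. cos (2 * pi * real k * r / real n)) / real n"

lemma abs_comb_le: "\<bar>comb n r\<bar> \<le> 1"
proof -
  have "\<bar>\<Sum>k<n. cos (2 * pi * real k * r / real n)\<bar> \<le> (\<Sum>k<n. 1)"
    by (intro order_trans[OF sum_abs] sum_mono) auto
  then show ?thesis by (cases "n = 0") (auto simp: comb_def divide_le_eq)
qed

lemma comb_0: "n > 0 \<Longrightarrow> comb n 0 = 1"
  by (simp add: comb_def)

text \<open>The sum is the real part of a full geometric sum over powers of an \<open>n\<close>-th
  root of unity, which differs from 1 because \<open>n\<close> does not divide
  \<open>m\<close>.\<close>

lemma comb_int:
  fixes m :: int
  assumes "m \<noteq> 0" "\<bar>m\<bar> < int n"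
  shows "comb n (real_of_int m) = 0"
proof -
  have n: "n > 0" using assms by simp
  define z where "z = cis (2 * pi * real_of_int m / real n)"
  have zk: "z ^ k = cis (2 * pi * real k * real_of_int m / real n)" for k
    unfolding z_def Complex.DeMoivre by (simp add: mult_ac)
  have "z ^ n = 1"
  proof -
    have "2 * pi * real n * real_of_int m / real n = 2 * pi * real_of_int m" using n by simp
    then show ?thesis unfolding zk
      by (simp add: cis_multiple_2pi)
  qed
  moreover have "z \<noteq> 1"
  proof
    assume "z = 1"
    then have "cos (2 * pi * real_of_int m / real n) = 1" by (simp add: z_def complex_eq_iff)
    then obtain k :: int where "2 * pi * real_of_int m / real n = real_of_int k * 2 * pi"
      using cos_one_2pi_int[of "2 * pi * real_of_int m / real n"] by auto
    then have "real_of_int m = real_of_int k * real n" using n by (simp add: field_simps)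
    then have "m = k * int n" by (metis of_int_eq_iff of_int_mult of_int_of_nat_eq)
    then have "k \<noteq> 0" "\<bar>m\<bar> = \<bar>k\<bar> * int n" using assms(1) by (auto simp: abs_mult)
    then have "1 * int n \<le> \<bar>m\<bar>" using n by (metis mult_right_mono zero_less_abs_iff of_nat_0_le_iff zless_imp_add1_zle add_0)
    then show False using assms(2) by simp
  qed
  ultimately have "(\<Sum>k<n. z ^ k) = 0" using geometric_sum[of z n] by simp
  moreover have "Re (\<Sum>k<n. z ^ k) = (\<Sum>k<n. cos (2 * pi * real k * real_of_int m / real n))"
    unfolding Re_sum zk by simp
  ultimately have "(\<Sum>k<n. cos (2 * pi * real k * real_of_int m / real n)) = 0" by simp
  then show ?thesis by (simp add: comb_def)
qed

section \<open>The two covariance functions\<close>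

text \<open>On the points \<open>\<delta> k\<close>, \<open>k \<in> {1..n}\<^sup>d\<close>, \<open>noise_cov\<close> is the covariance of white noise: the
  trigonometric factor \<open>comb n\<close> vanishes at the nonzero integers of modulus less than \<open>n\<close>. The
  Gaussian factor makes it integrable over \<open>\<real>\<^sup>d\<close>, with a weighted integral that is bounded
  uniformly in \<open>n\<close> and \<open>\<delta> \<le> 1\<close>.\<close>

definition noise_cov :: "real \<Rightarrow> real \<Rightarrow> nat \<Rightarrow> real^'d \<Rightarrow> real" where
  "noise_cov a \<delta> n t = a / \<delta> ^ CARD('d) * gauss ((1 / \<delta>) *\<^sub>R t) * (\<Prod>i\<in>UNIV. comb n (t $ i / \<delta>))"

definition bump_cov :: "real \<Rightarrow> real \<Rightarrow> real^'d \<Rightarrow> real^'d \<Rightarrow> real" where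
  "bump_cov \<alpha> w \<theta> t = \<alpha> * gauss (w *\<^sub>R t) * cos (\<theta> \<bullet> t)"

lemma feature_kernel_gauss_diff: "feature_kernel (\<lambda>s t. gauss (c *\<^sub>R (s - t :: real^'d)))"
proof -
  have "feature_kernel (\<lambda>s t :: real^'d. \<Prod>i\<in>UNIV. exp (- (c * s $ i - c * t $ i)\<^sup>2 / 2))"
    by (rule feature_kernel_prod, rule feature_kernel_gauss)
  moreover have "gauss (c *\<^sub>R (s - t)) = (\<Prod>i\<in>UNIV. exp (- (c * s $ i - c * t $ i)\<^sup>2 / 2))" for s t :: "real^'d"
    by (simp add: gauss_prod right_diff_distrib)
  ultimately show ?thesis by simp
qed

lemma feature_kernel_comb: "feature_kernel (\<lambda>s t. comb n (g s - g t))"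
proof -
  have "feature_kernel (\<lambda>s t. \<Sum>k<n. (1 / real n) * cos ((2 * pi * real k / real n * g s) - (2 * pi * real k / real n * g t)))"
    by (intro feature_kernel_sum feature_kernel_mult feature_kernel_const feature_kernel_cos) simp
  moreover have "comb n (g s - g t)
      = (\<Sum>k<n. (1 / real n) * cos ((2 * pi * real k / real n * g s) - (2 * pi * real k / real n * g t)))" for s t
    unfolding comb_def sum_divide_distrib by (intro sum.cong refl) (simp add: algebra_simps diff_divide_distrib)
  ultimately show ?thesis by simp
qed

lemma feature_kernel_noise_cov:
  assumes "a \<ge> 0" "\<delta> > 0"
  shows "feature_kernel (\<lambda>s t :: real^'d. noise_cov a \<delta> n (s - t))"
proof -
  have "feature_kernel (\<lambda>s t :: real^'d. \<Prod>i\<in>UNIV. comb n (s $ i / \<delta> - t $ i / \<delta>))"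
    by (rule feature_kernel_prod, rule feature_kernel_comb)
  then have "feature_kernel (\<lambda>s t :: real^'d. a / \<delta> ^ CARD('d) * gauss ((1 / \<delta>) *\<^sub>R (s - t))
      * (\<Prod>i\<in>UNIV. comb n (s $ i / \<delta> - t $ i / \<delta>)))"
    using assms by (intro feature_kernel_mult feature_kernel_const feature_kernel_gauss_diff) auto
  then show ?thesis by (simp add: noise_cov_def diff_divide_distrib)
qed

lemma feature_kernel_bump_cov:
  assumes "\<alpha> \<ge> 0" shows "feature_kernel (\<lambda>s t :: real^'d. bump_cov \<alpha> w \<theta> (s - t))"
  unfolding bump_cov_def inner_diff_right
  using assms by (intro feature_kernel_mult feature_kernel_const feature_kernel_gauss_diff feature_kernel_cos)

lemma continuous_gauss_scale: "continuous_on UNIV (\<lambda>t :: real^'d. gauss (c *\<^sub>R t))"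
  unfolding gauss_def by (intro continuous_intros) auto

lemma continuous_noise_cov: "continuous_on UNIV (noise_cov a \<delta> n :: real^'d \<Rightarrow> real)"
proof -
  have "continuous_on UNIV (\<lambda>t :: real^'d. comb n (t $ i / \<delta>))" for i
    unfolding comb_def divide_inverse by (intro continuous_intros)
  then show ?thesis unfolding noise_cov_def[abs_def]
    by (intro continuous_on_mult continuous_on_const continuous_gauss_scale continuous_on_prod)
qed

lemma continuous_bump_cov: "continuous_on UNIV (bump_cov \<alpha> w \<theta> :: real^'d \<Rightarrow> real)"
  unfolding bump_cov_def[abs_def]
  by (intro continuous_on_mult continuous_on_const continuous_gauss_scale continuous_on_cos
      continuous_on_inner continuous_on_id)

lemma abs_noise_cov_le:
  assumes "a \<ge> 0" "\<delta> > 0"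
  shows "\<bar>noise_cov a \<delta> n (t :: real^'d)\<bar> \<le> a / \<delta> ^ CARD('d) * gauss ((1 / \<delta>) *\<^sub>R t)"
proof -
  have "\<bar>\<Prod>i\<in>UNIV. comb n (t $ i / \<delta>)\<bar> \<le> 1"
    unfolding abs_prod by (intro prod_le_1) (auto simp: abs_comb_le)
  then have "a / \<delta> ^ CARD('d) * gauss ((1 / \<delta>) *\<^sub>R t) * \<bar>\<Prod>i\<in>UNIV. comb n (t $ i / \<delta>)\<bar>
      \<le> a / \<delta> ^ CARD('d) * gauss ((1 / \<delta>) *\<^sub>R t) * 1"
    using assms by (intro mult_left_mono mult_nonneg_nonneg gauss_nonneg) auto
  then show ?thesis using assms by (simp add: noise_cov_def abs_mult gauss_nonneg)
qed

lemma abs_bump_cov_le: "\<alpha> \<ge> 0 \<Longrightarrow> \<bar>bump_cov \<alpha> w \<theta> t\<bar> \<le> \<alpha> * gauss (w *\<^sub>R t)"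
  using mult_left_mono[of "\<bar>cos (\<theta> \<bullet> t)\<bar>" 1 "\<alpha> * gauss (w *\<^sub>R t)"]
  by (simp add: bump_cov_def abs_mult gauss_nonneg)

lemma integrable_if_gauss_bound:
  fixes k :: "real^'d \<Rightarrow> real"
  assumes "s > 0" "continuous_on UNIV k" "\<And>t. \<bar>k t\<bar> \<le> B * gauss (s *\<^sub>R t)"
  shows "integrable lborel k"
proof (rule Bochner_Integration.integrable_bound)
  show "integrable lborel (\<lambda>t :: real^'d. B * gauss (s *\<^sub>R t))"
    by (intro integrable_mult_right integrable_lborel_scale[OF assms(1) integrable_gauss])
  show "k \<in> borel_measurable lborel"
    unfolding measurable_lborel2 by (rule borel_measurable_continuous_onI[OF assms(2)])
  have "norm (k t) \<le> norm (B * gauss (s *\<^sub>R t))" for t using assms(3)[of t] by simp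
  then show "AE t in lborel. norm (k t) \<le> norm (B * gauss (s *\<^sub>R t))" by (rule AE_I2)
qed

section \<open>Covariances on the observation grid\<close>

definition grid_point :: "real \<Rightarrow> nat^'d \<Rightarrow> real^'d" where
  "grid_point \<delta> k = (\<chi> i. \<delta> * real (k $ i))"

lemma noise_cov_grid:
  assumes \<delta>: "\<delta> > 0" and n: "n > 0" and j: "j \<in> grid n" and k: "k \<in> grid n"
  shows "noise_cov a \<delta> n (grid_point \<delta> j - grid_point \<delta> k :: real^'d) = (if j = k then a / \<delta> ^ CARD('d) else 0)"
proof (cases "j = k")
  case True
  then show ?thesis using n by (simp add: noise_cov_def gauss_0 comb_0)
next
  case False
  then obtain i where i: "j $ i \<noteq> k $ i" by (auto simp: vec_eq_iff)
  have bounds: "j $ i \<in> {1..n}" "k $ i \<in> {1..n}" using j k by (auto simp: grid_def)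
  have "(grid_point \<delta> j - grid_point \<delta> k) $ i / \<delta> = real_of_int (int (j $ i) - int (k $ i))"
    using \<delta> by (simp add: grid_point_def field_simps)
  moreover have "comb n (real_of_int (int (j $ i) - int (k $ i))) = 0"
    by (rule comb_int) (use i bounds in auto)
  ultimately have "comb n ((grid_point \<delta> j - grid_point \<delta> k) $ i / \<delta>) = 0" by simp
  then have "(\<Prod>i\<in>UNIV. comb n ((grid_point \<delta> j - grid_point \<delta> k) $ i / \<delta>)) = 0"
    by (intro prod_zero) auto
  then show ?thesis using False by (simp add: noise_cov_def)
qed

lemma bij_betw_grid: "bij_betw (\<lambda>k. ($) k) (grid n :: (nat^'d) set) (Pi\<^sub>E UNIV (\<lambda>_. {1..n}))"
proof (rule bij_betw_byWitness[where f' = "\<lambda>g. \<chi> i. g i"])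
qed (auto simp: grid_def PiE_UNIV_domain)

lemma finite_grid: "finite (grid n :: (nat^'d) set)"
proof -
  have "finite (Pi\<^sub>E (UNIV :: 'd set) (\<lambda>_. {1..n}))" by (intro finite_PiE) auto
  then show ?thesis using bij_betw_finite[OF bij_betw_grid] by blast
qed

lemma card_grid: "card (grid n :: (nat^'d) set) = n ^ CARD('d)"
  using bij_betw_same_card[OF bij_betw_grid[of n, where 'd = 'd]] by (simp add: card_PiE)

lemma sum_prod_grid:
  fixes f :: "'d::finite \<Rightarrow> nat \<Rightarrow> real"
  shows "(\<Sum>k\<in>grid n. \<Prod>i\<in>UNIV. f i (k $ i)) = (\<Prod>i\<in>UNIV. \<Sum>k\<in>{1..n}. f i k)"
proof -
  have "(\<Prod>i\<in>UNIV. \<Sum>k\<in>{1..n}. f i k) = (\<Sum>g\<in>Pi\<^sub>E UNIV (\<lambda>_. {1..n}). \<Prod>i\<in>UNIV. f i (g i))"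
    by (rule prod_sum_PiE) auto
  also have "\<dots> = (\<Sum>k\<in>grid n. \<Prod>i\<in>UNIV. f i (k $ i))"
    by (rule sum.reindex_bij_betw[OF bij_betw_grid, symmetric])
  finally show ?thesis ..
qed

text \<open>After the squared cosine is bounded by 1, the squared Gaussian factorises over the
  coordinates. Each row sum is then a product of one-dimensional sums of size at most
  \<open>8 / (w * \<delta>)\<close>, and there are \<open>n ^ CARD('d)\<close> rows.\<close>

lemma sum_bump_cov_grid_le:
  fixes \<theta> :: "real^'d"
  assumes w: "0 < w" and \<delta>: "0 < \<delta>" and w\<delta>: "w * \<delta> \<le> 1"
  shows "(\<Sum>j\<in>grid n. \<Sum>k\<in>grid n. (bump_cov \<alpha> w \<theta> (grid_point \<delta> j - grid_point \<delta> k))\<^sup>2)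
    \<le> \<alpha>\<^sup>2 * (8 * real n / (w * \<delta>)) ^ CARD('d)"
proof -
  have pos: "0 < w * \<delta>" using w \<delta> by simp
  have le: "(bump_cov \<alpha> w \<theta> (grid_point \<delta> j - grid_point \<delta> k))\<^sup>2
      \<le> \<alpha>\<^sup>2 * (\<Prod>i\<in>UNIV. exp (- (w * \<delta> * (real (j $ i) - real (k $ i)))\<^sup>2))" for j k :: "nat^'d"
  proof -
    let ?t = "grid_point \<delta> j - grid_point \<delta> k"
    have g: "(gauss (w *\<^sub>R ?t))\<^sup>2 = (\<Prod>i\<in>UNIV. exp (- (w * \<delta> * (real (j $ i) - real (k $ i)))\<^sup>2))"
      unfolding gauss_prod power2_eq_square[of "prod _ _"] prod.distrib[symmetric]
    proof (rule prod.cong[OF refl])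
      fix i
      have e: "(w *\<^sub>R ?t) $ i = w * \<delta> * (real (j $ i) - real (k $ i))"
        by (simp add: grid_point_def algebra_simps)
      show "exp (- ((w *\<^sub>R ?t) $ i)\<^sup>2 / 2) * exp (- ((w *\<^sub>R ?t) $ i)\<^sup>2 / 2)
          = exp (- (w * \<delta> * (real (j $ i) - real (k $ i)))\<^sup>2)"
        unfolding e by (simp add: exp_add[symmetric])
    qed
    have "(cos (\<theta> \<bullet> ?t))\<^sup>2 \<le> 1" by (simp add: abs_square_le_1)
    then have "(\<alpha>\<^sup>2 * (gauss (w *\<^sub>R ?t))\<^sup>2) * (cos (\<theta> \<bullet> ?t))\<^sup>2 \<le> (\<alpha>\<^sup>2 * (gauss (w *\<^sub>R ?t))\<^sup>2) * 1"
      by (intro mult_left_mono) auto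
    then show ?thesis unfolding g[symmetric] by (simp add: bump_cov_def power_mult_distrib)
  qed
  have "(\<Sum>j\<in>grid n. \<Sum>k\<in>grid n. (bump_cov \<alpha> w \<theta> (grid_point \<delta> j - grid_point \<delta> k))\<^sup>2)
      \<le> (\<Sum>j\<in>(grid n :: (nat^'d) set). \<Sum>k\<in>grid n. \<alpha>\<^sup>2 * (\<Prod>i\<in>UNIV. exp (- (w * \<delta> * (real (j $ i) - real (k $ i)))\<^sup>2)))"
    by (intro sum_mono le)
  also have "\<dots> = (\<Sum>j\<in>(grid n :: (nat^'d) set). \<alpha>\<^sup>2 * (\<Prod>i\<in>UNIV. \<Sum>k\<in>{1..n}. exp (- (w * \<delta> * (real (j $ i) - real k))\<^sup>2)))"
  proof (rule sum.cong[OF refl])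
    fix j :: "nat^'d"
    show "(\<Sum>k\<in>grid n. \<alpha>\<^sup>2 * (\<Prod>i\<in>UNIV. exp (- (w * \<delta> * (real (j $ i) - real (k $ i)))\<^sup>2)))
        = \<alpha>\<^sup>2 * (\<Prod>i\<in>UNIV. \<Sum>k\<in>{1..n}. exp (- (w * \<delta> * (real (j $ i) - real k))\<^sup>2))"
      by (simp only: sum_distrib_left[symmetric]
          sum_prod_grid[of "\<lambda>i k. exp (- (w * \<delta> * (real (j $ i) - real k))\<^sup>2)"])
  qed
  also have "\<dots> \<le> (\<Sum>j\<in>(grid n :: (nat^'d) set). \<alpha>\<^sup>2 * (\<Prod>i\<in>(UNIV :: 'd set). 8 / (w * \<delta>)))"
    by (intro sum_mono mult_left_mono prod_mono conjI sum_nonneg sum_exp_abs_diff_le[OF pos w\<delta>]) auto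
  also have "\<dots> = \<alpha>\<^sup>2 * (8 * real n / (w * \<delta>)) ^ CARD('d)"
    by (simp add: card_grid power_mult_distrib power_divide)
  finally show ?thesis .
qed

text \<open>The summand 1 is the bump at \<theta> itself; the \<open>gauss\<close> summand is the
  mirrored bump at -\<theta>, evaluated at \<theta>. The mirrored bump is the price of a real
  covariance, but having the same sign it never reduces the separation, even at \<theta> =
  0.\<close>

lemma fourier_bump_cov:
  fixes \<theta> :: "real^'d"
  assumes w: "w > 0"
  shows "(CLINT h|lborel. iexp (h \<bullet> \<theta>) * complex_of_real (bump_cov \<alpha> w \<theta> h))
    = complex_of_real (\<alpha> / 2 * (sqrt (2 * pi) / w) ^ CARD('d) * (1 + gauss ((2 / w) *\<^sub>R \<theta>)))"
proof -
  have eq: "iexp (h \<bullet> \<theta>) * complex_of_real (bump_cov \<alpha> w \<theta> h)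
      = complex_of_real (\<alpha> / 2) * (iexp ((w *\<^sub>R h) \<bullet> 0) * complex_of_real (gauss (w *\<^sub>R h))
        + iexp ((w *\<^sub>R h) \<bullet> ((2 / w) *\<^sub>R \<theta>)) * complex_of_real (gauss (w *\<^sub>R h)))" for h
  proof -
    have e: "(w *\<^sub>R h) \<bullet> ((2 / w) *\<^sub>R \<theta>) = h \<bullet> \<theta> + h \<bullet> \<theta>" using w by simp
    have f: "iexp (h \<bullet> \<theta>) * complex_of_real (cos (\<theta> \<bullet> h)) = (1 + iexp (h \<bullet> \<theta> + h \<bullet> \<theta>)) / 2"
    proof -
      have c: "complex_of_real (cos x) = (iexp x + iexp (- x)) / 2" for x
        by (simp add: complex_eq_iff Re_exp Im_exp)
      have "iexp x * complex_of_real (cos x) = (iexp x * iexp x + iexp x * iexp (- x)) / 2" for x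
        unfolding c by (simp only: distrib_left times_divide_eq_right)
      moreover have "iexp x * iexp x = iexp (x + x)" for x
        by (simp only: exp_add[symmetric] distrib_left[symmetric] of_real_add)
      moreover have "iexp x * iexp (- x) = 1" for x
        by (simp only: exp_add[symmetric] distrib_left[symmetric] of_real_add[symmetric]) simp
      ultimately have "iexp x * complex_of_real (cos x) = (1 + iexp (x + x)) / 2" for x
        by (simp only: add.commute)
      then show ?thesis by (simp only: inner_commute[of \<theta> h])
    qed
    have "iexp (h \<bullet> \<theta>) * complex_of_real (bump_cov \<alpha> w \<theta> h)
        = (complex_of_real \<alpha> * complex_of_real (gauss (w *\<^sub>R h))) * (iexp (h \<bullet> \<theta>) * complex_of_real (cos (\<theta> \<bullet> h)))"
      by (simp only: bump_cov_def of_real_mult mult_ac)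
    also have "\<dots> = complex_of_real (\<alpha> / 2) * (1 * complex_of_real (gauss (w *\<^sub>R h))
        + iexp (h \<bullet> \<theta> + h \<bullet> \<theta>) * complex_of_real (gauss (w *\<^sub>R h)))"
      unfolding f by (simp add: field_simps)
    finally show ?thesis unfolding e by simp
  qed
  have i: "integrable lborel (\<lambda>h. iexp ((w *\<^sub>R h) \<bullet> v) * complex_of_real (gauss (w *\<^sub>R h)))"
    and I: "(CLINT h|lborel. iexp ((w *\<^sub>R h) \<bullet> v) * complex_of_real (gauss (w *\<^sub>R h)))
      = (1 / w ^ CARD('d)) *\<^sub>R complex_of_real (sqrt (2 * pi) ^ CARD('d) * gauss v)" for v :: "real^'d"
    using integrable_lborel_scale[OF w integrable_iexp_gauss[of v]] integral_lborel_scale[OF w integrable_iexp_gauss[of v]]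
    unfolding integral_iexp_gauss by blast+
  have "\<alpha> / 2 * (1 / w ^ CARD('d) * (sqrt (2 * pi) ^ CARD('d) * 1) + 1 / w ^ CARD('d) * (sqrt (2 * pi) ^ CARD('d) * g))
      = \<alpha> / 2 * (sqrt (2 * pi) / w) ^ CARD('d) * (1 + g)" for g
    by (simp add: power_divide ring_distribs)
  then show ?thesis
    unfolding eq integral_mult_right_zero Bochner_Integration.integral_add[OF i i] I gauss_0
    by (simp only: scaleR_conv_of_real of_real_mult[symmetric] of_real_add[symmetric])
qed

section \<open>Two-point lower bound\<close>

lemma space_field_law: "space (field_law E e \<psi>) = space (real_path_space E)"
  by (simp add: field_law_def)

lemma observations_grid_point:
  "observations \<delta> n \<omega> = (\<lambda>k\<in>grid n. \<omega> (grid_point \<delta> k))"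
  by (simp add: observations_def grid_point_def)

lemma measurable_observations: "observations \<delta> n \<in> real_path_space E \<rightarrow>\<^sub>M Pi\<^sub>M (grid n) (\<lambda>_. borel)"
proof -
  have "(\<lambda>\<omega>. \<lambda>k\<in>grid n. \<omega> (grid_point \<delta> k)) \<in> real_path_space E \<rightarrow>\<^sub>M Pi\<^sub>M (grid n) (\<lambda>_. borel)"
    by (rule measurable_restrict) (rule measurable_path_component)
  then show ?thesis by (simp add: observations_grid_point[abs_def])
qed

text \<open>Division by \<sigma> is meant to turn the null covariance into the identity, and the
  index set \<open>{..<m}\<close> supplies the linear order that a triangular factor needs.\<close>

definition sample_law :: "(nat \<Rightarrow> 't \<Rightarrow> real) \<Rightarrow> real \<Rightarrow> (nat \<Rightarrow> 't) \<Rightarrow> nat \<Rightarrow> (nat \<Rightarrow> real) measure" where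
  "sample_law \<psi> \<sigma> p m = distr (iid_normal UNIV) (Pi\<^sub>M {..<m} (\<lambda>_. borel)) (\<lambda>\<omega>. \<lambda>i\<in>{..<m}. gauss_field \<psi> (p i) \<omega> / \<sigma>)"

lemma measurable_sample:
  "(\<lambda>\<omega>. \<lambda>i\<in>{..<m}. gauss_field \<psi> (p i) \<omega> / \<sigma>) \<in> iid_normal UNIV \<rightarrow>\<^sub>M Pi\<^sub>M {..<m} (\<lambda>_. borel)"
  by (intro measurable_restrict borel_measurable_divide measurable_gauss_field borel_measurable_const)

lemma prob_space_sample_law: "prob_space (sample_law \<psi> \<sigma> p m)"
  unfolding sample_law_def by (rule prob_space.prob_space_distr[OF prob_space_iid_normal measurable_sample])

lemma sets_sample_law: "sets (sample_law \<psi> \<sigma> p m) = sets (Pi\<^sub>M {..<m} (\<lambda>_. borel))"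
  by (simp add: sample_law_def)

lemma char_sample_law:
  assumes \<psi>: "feature_map \<psi> c" and \<sigma>: "\<sigma> > 0"
    and cov: "\<And>i j. i < m \<Longrightarrow> j < m \<Longrightarrow> c (p i) (p j) = \<sigma>\<^sup>2 * C i j"
  shows "(CLINT x|sample_law \<psi> \<sigma> p m. iexp (\<Sum>i<m. a i * x i))
    = exp (- (\<Sum>i<m. \<Sum>j<m. a i * a j * C i j) / 2)"
proof -
  have m: "(\<lambda>x. iexp (\<Sum>i<m. a i * x i)) \<in> borel_measurable (Pi\<^sub>M {..<m} (\<lambda>_. borel))"
  proof -
    have "(\<lambda>x. \<Sum>i<m. a i * x i) \<in> borel_measurable (Pi\<^sub>M {..<m} (\<lambda>_. borel))"
      by (intro borel_measurable_sum borel_measurable_times borel_measurable_const measurable_component_singleton)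
    then show ?thesis by measurable
  qed
  have \<psi>p: "feature_map (\<lambda>k i. \<psi> k (p i)) (\<lambda>i j. c (p i) (p j))"
    using \<psi> by (simp add: feature_map_def)
  have eq: "(\<Sum>i<m. a i * (\<lambda>i\<in>{..<m}. gauss_field \<psi> (p i) \<omega> / \<sigma>) i)
      = (\<Sum>i\<in>{..<m}. (a i / \<sigma>) * gauss_field (\<lambda>k i. \<psi> k (p i)) i \<omega>)" for \<omega>
    by (intro sum.cong refl) (simp add: gauss_field_def)
  have "(CLINT x|sample_law \<psi> \<sigma> p m. iexp (\<Sum>i<m. a i * x i))
      = (CLINT \<omega>|iid_normal UNIV. iexp (\<Sum>i<m. a i * (\<lambda>i\<in>{..<m}. gauss_field \<psi> (p i) \<omega> / \<sigma>) i))"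
    unfolding sample_law_def by (rule integral_distr[OF measurable_sample m])
  also have "\<dots> = exp (- (\<Sum>i\<in>{..<m}. \<Sum>j\<in>{..<m}. (a i / \<sigma>) * (a j / \<sigma>) * c (p i) (p j)) / 2)"
    unfolding eq by (rule char_gauss_field[OF \<psi>p finite_lessThan])
  also have "(\<Sum>i\<in>{..<m}. \<Sum>j\<in>{..<m}. (a i / \<sigma>) * (a j / \<sigma>) * c (p i) (p j)) = (\<Sum>i<m. \<Sum>j<m. a i * a j * C i j)"
    using \<sigma> by (intro sum.cong refl) (simp add: cov power2_eq_square)
  finally show ?thesis .
qed

context
  fixes E :: "'h::{complex_hilbert_space, second_countable_topology} set" and e :: 'h
  assumes E: "complete_orthonormal_system E" and e: "e \<in> E"
begin

text \<open>All observations are multiples of \<open>e\<close>, so the scalar sample determines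
  them: \<open>obs\<close> undoes the scaling by \<sigma> and the enumeration \<open>q\<close>. An
  event about the Hilbert space valued data thus becomes one about a scalar Gaussian vector with the
  same probability.\<close>

lemma measure_field_law_observations:
  fixes \<psi> :: "nat \<Rightarrow> real^'d \<Rightarrow> real" and q :: "nat \<Rightarrow> nat^'d"
  assumes \<psi>: "feature_map \<psi> (\<lambda>s t. k (s - t))" and \<sigma>: "\<sigma> > 0"
    and q: "bij_betw q {..<m} (grid n)"
    and S: "S \<in> sets (Pi\<^sub>M (grid n) (\<lambda>_. borel))"
  defines "obs \<equiv> (\<lambda>y. \<lambda>k\<in>grid n. (\<sigma> * y (the_inv_into {..<m} q k)) *\<^sub>R e)"
  shows "obs \<in> Pi\<^sub>M {..<m} (\<lambda>_. borel) \<rightarrow>\<^sub>M Pi\<^sub>M (grid n) (\<lambda>_. borel)"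
    and "emeasure (field_law E e \<psi>) {\<omega> \<in> space (field_law E e \<psi>). observations \<delta> n \<omega> \<in> S}
      = emeasure (sample_law \<psi> \<sigma> (\<lambda>i. grid_point \<delta> (q i)) m) (obs -` S \<inter> space (Pi\<^sub>M {..<m} (\<lambda>_. borel)))"
proof -
  let ?p = "\<lambda>i. grid_point \<delta> (q i)"
  have ran: "the_inv_into {..<m} q k \<in> {..<m}" "q (the_inv_into {..<m} q k) = k" if "k \<in> grid n" for k
    using q that the_inv_into_into[of q "{..<m}" k "{..<m}"] f_the_inv_into_f[of q "{..<m}" k]
    by (auto simp: bij_betw_def)
  show obsm: "obs \<in> Pi\<^sub>M {..<m} (\<lambda>_. borel) \<rightarrow>\<^sub>M Pi\<^sub>M (grid n) (\<lambda>_. borel)"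
    unfolding obs_def
    by (intro measurable_restrict borel_measurable_scaleR borel_measurable_times borel_measurable_const
        measurable_component_singleton ran)
  note F = measurable_field_path[OF E e \<psi>]
  have "{\<omega> \<in> space (field_law E e \<psi>). observations \<delta> n \<omega> \<in> S} = observations \<delta> n -` S \<inter> space (real_path_space E)"
    by (auto simp: space_field_law)
  then have "emeasure (field_law E e \<psi>) {\<omega> \<in> space (field_law E e \<psi>). observations \<delta> n \<omega> \<in> S}
      = emeasure (iid_normal UNIV) ((\<lambda>\<omega> t. gauss_field \<psi> t \<omega> *\<^sub>R e) -` (observations \<delta> n -` S \<inter> space (real_path_space E))
          \<inter> space (iid_normal UNIV))"
    unfolding field_law_def using emeasure_distr[OF F measurable_sets[OF measurable_observations S]] by (simp only:)
  also have "(\<lambda>\<omega> t. gauss_field \<psi> t \<omega> *\<^sub>R e) -` (observations \<delta> n -` S \<inter> space (real_path_space E)) \<inter> space (iid_normal UNIV)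
      = (\<lambda>\<omega>. \<lambda>i\<in>{..<m}. gauss_field \<psi> (?p i) \<omega> / \<sigma>) -` (obs -` S \<inter> space (Pi\<^sub>M {..<m} (\<lambda>_. borel))) \<inter> space (iid_normal UNIV)"
  proof -
    have "observations \<delta> n (\<lambda>t. gauss_field \<psi> t \<omega> *\<^sub>R e) = obs (\<lambda>i\<in>{..<m}. gauss_field \<psi> (?p i) \<omega> / \<sigma>)" for \<omega>
      unfolding observations_grid_point obs_def using \<sigma> ran by (intro restrict_ext) simp
    moreover have "(\<lambda>t. gauss_field \<psi> t \<omega> *\<^sub>R e) \<in> space (real_path_space E)"
      "(\<lambda>i\<in>{..<m}. gauss_field \<psi> (?p i) \<omega> / \<sigma>) \<in> space (Pi\<^sub>M {..<m} (\<lambda>_. borel))" if "\<omega> \<in> space (iid_normal UNIV)" for \<omega>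
      by (rule measurable_space[OF F that], rule measurable_space[OF measurable_sample that])
    ultimately show ?thesis by auto
  qed
  also have "emeasure (iid_normal UNIV) \<dots> = emeasure (sample_law \<psi> \<sigma> ?p m) (obs -` S \<inter> space (Pi\<^sub>M {..<m} (\<lambda>_. borel)))"
    unfolding sample_law_def by (rule emeasure_distr[OF measurable_sample measurable_sets[OF obsm S], symmetric])
  finally show "emeasure (field_law E e \<psi>) {\<omega> \<in> space (field_law E e \<psi>). observations \<delta> n \<omega> \<in> S}
      = emeasure (sample_law \<psi> \<sigma> ?p m) (obs -` S \<inter> space (Pi\<^sub>M {..<m} (\<lambda>_. borel)))" .
qed

lemma field_law_in_class:
  fixes k :: "real^'d \<Rightarrow> real"
  assumes \<psi>: "feature_map \<psi> (\<lambda>s t. k (s - t))" and k: "continuous_on UNIV k"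
    and L: "(\<integral>\<^sup>+x. ennreal (1 + norm x powr \<beta>) * ennreal \<bar>k x\<bar> \<partial>lborel) \<le> ennreal L"
  shows "spectral_density (field_law E e \<psi>) \<in> spectral_class E \<beta> L"
    and "field_law E e \<psi> \<in> gaussian_spectral_laws E (spectral_density (field_law E e \<psi>))"
proof -
  have k0: "isCont k 0" using k by (simp add: continuous_on_eq_continuous_at)
  have st: "real_stationary_law E (field_law E e \<psi>)" by (rule real_stationary_field_law[OF E e \<psi> k0])
  have tr: "trace_norm E (autocovariance (field_law E e \<psi>) h) = ennreal \<bar>k h\<bar>" for h
    by (rule trace_norm_field_law[OF E e \<psi>])
  have "(\<integral>\<^sup>+h. ennreal \<bar>k h\<bar> \<partial>lborel) \<le> (\<integral>\<^sup>+x. ennreal (1 + norm x powr \<beta>) * ennreal \<bar>k x\<bar> \<partial>lborel)"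
  proof (rule nn_integral_mono)
    fix x
    have "1 * ennreal \<bar>k x\<bar> \<le> ennreal (1 + norm x powr \<beta>) * ennreal \<bar>k x\<bar>"
      by (intro mult_right_mono) (auto simp: ennreal_ge_1)
    then show "ennreal \<bar>k x\<bar> \<le> ennreal (1 + norm x powr \<beta>) * ennreal \<bar>k x\<bar>" by simp
  qed
  also have "\<dots> < \<infinity>" using L by (simp add: order_le_less_trans)
  finally have sd: "has_spectral_density E (field_law E e \<psi>) (spectral_density (field_law E e \<psi>))"
    unfolding has_spectral_density_def tr by simp
  show "spectral_density (field_law E e \<psi>) \<in> spectral_class E \<beta> L"
    unfolding spectral_class_def using st sd L by (auto simp: tr intro!: exI[of _ "field_law E e \<psi>"])
  show "field_law E e \<psi> \<in> gaussian_spectral_laws E (spectral_density (field_law E e \<psi>))"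
    unfolding gaussian_spectral_laws_def using st sd gaussian_field_law[OF E e \<psi>] by simp
qed

end

text \<open>The budget \<open>L\<close> is shared equally between noise and bump, so the sum of the
  two covariances is still admissible. All dependence on the parameters is concentrated in the
  assumptions \<open>K\<close> and \<open>sep\<close>: the first bounds the entropy, the second
  separates the hypotheses.\<close>

lemma two_point_bound:
  fixes E :: "'h::{complex_hilbert_space, second_countable_topology} set"
    and \<theta> :: "real^'d" and g :: "(nat^'d \<Rightarrow> 'h) \<Rightarrow> real^'d \<Rightarrow> 'h \<Rightarrow> 'h"
  assumes E: "complete_orthonormal_system E" "e \<in> E"
    and pos: "a > 0" "\<alpha> \<ge> 0" "w > 0" "\<delta> > 0" "n > 0"
    and class0: "(\<integral>\<^sup>+x. ennreal (1 + norm (x :: real^'d) powr \<beta>) * ennreal \<bar>noise_cov a \<delta> n x\<bar> \<partial>lborel) \<le> ennreal (L / 2)"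
    and class1: "(\<integral>\<^sup>+x. ennreal (1 + norm (x :: real^'d) powr \<beta>) * ennreal \<bar>bump_cov \<alpha> w \<theta> x\<bar> \<partial>lborel) \<le> ennreal (L / 2)"
    and L: "L > 0"
    and K: "(\<Sum>j\<in>grid n. \<Sum>k\<in>grid n. (bump_cov \<alpha> w \<theta> (grid_point \<delta> j - grid_point \<delta> k))\<^sup>2) \<le> K * (a / \<delta> ^ CARD('d))\<^sup>2"
    and sep: "2 * r \<le> 1 / (2 * pi) ^ CARD('d) * (\<alpha> / 2 * (sqrt (2 * pi) / w) ^ CARD('d))"
    and g: "g \<in> estimators E n"
  shows "ennreal (exp (- (K + 2))) \<le> (SUP f \<in> spectral_class E \<beta> L. SUP P \<in> gaussian_spectral_laws E f.
    emeasure P {\<omega> \<in> space P. hs_norm E (\<lambda>z. g (observations \<delta> n \<omega>) \<theta> z - f \<theta> z) \<ge> r})"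
proof -
  define k0 where "k0 = (noise_cov a \<delta> n :: real^'d \<Rightarrow> real)"
  define kb where "kb = bump_cov \<alpha> w \<theta>"
  define k1 where "k1 x = k0 x + kb x" for x
  have fk0: "feature_kernel (\<lambda>s t. k0 (s - t))"
    unfolding k0_def using pos by (intro feature_kernel_noise_cov) auto
  have fkb: "feature_kernel (\<lambda>s t. kb (s - t))"
    unfolding kb_def using pos by (intro feature_kernel_bump_cov)
  obtain \<psi>0 :: "nat \<Rightarrow> real^'d \<Rightarrow> real" where \<psi>0: "feature_map \<psi>0 (\<lambda>s t. k0 (s - t))"
    using fk0 unfolding feature_kernel_def by blast
  obtain \<psi>1 :: "nat \<Rightarrow> real^'d \<Rightarrow> real" where \<psi>1: "feature_map \<psi>1 (\<lambda>s t. k1 (s - t))"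
    using feature_kernel_add[OF fk0 fkb] unfolding feature_kernel_def k1_def by blast
  have cont: "continuous_on UNIV k0" "continuous_on UNIV kb"
    unfolding k0_def kb_def by (rule continuous_noise_cov continuous_bump_cov)+
  then have cont1: "continuous_on UNIV k1" unfolding k1_def[abs_def] by (rule continuous_on_add)
  have int0: "integrable lborel k0"
    unfolding k0_def
    by (rule integrable_if_gauss_bound[OF _ continuous_noise_cov abs_noise_cov_le]) (use pos in auto)
  have intb: "integrable lborel kb"
    unfolding kb_def
    by (rule integrable_if_gauss_bound[OF pos(3) continuous_bump_cov abs_bump_cov_le[OF pos(2)]])
  have int1: "integrable lborel k1" unfolding k1_def[abs_def] by (rule Bochner_Integration.integrable_add[OF int0 intb])
  have half: "ennreal (L / 2) + ennreal (L / 2) = ennreal L" using L by (simp add: ennreal_plus[symmetric] del: ennreal_plus)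
  have cl0: "(\<integral>\<^sup>+x. ennreal (1 + norm x powr \<beta>) * ennreal \<bar>k0 x\<bar> \<partial>lborel) \<le> ennreal L"
    unfolding k0_def using L by (intro order_trans[OF class0 ennreal_leI]) simp
  have cl1: "(\<integral>\<^sup>+x. ennreal (1 + norm x powr \<beta>) * ennreal \<bar>k1 x\<bar> \<partial>lborel) \<le> ennreal L"
  proof -
    have m: "(\<lambda>x :: real^'d. ennreal (1 + norm x powr \<beta>) * ennreal \<bar>k x\<bar>) \<in> borel_measurable lborel"
      if "continuous_on UNIV k" for k :: "real^'d \<Rightarrow> real"
    proof -
      have [measurable]: "k \<in> borel_measurable borel" by (rule borel_measurable_continuous_onI[OF that])
      show ?thesis by measurable
    qed
    have "(\<integral>\<^sup>+x. ennreal (1 + norm x powr \<beta>) * ennreal \<bar>k1 x\<bar> \<partial>lborel)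
        \<le> (\<integral>\<^sup>+x. ennreal (1 + norm x powr \<beta>) * ennreal \<bar>k0 x\<bar> + ennreal (1 + norm x powr \<beta>) * ennreal \<bar>kb x\<bar> \<partial>lborel)"
    proof (rule nn_integral_mono)
      fix x
      have "ennreal \<bar>k1 x\<bar> \<le> ennreal \<bar>k0 x\<bar> + ennreal \<bar>kb x\<bar>"
        unfolding k1_def by (simp add: ennreal_plus[symmetric] ennreal_leI abs_triangle_ineq del: ennreal_plus)
      then show "ennreal (1 + norm x powr \<beta>) * ennreal \<bar>k1 x\<bar>
          \<le> ennreal (1 + norm x powr \<beta>) * ennreal \<bar>k0 x\<bar> + ennreal (1 + norm x powr \<beta>) * ennreal \<bar>kb x\<bar>"
        unfolding distrib_left[symmetric] by (intro mult_left_mono) auto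
    qed
    also have "\<dots> = (\<integral>\<^sup>+x. ennreal (1 + norm x powr \<beta>) * ennreal \<bar>k0 x\<bar> \<partial>lborel)
        + (\<integral>\<^sup>+x. ennreal (1 + norm x powr \<beta>) * ennreal \<bar>kb x\<bar> \<partial>lborel)"
      by (rule nn_integral_add[OF m[OF cont(1)] m[OF cont(2)]])
    also have "\<dots> \<le> ennreal (L / 2) + ennreal (L / 2)"
      using class0 class1 unfolding k0_def kb_def by (rule add_mono)
    finally show ?thesis unfolding half .
  qed
  define P0 where "P0 = field_law E e \<psi>0"
  define P1 where "P1 = field_law E e \<psi>1"
  define f0 where "f0 = spectral_density P0"
  define f1 where "f1 = spectral_density P1"
  have in0: "f0 \<in> spectral_class E \<beta> L" "P0 \<in> gaussian_spectral_laws E f0"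
    unfolding f0_def P0_def by (rule field_law_in_class[OF E \<psi>0 cont(1) cl0])+
  have in1: "f1 \<in> spectral_class E \<beta> L" "P1 \<in> gaussian_spectral_laws E f1"
    unfolding f1_def P1_def by (rule field_law_in_class[OF E \<psi>1 cont1 cl1])+
  define z0 where "z0 = complex_of_real (1 / (2 * pi) ^ CARD('d)) * (CLINT h|lborel. iexp (h \<bullet> \<theta>) * complex_of_real (k0 h))"
  define z1 where "z1 = complex_of_real (1 / (2 * pi) ^ CARD('d)) * (CLINT h|lborel. iexp (h \<bullet> \<theta>) * complex_of_real (k1 h))"
  have f\<theta>: "f0 \<theta> = rank1 e z0" "f1 \<theta> = rank1 e z1"
    unfolding f0_def P0_def z0_def f1_def P1_def z1_def
    by (rule spectral_density_field_law[OF E \<psi>0 int0], rule spectral_density_field_law[OF E \<psi>1 int1])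
  have zdiff: "2 * r \<le> cmod (z1 - z0)"
  proof -
    have "(CLINT h|lborel. iexp (h \<bullet> \<theta>) * complex_of_real (k1 h))
        = (CLINT h|lborel. iexp (h \<bullet> \<theta>) * complex_of_real (k0 h) + iexp (h \<bullet> \<theta>) * complex_of_real (kb h))"
      by (simp only: k1_def of_real_add distrib_left)
    also have "\<dots> = (CLINT h|lborel. iexp (h \<bullet> \<theta>) * complex_of_real (k0 h)) + (CLINT h|lborel. iexp (h \<bullet> \<theta>) * complex_of_real (kb h))"
      by (rule Bochner_Integration.integral_add[OF integrable_iexp_mult[OF int0] integrable_iexp_mult[OF intb]])
    finally have "z1 - z0 = complex_of_real (1 / (2 * pi) ^ CARD('d)) * (CLINT h|lborel. iexp (h \<bullet> \<theta>) * complex_of_real (kb h))"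
      unfolding z0_def z1_def by (simp only: distrib_left add_diff_cancel_left')
    also have "\<dots> = complex_of_real (1 / (2 * pi) ^ CARD('d) *
        (\<alpha> / 2 * (sqrt (2 * pi) / w) ^ CARD('d) * (1 + gauss ((2 / w) *\<^sub>R \<theta>))))"
      unfolding kb_def fourier_bump_cov[OF pos(3)] by (simp only: of_real_mult)
    finally have z: "cmod (z1 - z0) = \<bar>1 / (2 * pi) ^ CARD('d) *
        (\<alpha> / 2 * (sqrt (2 * pi) / w) ^ CARD('d) * (1 + gauss ((2 / w) *\<^sub>R \<theta>)))\<bar>"
      by (simp only: norm_of_real)
    define A where "A = \<alpha> / 2 * (sqrt (2 * pi) / w) ^ CARD('d)"
    have A0: "A \<ge> 0" unfolding A_def using pos by simp
    have "2 * r \<le> 1 / (2 * pi) ^ CARD('d) * (A * 1)" using sep by (simp only: A_def mult_1_right)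
    also have "\<dots> \<le> 1 / (2 * pi) ^ CARD('d) * (A * (1 + gauss ((2 / w) *\<^sub>R \<theta>)))"
      using A0 gauss_nonneg[of "(2 / w) *\<^sub>R \<theta>"] by (intro mult_left_mono) auto
    finally show ?thesis unfolding z A_def[symmetric] by (rule order_trans[OF _ abs_ge_self])
  qed
  have G: "(\<lambda>x. g x \<theta>) \<in> Pi\<^sub>M (grid n) (\<lambda>_. borel) \<rightarrow>\<^sub>M hs_borel E" using g by (simp add: estimators_def)
  define X where "X = space (Pi\<^sub>M (grid n :: (nat^'d) set) (\<lambda>_. borel :: 'h measure))"
  define S0 where "S0 = {x \<in> X. hs_norm E (\<lambda>z. g x \<theta> z - f0 \<theta> z) < r}"
  define S1 where "S1 = {x \<in> X. hs_norm E (\<lambda>z. g x \<theta> z - f1 \<theta> z) < r}"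
  have ghs: "g x \<theta> \<in> hs_operators E" if "x \<in> X" for x
    using measurable_space[OF G] that by (simp add: space_hs_borel X_def)
  have fhs: "f0 \<theta> \<in> hs_operators E" "f1 \<theta> \<in> hs_operators E" unfolding f\<theta> by (rule rank1_hs(1)[OF E])+
  have "{x \<in> X. hs_norm E (\<lambda>z. g x \<theta> z - F z) < r} \<in> sets (Pi\<^sub>M (grid n) (\<lambda>_. borel))" if "F \<in> hs_operators E" for F
  proof -
    have "{x \<in> X. hs_norm E (\<lambda>z. g x \<theta> z - F z) < r}
        = (\<lambda>x. g x \<theta>) -` {A \<in> hs_operators E. hs_norm E (\<lambda>z. A z - F z) < r} \<inter> space (Pi\<^sub>M (grid n) (\<lambda>_. borel))"
      using ghs by (auto simp: X_def)
    then show ?thesis using measurable_sets[OF G hs_borel_dist_set[OF E(1) that]] by simp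
  qed
  then have S: "S0 \<in> sets (Pi\<^sub>M (grid n) (\<lambda>_. borel))" "S1 \<in> sets (Pi\<^sub>M (grid n) (\<lambda>_. borel))"
    unfolding S0_def S1_def using fhs by blast+
  then have Sc: "X - S0 \<in> sets (Pi\<^sub>M (grid n) (\<lambda>_. borel))" "X - S1 \<in> sets (Pi\<^sub>M (grid n) (\<lambda>_. borel))"
    unfolding X_def by (auto intro: sets.compl_sets)
  \<comment> \<open>An estimate within \<open>r\<close> of \<open>f1 \<theta>\<close> errs by at
    least \<open>r\<close> if the truth is \<open>f0\<close>, since the two values are at least
    \<open>2 * r\<close> apart.\<close>
  have disj: "S1 \<subseteq> X - S0"
  proof
    fix x assume x: "x \<in> S1"
    then have xX: "x \<in> X" by (simp add: S1_def)
    interpret M: Metric_space "hs_operators E" "\<lambda>A B. hs_norm E (\<lambda>z. A z - B z)" by (rule Metric_space_hs[OF E(1)])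
    have "hs_norm E (\<lambda>z. f1 \<theta> z - f0 \<theta> z) \<le> hs_norm E (\<lambda>z. f1 \<theta> z - g x \<theta> z) + hs_norm E (\<lambda>z. g x \<theta> z - f0 \<theta> z)"
      by (rule M.triangle[OF fhs(2) ghs[OF xX] fhs(1)])
    moreover have "hs_norm E (\<lambda>z. f1 \<theta> z - f0 \<theta> z) = cmod (z1 - z0)"
      unfolding f\<theta> rank1_diff by (rule rank1_hs(2)[OF E])
    moreover have "hs_norm E (\<lambda>z. f1 \<theta> z - g x \<theta> z) = hs_norm E (\<lambda>z. g x \<theta> z - f1 \<theta> z)" by (rule M.commute)
    ultimately have "r \<le> hs_norm E (\<lambda>z. g x \<theta> z - f0 \<theta> z)" using zdiff x by (simp add: S1_def)
    then show "x \<in> X - S0" using xX by (simp add: S0_def)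
  qed
  define \<sigma> where "\<sigma> = sqrt (a / \<delta> ^ CARD('d))"
  have \<sigma>: "\<sigma> > 0" "\<sigma>\<^sup>2 = a / \<delta> ^ CARD('d)" using pos by (auto simp: \<sigma>_def)
  define m where "m = card (grid n :: (nat^'d) set)"
  obtain q where q: "bij_betw q {..<m} (grid n :: (nat^'d) set)"
    using ex_bij_betw_nat_finite[OF finite_grid, of n] unfolding m_def atLeast0LessThan by blast
  have qg: "q i \<in> grid n" if "i < m" for i using q that by (auto simp: bij_betw_def)
  have qinj: "q i = q j \<longleftrightarrow> i = j" if "i < m" "j < m" for i j
    using q that by (auto simp: bij_betw_def inj_on_def)
  define p where "p i = grid_point \<delta> (q i)" for i
  define M where "M i j = kb (p i - p j) / \<sigma>\<^sup>2" for i j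
  define \<mu>0 where "\<mu>0 = sample_law \<psi>0 \<sigma> p m"
  define \<mu>1 where "\<mu>1 = sample_law \<psi>1 \<sigma> p m"
  have cov0: "k0 (p i - p j) = \<sigma>\<^sup>2 * (if i = j then 1 else 0)" if "i < m" "j < m" for i j
    unfolding k0_def p_def noise_cov_grid[OF pos(4,5) qg[OF that(1)] qg[OF that(2)]] \<sigma> qinj[OF that] by simp
  have cov1: "k1 (p i - p j) = \<sigma>\<^sup>2 * ((if i = j then 1 else 0) + M i j)" if "i < m" "j < m" for i j
    unfolding k1_def cov0[OF that] M_def using \<sigma>(1) by (simp add: distrib_left)
  have char0: "(CLINT x|\<mu>0. iexp (\<Sum>i<m. b i * x i)) = exp (- (\<Sum>i<m. (b i)\<^sup>2) / 2)" for b
  proof -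
    have "(\<Sum>i<m. \<Sum>j<m. b i * b j * (if i = j then 1 else 0)) = (\<Sum>i<m. (b i)\<^sup>2)"
      by (intro sum.cong refl) (simp add: power2_eq_square if_distrib cong: if_cong)
    moreover have "(CLINT x|\<mu>0. iexp (\<Sum>i<m. b i * x i)) = exp (- (\<Sum>i<m. \<Sum>j<m. b i * b j * (if i = j then 1 else 0)) / 2)"
      unfolding \<mu>0_def by (rule char_sample_law[OF \<psi>0 \<sigma>(1) cov0])
    ultimately show ?thesis by (simp only:)
  qed
  have char1: "(CLINT x|\<mu>1. iexp (\<Sum>i<m. b i * x i))
      = exp (- (\<Sum>i<m. \<Sum>j<m. b i * b j * ((if i = j then 1 else 0) + M i j)) / 2)" for b
    unfolding \<mu>1_def by (rule char_sample_law[OF \<psi>1 \<sigma>(1) cov1])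
  have Msym: "M i j = M j i" for i j unfolding M_def using feature_kernel_sym[OF fkb, of "p i" "p j"] by simp
  have fkM: "feature_kernel (\<lambda>i j. kb (p i - p j))"
  proof -
    obtain \<psi> :: "nat \<Rightarrow> real^'d \<Rightarrow> real" where "feature_map \<psi> (\<lambda>s t. kb (s - t))"
      using fkb unfolding feature_kernel_def by blast
    then have "feature_map (\<lambda>k i. \<psi> k (p i)) (\<lambda>i j. kb (p i - p j))" by (simp add: feature_map_def)
    then show ?thesis unfolding feature_kernel_def by blast
  qed
  have Mpsd: "0 \<le> (\<Sum>i<m. \<Sum>j<m. x i * x j * M i j)" for x
  proof -
    have "(\<Sum>i<m. \<Sum>j<m. x i * x j * M i j) = (\<Sum>i<m. \<Sum>j<m. x i * x j * kb (p i - p j)) / \<sigma>\<^sup>2"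
      unfolding M_def sum_divide_distrib by simp
    then show ?thesis using feature_kernel_psd[OF fkM, of x "{..<m}"] by simp
  qed
  have MK: "(\<Sum>i<m. \<Sum>j<m. (M i j)\<^sup>2) \<le> K"
  proof -
    have "(\<Sum>i<m. \<Sum>j<m. (M i j)\<^sup>2)
        = (\<Sum>i<m. \<Sum>j<m. (kb (grid_point \<delta> (q i) - grid_point \<delta> (q j)))\<^sup>2) / (\<sigma>\<^sup>2)\<^sup>2"
      unfolding M_def p_def sum_divide_distrib power_divide ..
    also have "(\<Sum>i<m. \<Sum>j<m. (kb (grid_point \<delta> (q i) - grid_point \<delta> (q j)))\<^sup>2)
        = (\<Sum>j\<in>grid n. \<Sum>k\<in>grid n. (kb (grid_point \<delta> j - grid_point \<delta> k))\<^sup>2)"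
      by (subst sum.reindex_bij_betw[OF q, of "\<lambda>j. \<Sum>k\<in>grid n. (kb (grid_point \<delta> j - grid_point \<delta> k))\<^sup>2", symmetric])
         (intro sum.cong refl sum.reindex_bij_betw[OF q])
    also have "\<dots> / (\<sigma>\<^sup>2)\<^sup>2 \<le> K"
      using K \<sigma>(1) unfolding kb_def \<sigma>(2)[symmetric] by (simp add: pos_divide_le_eq)
    finally show ?thesis .
  qed
  have K0: "0 \<le> K"
  proof -
    have "0 \<le> (\<Sum>i<m. \<Sum>j<m. (M i j)\<^sup>2)" by (intro sum_nonneg) simp
    then show ?thesis using MK by simp
  qed
  define obs where "obs = (\<lambda>y. \<lambda>k\<in>grid n. (\<sigma> * y (the_inv_into {..<m} q k)) *\<^sub>R e)"
  have obsm: "obs \<in> Pi\<^sub>M {..<m} (\<lambda>_. borel) \<rightarrow>\<^sub>M Pi\<^sub>M (grid n) (\<lambda>_. borel)"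
    unfolding obs_def by (rule measure_field_law_observations(1)[OF E \<psi>0 \<sigma>(1) q S(1)])
  define R where "R A = obs -` A \<inter> space (Pi\<^sub>M {..<m} (\<lambda>_. borel))" for A
  have Rs: "R A \<in> sets (Pi\<^sub>M {..<m} (\<lambda>_. borel))" if "A \<in> sets (Pi\<^sub>M (grid n) (\<lambda>_. borel))" for A
    unfolding R_def by (rule measurable_sets[OF obsm that])
  have tr0: "emeasure P0 {\<omega> \<in> space P0. observations \<delta> n \<omega> \<in> A} = emeasure \<mu>0 (R A)"
    if "A \<in> sets (Pi\<^sub>M (grid n) (\<lambda>_. borel))" for A
    unfolding P0_def \<mu>0_def R_def obs_def p_def[abs_def]
    by (rule measure_field_law_observations(2)[OF E \<psi>0 \<sigma>(1) q that])
  have tr1: "emeasure P1 {\<omega> \<in> space P1. observations \<delta> n \<omega> \<in> A} = emeasure \<mu>1 (R A)"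
    if "A \<in> sets (Pi\<^sub>M (grid n) (\<lambda>_. borel))" for A
    unfolding P1_def \<mu>1_def R_def obs_def p_def[abs_def]
    by (rule measure_field_law_observations(2)[OF E \<psi>1 \<sigma>(1) q that])
  interpret \<mu>0: prob_space \<mu>0 unfolding \<mu>0_def by (rule prob_space_sample_law)
  interpret \<mu>1: prob_space \<mu>1 unfolding \<mu>1_def by (rule prob_space_sample_law)
  have obsX: "observations \<delta> n \<omega> \<in> X" if "\<omega> \<in> space P" "P = P0 \<or> P = P1" for \<omega> P
    using that measurable_space[OF measurable_observations] unfolding X_def P0_def P1_def
    by (auto simp: space_field_law)
  have ev0: "emeasure P0 {\<omega> \<in> space P0. hs_norm E (\<lambda>z. g (observations \<delta> n \<omega>) \<theta> z - f0 \<theta> z) \<ge> r} = emeasure \<mu>0 (R (X - S0))"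
  proof -
    have "{\<omega> \<in> space P0. hs_norm E (\<lambda>z. g (observations \<delta> n \<omega>) \<theta> z - f0 \<theta> z) \<ge> r}
        = {\<omega> \<in> space P0. observations \<delta> n \<omega> \<in> X - S0}"
      using obsX[of _ P0] by (auto simp: S0_def not_less)
    then show ?thesis using tr0[OF Sc(1)] by simp
  qed
  have ev1: "emeasure P1 {\<omega> \<in> space P1. hs_norm E (\<lambda>z. g (observations \<delta> n \<omega>) \<theta> z - f1 \<theta> z) \<ge> r} = emeasure \<mu>1 (R (X - S1))"
  proof -
    have "{\<omega> \<in> space P1. hs_norm E (\<lambda>z. g (observations \<delta> n \<omega>) \<theta> z - f1 \<theta> z) \<ge> r}
        = {\<omega> \<in> space P1. observations \<delta> n \<omega> \<in> X - S1}"
      using obsX[of _ P1] by (auto simp: S1_def not_less)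
    then show ?thesis using tr1[OF Sc(2)] by simp
  qed
  have upper: "emeasure P {\<omega> \<in> space P. hs_norm E (\<lambda>z. g (observations \<delta> n \<omega>) \<theta> z - f \<theta> z) \<ge> r}
      \<le> (SUP f \<in> spectral_class E \<beta> L. SUP P \<in> gaussian_spectral_laws E f.
        emeasure P {\<omega> \<in> space P. hs_norm E (\<lambda>z. g (observations \<delta> n \<omega>) \<theta> z - f \<theta> z) \<ge> r})"
    if "f \<in> spectral_class E \<beta> L" "P \<in> gaussian_spectral_laws E f" for f P
    by (rule SUP_upper2[OF that(1)], rule SUP_upper[OF that(2)])
  show ?thesis
  \<comment> \<open>Either the estimator already fails under \<open>P1\<close> with probability at
    least 1/2, or its success event \<open>S1\<close> has at least that probability there. In the
    second case the testing bound preserves some mass of \<open>S1\<close> under \<open>P0\<close>,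
    where \<open>S1\<close> means failure.\<close>
  proof (cases "measure \<mu>1 (R (X - S1)) \<ge> 1 / 2")
    case True
    have "exp (- (K + 2)) \<le> exp (- 1 :: real)" using K0 by simp
    also have "\<dots> \<le> 1 / 2"
    proof -
      have "(2::real) \<le> exp 1" using exp_ge_add_one_self[of 1] by simp
      then show ?thesis by (simp add: exp_minus field_simps)
    qed
    finally have "exp (- (K + 2)) \<le> measure \<mu>1 (R (X - S1))" using True by simp
    then have "ennreal (exp (- (K + 2))) \<le> emeasure \<mu>1 (R (X - S1))"
      unfolding \<mu>1.emeasure_eq_measure by (rule ennreal_leI)
    also have "\<dots> \<le> (SUP f \<in> spectral_class E \<beta> L. SUP P \<in> gaussian_spectral_laws E f.
        emeasure P {\<omega> \<in> space P. hs_norm E (\<lambda>z. g (observations \<delta> n \<omega>) \<theta> z - f \<theta> z) \<ge> r})"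
      unfolding ev1[symmetric] by (rule upper[OF in1])
    finally show ?thesis .
  next
    case False
    have sp: "space \<mu>1 = space (Pi\<^sub>M {..<m} (\<lambda>_. borel))"
      unfolding \<mu>1_def by (rule sets_eq_imp_space_eq[OF sets_sample_law])
    have S1X: "S1 \<subseteq> X" by (auto simp: S1_def)
    have "space \<mu>1 - R (X - S1) = R S1"
      using measurable_space[OF obsm] S1X unfolding sp R_def X_def by auto
    moreover have "R (X - S1) \<in> sets \<mu>1" unfolding \<mu>1_def sets_sample_law by (rule Rs[OF Sc(2)])
    ultimately have "measure \<mu>1 (R S1) \<ge> 1 / 2" using False \<mu>1.prob_compl[of "R (X - S1)"] by simp
    then have "exp (- (K + 2)) \<le> measure \<mu>0 (R S1)"
      by (intro gaussian_test_lower_bound[OF \<mu>0.prob_space_axioms _ \<mu>1.prob_space_axioms _ char0 char1 Msym Mpsd MK Rs[OF S(2)]])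
         (simp_all add: \<mu>0_def \<mu>1_def sets_sample_law)
    also have "\<dots> \<le> measure \<mu>0 (R (X - S0))"
    proof (rule \<mu>0.finite_measure_mono)
      show "R S1 \<subseteq> R (X - S0)" unfolding R_def using disj by auto
      show "R (X - S0) \<in> sets \<mu>0" unfolding \<mu>0_def sets_sample_law by (rule Rs[OF Sc(1)])
    qed
    finally have "ennreal (exp (- (K + 2))) \<le> emeasure \<mu>0 (R (X - S0))"
      unfolding \<mu>0.emeasure_eq_measure by (rule ennreal_leI)
    also have "\<dots> \<le> (SUP f \<in> spectral_class E \<beta> L. SUP P \<in> gaussian_spectral_laws E f.
        emeasure P {\<omega> \<in> space P. hs_norm E (\<lambda>z. g (observations \<delta> n \<omega>) \<theta> z - f \<theta> z) \<ge> r})"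
      unfolding ev0[symmetric] by (rule upper[OF in0])
    finally show ?thesis .
  qed
qed

section \<open>Choice of the parameters\<close>

theorem theorem6p2:
  fixes E :: "'h::{complex_hilbert_space, second_countable_topology} set"
    and \<beta> L :: real
    and \<theta>\<^sub>0 :: "real^'d"
    and \<delta> :: "nat \<Rightarrow> real"
  assumes "(UNIV :: 'h set) \<noteq> {0}"
    and "complete_orthonormal_system E"
    and "\<beta> > 0" and "L > 0"
    and "\<And>n. n \<ge> 1 \<Longrightarrow> \<delta> n > 0"
    and "\<delta> \<longlonglongrightarrow> 0"
    and "filterlim (\<lambda>n. real n * \<delta> n) at_top sequentially"
  shows "liminf (\<lambda>n.
           INF g \<in> (estimators E n :: ((nat^'d \<Rightarrow> 'h) \<Rightarrow> real^'d \<Rightarrow> 'h \<Rightarrow> 'h) set).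
           SUP f \<in> spectral_class E \<beta> L.
           SUP P \<in> gaussian_spectral_laws E f.
             emeasure P {\<omega> \<in> space P.
               hs_norm E (\<lambda>z. g (observations (\<delta> n) n \<omega>) \<theta>\<^sub>0 z - f \<theta>\<^sub>0 z)
                 \<ge> (real n * \<delta> n) powr (- (real CARD('d) * \<beta> / (2 * \<beta> + real CARD('d))))}) > 0"
proof -
  note b = \<open>\<beta> > 0\<close> and Lpos = \<open>L > 0\<close>
  obtain e where e: "e \<in> E"
  proof -
    obtain x :: 'h where "x \<noteq> 0" using assms(1) by auto
    then have "E \<noteq> {}" using complete_orthonormal_systemD(2)[OF assms(2), of x] by blast
    then show ?thesis using that by blast
  qed
  \<comment> \<open>\<open>a\<close> and \<open>\<kappa>\<close> keep the weighted integrals of \<open>noise_cov\<close> and \<open>bump_cov\<close> below \<open>L / 2\<close>; \<open>\<alpha>\<close> makes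
    the two spectral densities differ by at least \<open>2 * r n\<close> at \<open>\<theta>\<^sub>0\<close>; \<open>h n powr \<beta> = r n\<close> and
    \<open>h n ^ D * (r n)\<^sup>2 * N n ^ D = 1\<close>.\<close>
  define D where "D = CARD('d)"
  define T where "T = (2 * pi) ^ D"
  define S where "S = sqrt (2 * pi) ^ D"
  define Gb where "Gb = enn2real (\<integral>\<^sup>+x. ennreal (norm (x :: real^'d) powr \<beta> * gauss x) \<partial>lborel)"
  define q where "q = 2 * \<beta> + real D"
  define N where "N n = real n * \<delta> n" for n
  define r where "r n = N n powr (- (real D * \<beta> / q))" for n
  define h where "h n = N n powr (- (real D / q))" for n
  define a where "a = L / (2 * (S + Gb))"
  define \<kappa> where "\<kappa> = (16 * T * (Gb + 1) / (S * L)) powr (1 / \<beta>)"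
  define w where "w n = \<kappa> * h n" for n
  define \<alpha> where "\<alpha> n = 4 * T / S * w n ^ D * r n" for n
  define K where "K = 16 * T\<^sup>2 / S\<^sup>2 * 8 ^ D * \<kappa> ^ D / a\<^sup>2"
  have D: "D > 0" by (simp add: D_def)
  have T: "T > 0" and S: "S > 0" by (auto simp: T_def S_def)
  have Gb0: "Gb \<ge> 0" by (simp add: Gb_def)
  have q: "q > 0" using b by (simp add: q_def)
  have a: "a > 0" using Lpos S Gb0 by (auto simp: a_def)
  have \<kappa>: "\<kappa> > 0" using T Gb0 S Lpos by (auto simp: \<kappa>_def)
  have \<kappa>b: "\<kappa> powr \<beta> = 16 * T * (Gb + 1) / (S * L)"
    unfolding \<kappa>_def powr_powr using b T Gb0 S Lpos by simp
  have N_lim: "filterlim N at_top sequentially" unfolding N_def[abs_def] by (rule assms(7))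
  have r_lim: "r \<longlonglongrightarrow> 0" unfolding r_def using D b q by (intro tendsto_neg_powr[OF _ N_lim]) auto
  have "h \<longlonglongrightarrow> 0" unfolding h_def using D q by (intro tendsto_neg_powr[OF _ N_lim]) auto
  then have w_lim: "w \<longlonglongrightarrow> 0" unfolding w_def by (rule tendsto_mult_right_zero)
  \<comment> \<open>\<open>\<delta> n < 1\<close> bounds the weighted noise integral independently
    of \<open>n\<close>; \<open>r n < L / (16 * T)\<close> limits the unweighted mass of the bump;
    and \<open>w n < 1\<close> together with \<open>\<delta> n < 1\<close> gives the condition
    \<open>w n * \<delta> n \<le> 1\<close> of the grid sum.\<close>
  have ev: "\<forall>\<^sub>F n in sequentially. n \<ge> 1 \<and> \<delta> n < 1 \<and> r n < L / (16 * T) \<and> w n < 1"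
    using eventually_ge_at_top[of 1] order_tendstoD(2)[OF assms(6), of 1] order_tendstoD(2)[OF r_lim, of "L / (16 * T)"]
      order_tendstoD(2)[OF w_lim, of 1] Lpos T by (auto simp: eventually_conj_iff)
  have bound: "ennreal (exp (- (K + 2))) \<le> (INF g \<in> (estimators E n :: ((nat^'d \<Rightarrow> 'h) \<Rightarrow> real^'d \<Rightarrow> 'h \<Rightarrow> 'h) set).
           SUP f \<in> spectral_class E \<beta> L.
           SUP P \<in> gaussian_spectral_laws E f.
             emeasure P {\<omega> \<in> space P.
               hs_norm E (\<lambda>z. g (observations (\<delta> n) n \<omega>) \<theta>\<^sub>0 z - f \<theta>\<^sub>0 z) \<ge> r n})"
    if n: "n \<ge> 1" "\<delta> n < 1" "r n < L / (16 * T)" "w n < 1" for n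
  proof (rule INF_greatest)
    fix g :: "(nat^'d \<Rightarrow> 'h) \<Rightarrow> real^'d \<Rightarrow> 'h \<Rightarrow> 'h" assume g: "g \<in> estimators E n"
    have \<delta>: "\<delta> n > 0" by (rule assms(5)[OF n(1)])
    have Npos: "N n > 0" using \<delta> n(1) by (simp add: N_def)
    have hpos: "h n > 0" using Npos by (simp add: h_def)
    have rpos: "r n > 0" using Npos by (simp add: r_def)
    have wpos: "w n > 0" using hpos \<kappa> by (simp add: w_def)
    have \<alpha>0: "\<alpha> n \<ge> 0" using T S wpos rpos by (simp add: \<alpha>_def)
    have hb: "h n powr \<beta> = r n" by (simp add: h_def r_def powr_powr)
    have wb: "w n powr \<beta> = \<kappa> powr \<beta> * r n" using \<kappa> hpos by (simp add: w_def powr_mult hb)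
    show "ennreal (exp (- (K + 2))) \<le> (SUP f \<in> spectral_class E \<beta> L. SUP P \<in> gaussian_spectral_laws E f.
        emeasure P {\<omega> \<in> space P. hs_norm E (\<lambda>z. g (observations (\<delta> n) n \<omega>) \<theta>\<^sub>0 z - f \<theta>\<^sub>0 z) \<ge> r n})"
    proof (rule two_point_bound[OF assms(2) e a \<alpha>0 wpos \<delta> _ _ _ Lpos _ _ g])
      show "0 < n" using n by simp
      have s: "1 / \<delta> n > 0" using \<delta> by simp
      have "(\<integral>\<^sup>+x. ennreal (1 + norm (x :: real^'d) powr \<beta>) * ennreal \<bar>noise_cov a (\<delta> n) n x\<bar> \<partial>lborel)
          \<le> (\<integral>\<^sup>+x. ennreal (1 + norm (x :: real^'d) powr \<beta>) * ennreal (a / \<delta> n ^ D * gauss ((1 / \<delta> n) *\<^sub>R x)) \<partial>lborel)"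
        unfolding D_def using a \<delta> by (intro nn_integral_mono mult_left_mono ennreal_leI abs_noise_cov_le) auto
      also have "\<dots> = ennreal (a / \<delta> n ^ D / (1 / \<delta> n) ^ D * (S + Gb / (1 / \<delta> n) powr \<beta>))"
        unfolding D_def S_def Gb_def by (rule nn_integral_weighted_gauss[OF s b]) (use a \<delta> in auto)
      also have "\<dots> \<le> ennreal (L / 2)"
      proof (rule ennreal_leI)
        have "\<delta> n powr \<beta> \<le> 1" using \<delta> n(2) b powr_mono2[of \<beta> "\<delta> n" 1] by simp
        then have "Gb * \<delta> n powr \<beta> \<le> Gb * 1" using Gb0 by (intro mult_left_mono)
        then have "a * (S + Gb * \<delta> n powr \<beta>) \<le> a * (S + Gb)" using a by (intro mult_left_mono) auto
        also have "\<dots> = L / 2" using S Gb0 by (simp add: a_def field_simps)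
        finally have "a * (S + Gb * \<delta> n powr \<beta>) \<le> L / 2" .
        moreover have "a / \<delta> n ^ D / (1 / \<delta> n) ^ D = a" using \<delta> by (simp add: power_one_over)
        moreover have "Gb / (1 / \<delta> n) powr \<beta> = Gb * \<delta> n powr \<beta>" using \<delta> by (simp add: powr_divide)
        ultimately show "a / \<delta> n ^ D / (1 / \<delta> n) ^ D * (S + Gb / (1 / \<delta> n) powr \<beta>) \<le> L / 2" by (simp only:)
      qed
      finally show "(\<integral>\<^sup>+x. ennreal (1 + norm (x :: real^'d) powr \<beta>) * ennreal \<bar>noise_cov a (\<delta> n) n x\<bar> \<partial>lborel) \<le> ennreal (L / 2)" .
      have "(\<integral>\<^sup>+x. ennreal (1 + norm (x :: real^'d) powr \<beta>) * ennreal \<bar>bump_cov (\<alpha> n) (w n) \<theta>\<^sub>0 x\<bar> \<partial>lborel)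
          \<le> (\<integral>\<^sup>+x. ennreal (1 + norm (x :: real^'d) powr \<beta>) * ennreal (\<alpha> n * gauss (w n *\<^sub>R x)) \<partial>lborel)"
        by (intro nn_integral_mono mult_left_mono ennreal_leI abs_bump_cov_le \<alpha>0) auto
      also have "\<dots> = ennreal (\<alpha> n / w n ^ D * (S + Gb / w n powr \<beta>))"
        unfolding D_def S_def Gb_def by (rule nn_integral_weighted_gauss[OF wpos b \<alpha>0])
      also have "\<dots> \<le> ennreal (L / 2)"
      proof (rule ennreal_leI)
        \<comment> \<open>Of the budget \<open>L / 2\<close> the unweighted part of the integral
          takes \<open>4 * T * r n\<close>, at most \<open>L / 4\<close>. The weighted part does not
          depend on \<open>n\<close>, because \<open>w n powr \<beta>\<close> is proportional to
          \<open>r n\<close>, and \<kappa> was chosen to keep it below \<open>L / 4\<close>.\<close>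
        have \<alpha>w: "\<alpha> n / w n ^ D = 4 * T / S * r n" using wpos by (simp add: \<alpha>_def)
        have "\<alpha> n / w n ^ D * (S + Gb / w n powr \<beta>) = 4 * T * r n + 4 * T * Gb / (S * \<kappa> powr \<beta>)"
          unfolding \<alpha>w wb using rpos S \<kappa> by (simp add: field_simps)
        \<comment> \<open>With \<open>Gb + 1\<close> in place of \<open>Gb\<close>, positivity of
          \<kappa> follows from \<open>Gb \<ge> 0\<close> alone; the price is the harmless factor
          \<open>Gb / (Gb + 1)\<close>.\<close>
        also have "4 * T * Gb / (S * \<kappa> powr \<beta>) = L / 4 * (Gb / (Gb + 1))"
        proof -
          have "4 * T * Gb / (S * (16 * T * G / (S * L))) = L / 4 * (Gb / G)" if "G > 0" for G
            using that T S Lpos by (simp add: field_simps)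
          then show ?thesis unfolding \<kappa>b using Gb0 by simp
        qed
        also have "\<dots> \<le> L / 4 * 1" using Lpos Gb0 by (intro mult_left_mono) auto
        also have "4 * T * r n + L / 4 * 1 \<le> L / 2"
        proof -
          have "16 * T * r n \<le> L" using n(3) T by (simp add: field_simps)
          then show ?thesis by simp
        qed
        finally show "\<alpha> n / w n ^ D * (S + Gb / w n powr \<beta>) \<le> L / 2" by simp
      qed
      finally show "(\<integral>\<^sup>+x. ennreal (1 + norm (x :: real^'d) powr \<beta>) * ennreal \<bar>bump_cov (\<alpha> n) (w n) \<theta>\<^sub>0 x\<bar> \<partial>lborel) \<le> ennreal (L / 2)" .
      have "w n * \<delta> n \<le> 1" using wpos \<delta> n(2,4) by (intro mult_le_one) auto
      then have "(\<Sum>j\<in>grid n. \<Sum>k\<in>grid n. (bump_cov (\<alpha> n) (w n) \<theta>\<^sub>0 (grid_point (\<delta> n) j - grid_point (\<delta> n) k))\<^sup>2)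
          \<le> (\<alpha> n)\<^sup>2 * (8 * real n / (w n * \<delta> n)) ^ D"
        unfolding D_def by (rule sum_bump_cov_grid_le[OF wpos \<delta>])
      also have "\<dots> = K * (a / \<delta> n ^ D)\<^sup>2"
      proof -
        \<comment> \<open>The three exponents of \<open>N n\<close> add up to 0 exactly because
          \<open>q = 2 * \<beta> + real D\<close>; here the rate is determined.\<close>
        have hN: "h n ^ D * (r n)\<^sup>2 * N n ^ D = 1"
        proof -
          have "h n ^ D * (r n)\<^sup>2 * N n ^ D = N n powr (- (real D / q) * real D) * N n powr (- (real D * \<beta> / q) * 2) * N n powr real D"
            using Npos by (simp add: h_def r_def powr_power powr_realpow[symmetric] powr_powr)
          also have "\<dots> = N n powr (- (real D / q) * real D + - (real D * \<beta> / q) * 2 + real D)"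
            by (simp only: powr_add)
          also have "- (real D / q) * real D + - (real D * \<beta> / q) * 2 + real D = 0"
          proof -
            have "- (real D / q) * real D + - (real D * \<beta> / q) * 2 = - (real D * q / q)"
              by (simp add: q_def add_divide_distrib[symmetric] algebra_simps)
            then show ?thesis using q by simp
          qed
          finally show ?thesis using Npos by simp
        qed
        have "(\<alpha> n)\<^sup>2 * (8 * real n / (w n * \<delta> n)) ^ D
            = (16 * T\<^sup>2 / S\<^sup>2 * 8 ^ D) * ((w n ^ D)\<^sup>2 / w n ^ D) * (r n)\<^sup>2 * (real n ^ D / \<delta> n ^ D)"
          by (simp add: \<alpha>_def power_mult_distrib power_divide mult_ac)
        also have "(w n ^ D)\<^sup>2 / w n ^ D = \<kappa> ^ D * h n ^ D"
          using wpos by (simp add: power2_eq_square w_def power_mult_distrib)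
        also have "real n ^ D / \<delta> n ^ D = N n ^ D / (\<delta> n ^ D)\<^sup>2"
          using \<delta> by (simp add: N_def power_mult_distrib power2_eq_square)
        also have "(16 * T\<^sup>2 / S\<^sup>2 * 8 ^ D) * (\<kappa> ^ D * h n ^ D) * (r n)\<^sup>2 * (N n ^ D / (\<delta> n ^ D)\<^sup>2)
            = (16 * T\<^sup>2 / S\<^sup>2 * 8 ^ D * \<kappa> ^ D) * (h n ^ D * (r n)\<^sup>2 * N n ^ D) / (\<delta> n ^ D)\<^sup>2"
          by (simp add: mult_ac)
        also have "\<dots> = (16 * T\<^sup>2 / S\<^sup>2 * 8 ^ D * \<kappa> ^ D) / (\<delta> n ^ D)\<^sup>2" unfolding hN by (simp only: mult_1_right)
        also have "\<dots> = K * (a / \<delta> n ^ D)\<^sup>2"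
          using a by (simp add: K_def power_divide)
        finally show ?thesis .
      qed
      finally show "(\<Sum>j\<in>grid n. \<Sum>k\<in>grid n. (bump_cov (\<alpha> n) (w n) \<theta>\<^sub>0 (grid_point (\<delta> n) j - grid_point (\<delta> n) k))\<^sup>2)
          \<le> K * (a / \<delta> n ^ CARD('d))\<^sup>2" unfolding D_def .
      \<comment> \<open>The factor \<open>4 * T / S\<close> in \<alpha> cancels the Fourier
        normalisation, the Gaussian integral and the halving caused by the cosine, and leaves the
        separation \<open>2 * r n\<close>.\<close>
      have "1 / T * (\<alpha> n / 2 * (sqrt (2 * pi) / w n) ^ D) = 2 * r n"
        using wpos T S by (simp add: \<alpha>_def power_divide S_def[symmetric])
      then show "2 * r n \<le> 1 / (2 * pi) ^ CARD('d) * (\<alpha> n / 2 * (sqrt (2 * pi) / w n) ^ CARD('d))"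
        unfolding D_def T_def by simp
    qed
  qed
  have "0 < ennreal (exp (- (K + 2)))" by simp
  also have "\<dots> \<le> liminf (\<lambda>n.
           INF g \<in> (estimators E n :: ((nat^'d \<Rightarrow> 'h) \<Rightarrow> real^'d \<Rightarrow> 'h \<Rightarrow> 'h) set).
           SUP f \<in> spectral_class E \<beta> L.
           SUP P \<in> gaussian_spectral_laws E f.
             emeasure P {\<omega> \<in> space P.
               hs_norm E (\<lambda>z. g (observations (\<delta> n) n \<omega>) \<theta>\<^sub>0 z - f \<theta>\<^sub>0 z) \<ge> r n})"
    by (rule Liminf_bounded, rule eventually_mono[OF ev]) (use bound in blast)
  finally show ?thesis unfolding r_def N_def D_def q_def .
qed

end
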